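(* Given a deterministic regex $\alpha$ over $\Sigma$ with $n$ occurrences of terminal symbols or variable references and with $k$ variables, and given $w\in\Sigma^*$, one can decide in time $O(|\Sigma||\alpha|n+k|w|)$ whether $w\in\mathcal{L}(\alpha)$.
   Context: Regex. Let $\Sigma$ be a finite terminal alphabet ($|\Sigma|\ge 2$ unless otherwise noted) and $\Xi$ an infinite variable alphabet disjoint from $\Sigma$. The set $\mathsf{RX}$ of regex, with $\mathsf{var}(\alpha)\subset\Xi$ the set of variables occurring in $\alpha$, is defined recursively: every $a\in\Sigma\cup\{\varepsilon\}$ is a regex; $\&x$ (variable reference) for $x\in\Xi$; $(\alpha\cdot\beta)$, $(\alpha\vee\beta)$, $(\alpha^+)$ for $\alpha,\beta\in\mathsf{RX}$; and $\langle x:\alpha\rangle$ (variable binding) for $\alpha\in\mathsf{RX}$ and $x\in\Xi\setminus\mathsf{var}(\alpha)$. Also $\emptyset$ is a regex, but may not occur inside another regex. $\alpha^*$ abbreviates $\varepsilon\vee\alpha^+$; a nonempty set $A\subseteq\Sigma$ abbreviates $\bigvee_{a\in A}a$. Let $\Gamma=\{[_x,]_x\mid x\in\Xi\}$. The ref-language $\mathcal{R}(\alpha)\subseteq(\Sigma\cup\Xi\cup\Gamma)^*$ is given by $\mathcal{R}(\emptyset)=\emptyset$, $\mathcal{R}(a)=\{a\}$ for $a\in\Sigma\cup\{\varepsilon\}$, $\mathcal{R}(\&x)=\{x\}$, $\mathcal{R}(\langle x:\alpha\rangle)=[_x\mathcal{R}(\alpha)]_x$, $\mathcal{R}(\alpha\cdot\beta)=\mathcal{R}(\alpha)\mathcal{R}(\beta)$,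 $\mathcal{R}(\alpha\vee\beta)=\mathcal{R}(\alpha)\cup\mathcal{R}(\beta)$, $\mathcal{R}(\alpha^+)=\mathcal{R}(\alpha)^+$. For $r\in\mathcal{R}(\alpha)$, the dereference $\mathcal{D}(r)\in\Sigma^*$ is obtained by replacing each occurrence of a variable $x$ by $v$, where $[_x v]_x$ is the nearest such factor to the left of this occurrence (or by $\varepsilon$ if there is none; variables inside $v$ are replaced likewise), and then deleting all symbols of $\Gamma$. $\mathcal{L}(\alpha)=\{\mathcal{D}(r)\mid r\in\mathcal{R}(\alpha)\}$. Deterministic regex. Let $\alpha_{\mathcal{R}}$ be the regular expression over $\Sigma\cup\Xi\cup\Gamma$ obtained from $\alpha$ by replacing each $\langle x:\beta\rangle$ by $[_x\beta_{\mathcal{R}}]_x$ and each $\&x$ by $x$. The marked regex $\tilde\alpha$ is obtained from $\alpha_{\mathcal{R}}$ by attaching to each occurrence of a symbol $\chi\in\Sigma\cup\Xi\cup\Gamma$ its own unique number $i$, written $\chi_{(i)}$; $\mathcal{R}(\tilde\alpha)$ is the language of marked ref-words it generates. $\tilde A$ denotes the set of marked symbols from $A$. A regex $\alpha$ is not deterministic if there exist $\rho_1,\rho_2\in\mathcal{R}(\tilde\alpha)$, $r,s_1,s_2\in(\tilde\Sigma\cup\tilde\Xi\cup\tilde\Gamma)^*$ and $\gamma_1,\gamma_2\in\tilde\Gamma^*$ such that one of the following holds: (1) $\rho_1=r\gamma_1a_{(i)}s_1$ and $\rho_2=r\gamma_2a_{(j)}s_2$ with $a\in\Sigma$, $i\ne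 j$; (2) $\rho_1=r\gamma_1x_{(i)}s_1$ and $\rho_2=r\gamma_2\chi_{(j)}s_2$ with $x\in\Xi$, $\chi\in\Sigma\cup\Xi$, $i\neq j$; (3) $\rho_1=r\gamma_1\chi_{(i)}s_1$ and $\rho_2=r\gamma_2\chi_{(i)}s_2$ with $\chi\in\Sigma\cup\Xi$, $\gamma_1\ne\gamma_2$; (4) $\rho_1=r\gamma_1$ and $\rho_2=r\gamma_2$ with $\gamma_1\neq\gamma_2$. Otherwise $\alpha$ is deterministic.
   Formalization: In the time bound, n and k are replaced by max(1,n) and max(1,k): read literally, k = 0 would leave no time to read w (e.g. for a^+) and n = 0 no time to read α; for n, k ≥ 1 the bound is unchanged. *)

theory Defs
  imports Main
begin

section \<open>Regex with variables\<close>

text \<open>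
  The terminal alphabet and the variable alphabet are two separate type parameters, so they are
  disjoint. The datatype alone is too liberal: \<open>Empty\<close> may occur only at top level, and a binding
  of \<open>x\<close> must not contain \<open>x\<close>; see \<open>is_regex\<close>. The set \<open>vars \<alpha>\<close> contains referenced as well as
  bound variables.
\<close>

datatype (lits: 'a, vars: 'v) regex =
    Empty
  | Eps
  | Lit 'a
  | Ref 'v
  | Cat "('a, 'v) regex" "('a, 'v) regex"
  | Alt "('a, 'v) regex" "('a, 'v) regex"
  | Plus "('a, 'v) regex"
  | Bind 'v "('a, 'v) regex"

fun is_nonempty_regex :: "('a, 'v) regex \<Rightarrow> bool" where
  "is_nonempty_regex Empty \<longleftrightarrow> False"
| "is_nonempty_regex Eps \<longleftrightarrow> True"
| "is_nonempty_regex (Lit a) \<longleftrightarrow> True"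
| "is_nonempty_regex (Ref x) \<longleftrightarrow> True"
| "is_nonempty_regex (Cat \<alpha> \<beta>) \<longleftrightarrow> is_nonempty_regex \<alpha> \<and> is_nonempty_regex \<beta>"
| "is_nonempty_regex (Alt \<alpha> \<beta>) \<longleftrightarrow> is_nonempty_regex \<alpha> \<and> is_nonempty_regex \<beta>"
| "is_nonempty_regex (Plus \<alpha>) \<longleftrightarrow> is_nonempty_regex \<alpha>"
| "is_nonempty_regex (Bind x \<alpha>) \<longleftrightarrow> is_nonempty_regex \<alpha> \<and> x \<notin> vars \<alpha>"

definition is_regex :: "('a, 'v) regex \<Rightarrow> bool" where
  "is_regex \<alpha> \<longleftrightarrow> \<alpha> = Empty \<or> is_nonempty_regex \<alpha>"

text \<open>The length of a regex, up to a constant factor: the number of nodes of its syntax tree.\<close>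

fun regex_length :: "('a, 'v) regex \<Rightarrow> nat" where
  "regex_length Empty = 1"
| "regex_length Eps = 1"
| "regex_length (Lit a) = 1"
| "regex_length (Ref x) = 1"
| "regex_length (Cat \<alpha> \<beta>) = regex_length \<alpha> + regex_length \<beta> + 1"
| "regex_length (Alt \<alpha> \<beta>) = regex_length \<alpha> + regex_length \<beta> + 1"
| "regex_length (Plus \<alpha>) = regex_length \<alpha> + 1"
| "regex_length (Bind x \<alpha>) = regex_length \<alpha> + 1"

fun occurrences :: "('a, 'v) regex \<Rightarrow> nat" where
  "occurrences Empty = 0"
| "occurrences Eps = 0"
| "occurrences (Lit a) = 1"
| "occurrences (Ref x) = 1"
| "occurrences (Cat \<alpha> \<beta>) = occurrences \<alpha> + occurrences \<beta>"
| "occurrences (Alt \<alpha> \<beta>) = occurrences \<alpha> + occurrences \<beta>"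
| "occurrences (Plus \<alpha>) = occurrences \<alpha>"
| "occurrences (Bind x \<alpha>) = occurrences \<alpha>"


section \<open>Ref-words and the language of a regex\<close>

text \<open>\<open>Open x\<close> and \<open>Close x\<close> are the brackets \<open>[\<^sub>x\<close> and \<open>]\<^sub>x\<close>.\<close>

datatype ('a, 'v) symbol = Term 'a | Var 'v | Open 'v | Close 'v

fun is_bracket :: "('a, 'v) symbol \<Rightarrow> bool" where
  "is_bracket (Term a) = False"
| "is_bracket (Var x) = False"
| "is_bracket (Open x) = True"
| "is_bracket (Close x) = True"

definition lang_conc :: "'s list set \<Rightarrow> 's list set \<Rightarrow> 's list set" where
  "lang_conc A B = {u @ v | u v. u \<in> A \<and> v \<in> B}"

definition lang_plus :: "'s list set \<Rightarrow> 's list set" where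
  "lang_plus A = {concat us | us. us \<noteq> [] \<and> set us \<subseteq> A}"

fun ref_language :: "('a, 'v) regex \<Rightarrow> ('a, 'v) symbol list set" where
  "ref_language Empty = {}"
| "ref_language Eps = {[]}"
| "ref_language (Lit a) = {[Term a]}"
| "ref_language (Ref x) = {[Var x]}"
| "ref_language (Cat \<alpha> \<beta>) = lang_conc (ref_language \<alpha>) (ref_language \<beta>)"
| "ref_language (Alt \<alpha> \<beta>) = ref_language \<alpha> \<union> ref_language \<beta>"
| "ref_language (Plus \<alpha>) = lang_plus (ref_language \<alpha>)"
| "ref_language (Bind x \<alpha>) = {[Open x] @ u @ [Close x] | u. u \<in> ref_language \<alpha>}"

text \<open>
  \<open>nearest_factor x r = Some (p, v)\<close> means \<open>r = p [\<^sub>x v ]\<^sub>x q\<close>, where the displayed \<open>]\<^sub>x\<close> is the last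
  one in \<open>r\<close> and the displayed \<open>[\<^sub>x\<close> is the last one before it. In a ref-word of a regex, brackets
  of the same variable are never nested, so this is the rightmost factor \<open>[\<^sub>x v ]\<^sub>x\<close> of \<open>r\<close>.
\<close>

definition nearest_factor ::
  "'v \<Rightarrow> ('a, 'v) symbol list \<Rightarrow> (('a, 'v) symbol list \<times> ('a, 'v) symbol list) option" where
  "nearest_factor x r =
    (case dropWhile (\<lambda>s. s \<noteq> Close x) (rev r) of
       [] \<Rightarrow> None
     | _ # t \<Rightarrow>
         (case dropWhile (\<lambda>s. s \<noteq> Open x) t of
            [] \<Rightarrow> None
          | _ # t' \<Rightarrow> Some (rev t', rev (takeWhile (\<lambda>s. s \<noteq> Open x) t))))"

lemma nearest_factor_SomeD:
  assumes "nearest_factor x r = Some (p, v)"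
  shows "\<exists>q. r = p @ [Open x] @ v @ [Close x] @ q \<and>
             Close x \<notin> set q \<and> Open x \<notin> set v"
proof -
  let ?c = "\<lambda>s. s \<noteq> Close x" and ?o = "\<lambda>s. s \<noteq> Open x"
  obtain c t where t: "dropWhile ?c (rev r) = c # t"
    using assms by (auto simp: nearest_factor_def split: list.splits)
  obtain d t' where t': "dropWhile ?o t = d # t'"
    using assms t by (auto simp: nearest_factor_def split: list.splits)
  have c: "c = Close x" and d: "d = Open x"
    using t t' by (auto simp: dropWhile_eq_Cons_conv)
  have p: "p = rev t'" and v: "v = rev (takeWhile ?o t)"
    using assms t t' by (auto simp: nearest_factor_def)
  have "rev r = takeWhile ?c (rev r) @ Close x # takeWhile ?o t @ Open x # t'"
    using takeWhile_dropWhile_id[of ?c "rev r"] takeWhile_dropWhile_id[of ?o t]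
    unfolding t t' c d by simp
  then have "rev (rev r) = rev (takeWhile ?c (rev r) @ Close x # takeWhile ?o t @ Open x # t')"
    by (rule arg_cong)
  then have "r = p @ [Open x] @ v @ [Close x] @ rev (takeWhile ?c (rev r))"
    using p v by simp
  moreover have "Close x \<notin> set (rev (takeWhile ?c (rev r)))" "Open x \<notin> set v"
    using v by (auto dest: set_takeWhileD)
  ultimately show ?thesis by blast
qed

text \<open>
  \<open>deref_after p u\<close> dereferences the factor \<open>u\<close> of a ref-word in which \<open>u\<close> is preceded by \<open>p\<close>;
  each variable occurrence in \<open>u\<close> is replaced according to what stands to its left.
\<close>

function deref_after :: "('a, 'v) symbol list \<Rightarrow> ('a, 'v) symbol list \<Rightarrow> 'a list" where
  "deref_after p [] = []"
| "deref_after p (Term a # u) = a # deref_after (p @ [Term a]) u"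
| "deref_after p (Open x # u) = deref_after (p @ [Open x]) u"
| "deref_after p (Close x # u) = deref_after (p @ [Close x]) u"
| "deref_after p (Var x # u) =
    (case nearest_factor x p of
       None \<Rightarrow> []
     | Some (p', v) \<Rightarrow> deref_after (p' @ [Open x]) v)
    @ deref_after (p @ [Var x]) u"
  by pat_completeness auto
termination
proof (relation "measures [\<lambda>(p, u). length p + length u, \<lambda>(p, u). length u]", goal_cases)
  case (5 p x u pv p' v)
  then show ?case by (auto dest!: nearest_factor_SomeD)
qed auto

definition deref :: "('a, 'v) symbol list \<Rightarrow> 'a list" where
  "deref r = deref_after [] r"

definition language :: "('a, 'v) regex \<Rightarrow> 'a list set" where
  "language \<alpha> = deref ` ref_language \<alpha>"


section \<open>Deterministic regex\<close>

datatype 's rexp =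
    RZero
  | ROne
  | RAtom 's
  | RConc "'s rexp" "'s rexp"
  | RAlt "'s rexp" "'s rexp"
  | RPlus "'s rexp"

fun rexp_lang :: "'s rexp \<Rightarrow> 's list set" where
  "rexp_lang RZero = {}"
| "rexp_lang ROne = {[]}"
| "rexp_lang (RAtom s) = {[s]}"
| "rexp_lang (RConc e f) = lang_conc (rexp_lang e) (rexp_lang f)"
| "rexp_lang (RAlt e f) = rexp_lang e \<union> rexp_lang f"
| "rexp_lang (RPlus e) = lang_plus (rexp_lang e)"

text \<open>The regular expression \<open>\<alpha>\<^sub>R\<close>.\<close>

fun ref_rexp :: "('a, 'v) regex \<Rightarrow> ('a, 'v) symbol rexp" where
  "ref_rexp Empty = RZero"
| "ref_rexp Eps = ROne"
| "ref_rexp (Lit a) = RAtom (Term a)"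
| "ref_rexp (Ref x) = RAtom (Var x)"
| "ref_rexp (Cat \<alpha> \<beta>) = RConc (ref_rexp \<alpha>) (ref_rexp \<beta>)"
| "ref_rexp (Alt \<alpha> \<beta>) = RAlt (ref_rexp \<alpha>) (ref_rexp \<beta>)"
| "ref_rexp (Plus \<alpha>) = RPlus (ref_rexp \<alpha>)"
| "ref_rexp (Bind x \<alpha>) = RConc (RAtom (Open x)) (RConc (ref_rexp \<alpha>) (RAtom (Close x)))"

lemma rexp_lang_ref_rexp: "rexp_lang (ref_rexp \<alpha>) = ref_language \<alpha>"
  by (induction \<alpha>) (auto simp: lang_conc_def)

text \<open>\<open>mark i e\<close> numbers the atoms of \<open>e\<close> from left to right, starting with \<open>i\<close>, and also
  returns the next unused number.\<close>

fun mark :: "nat \<Rightarrow> 's rexp \<Rightarrow> ('s \<times> nat) rexp \<times> nat" where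
  "mark i RZero = (RZero, i)"
| "mark i ROne = (ROne, i)"
| "mark i (RAtom s) = (RAtom (s, i), Suc i)"
| "mark i (RConc e f) =
    (let (e', j) = mark i e; (f', k) = mark j f in (RConc e' f', k))"
| "mark i (RAlt e f) =
    (let (e', j) = mark i e; (f', k) = mark j f in (RAlt e' f', k))"
| "mark i (RPlus e) = (let (e', j) = mark i e in (RPlus e', j))"

definition marked_ref_language :: "('a, 'v) regex \<Rightarrow> (('a, 'v) symbol \<times> nat) list set" where
  "marked_ref_language \<alpha> = rexp_lang (fst (mark 1 (ref_rexp \<alpha>)))"

definition nondeterministic :: "('a, 'v) regex \<Rightarrow> bool" where
  "nondeterministic \<alpha> \<longleftrightarrow>
    (\<exists>\<rho>\<^sub>1 \<in> marked_ref_language \<alpha>. \<exists>\<rho>\<^sub>2 \<in> marked_ref_language \<alpha>. \<exists>r s\<^sub>1 s\<^sub>2 \<gamma>\<^sub>1 \<gamma>\<^sub>2.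
       (\<forall>g \<in> set \<gamma>\<^sub>1 \<union> set \<gamma>\<^sub>2. is_bracket (fst g)) \<and>
       ((\<exists>a i j. i \<noteq> j \<and>
           \<rho>\<^sub>1 = r @ \<gamma>\<^sub>1 @ [(Term a, i)] @ s\<^sub>1 \<and> \<rho>\<^sub>2 = r @ \<gamma>\<^sub>2 @ [(Term a, j)] @ s\<^sub>2)
      \<or> (\<exists>x \<chi> i j. \<not> is_bracket \<chi> \<and> i \<noteq> j \<and>
           \<rho>\<^sub>1 = r @ \<gamma>\<^sub>1 @ [(Var x, i)] @ s\<^sub>1 \<and> \<rho>\<^sub>2 = r @ \<gamma>\<^sub>2 @ [(\<chi>, j)] @ s\<^sub>2)
      \<or> (\<exists>\<chi> i. \<not> is_bracket \<chi> \<and> \<gamma>\<^sub>1 \<noteq> \<gamma>\<^sub>2 \<and>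
           \<rho>\<^sub>1 = r @ \<gamma>\<^sub>1 @ [(\<chi>, i)] @ s\<^sub>1 \<and> \<rho>\<^sub>2 = r @ \<gamma>\<^sub>2 @ [(\<chi>, i)] @ s\<^sub>2)
      \<or> (\<rho>\<^sub>1 = r @ \<gamma>\<^sub>1 \<and> \<rho>\<^sub>2 = r @ \<gamma>\<^sub>2 \<and> \<gamma>\<^sub>1 \<noteq> \<gamma>\<^sub>2)))"

definition deterministic :: "('a, 'v) regex \<Rightarrow> bool" where
  "deterministic \<alpha> \<longleftrightarrow> \<not> nondeterministic \<alpha>"


section \<open>Random access machines\<close>

text \<open>
  A unit-cost random access machine in the style of Cook and Reckhow: natural-number cells with
  direct and indirect addressing, addition and truncated subtraction but no multiplication, and a
  sequential read-only input. In \<open>Load r s\<close> and \<open>Store r s\<close> the address is the content of cell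
  \<open>s\<close> and of cell \<open>r\<close>, respectively. Jump targets are absolute.
\<close>

datatype instr =
    Const nat nat
  | Move nat nat
  | Add nat nat nat
  | Sub nat nat nat
  | Load nat nat
  | Store nat nat
  | Read nat
  | Jump nat
  | JumpZero nat nat
  | Accept
  | Reject

text \<open>
  \<open>ram_run P t pc inp m = Some b\<close> iff the program \<open>P\<close>, started at instruction \<open>pc\<close> with remaining
  input \<open>inp\<close> and memory \<open>m\<close>, halts with verdict \<open>b\<close> after executing at most \<open>t\<close> instructions.
  Reading past the end of the input yields \<open>0\<close>; leaving the program gives no verdict.
\<close>

fun ram_run :: "instr list \<Rightarrow> nat \<Rightarrow> nat \<Rightarrow> nat list \<Rightarrow> (nat \<Rightarrow> nat) \<Rightarrow> bool option" where
  "ram_run P 0 pc inp m = None"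
| "ram_run P (Suc t) pc inp m =
    (if pc < length P then
       (case P ! pc of
          Const r c \<Rightarrow> ram_run P t (Suc pc) inp (m(r := c))
        | Move r s \<Rightarrow> ram_run P t (Suc pc) inp (m(r := m s))
        | Add r s u \<Rightarrow> ram_run P t (Suc pc) inp (m(r := m s + m u))
        | Sub r s u \<Rightarrow> ram_run P t (Suc pc) inp (m(r := m s - m u))
        | Load r s \<Rightarrow> ram_run P t (Suc pc) inp (m(r := m (m s)))
        | Store r s \<Rightarrow> ram_run P t (Suc pc) inp (m(m r := m s))
        | Read r \<Rightarrow>
            ram_run P t (Suc pc) (tl inp) (m(r := (case inp of [] \<Rightarrow> 0 | a # _ \<Rightarrow> a)))
        | Jump l \<Rightarrow> ram_run P t l inp m
        | JumpZero r l \<Rightarrow> ram_run P t (if m r = 0 then l else Suc pc) inp m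
        | Accept \<Rightarrow> Some True
        | Reject \<Rightarrow> Some False)
     else None)"

definition ram_result :: "instr list \<Rightarrow> nat \<Rightarrow> nat list \<Rightarrow> bool option" where
  "ram_result P t inp = ram_run P t 0 inp (\<lambda>_. 0)"

text \<open>A regex over the terminals \<open>0, 1, 2, \<dots>\<close> with variables \<open>0, 1, 2, \<dots>\<close> is given to the machine
  in prefix notation.\<close>

fun encode_regex :: "(nat, nat) regex \<Rightarrow> nat list" where
  "encode_regex Empty = [0]"
| "encode_regex Eps = [1]"
| "encode_regex (Lit a) = [2, a]"
| "encode_regex (Ref x) = [3, x]"
| "encode_regex (Cat \<alpha> \<beta>) = 4 # encode_regex \<alpha> @ encode_regex \<beta>"
| "encode_regex (Alt \<alpha> \<beta>) = 5 # encode_regex \<alpha> @ encode_regex \<beta>"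
| "encode_regex (Plus \<alpha>) = 6 # encode_regex \<alpha>"
| "encode_regex (Bind x \<alpha>) = 7 # x # encode_regex \<alpha>"

definition encode_instance :: "nat \<Rightarrow> (nat, nat) regex \<Rightarrow> nat list \<Rightarrow> nat list" where
  "encode_instance \<sigma> \<alpha> w = [\<sigma>] @ encode_regex \<alpha> @ [length w] @ w"

text \<open>
  The bound \<open>|\<Sigma>||\<alpha>|n + k|w|\<close> for an alphabet of size \<open>\<sigma>\<close> and a word of length \<open>l\<close>. The degenerate
  factors \<open>n = 0\<close> and \<open>k = 0\<close> count as \<open>1\<close>: otherwise no time at all would be allowed for \<open>Eps\<close>
  and the empty word, nor for reading the input word when there are no variables.
\<close>

definition time_bound :: "nat \<Rightarrow> ('a, 'v) regex \<Rightarrow> nat \<Rightarrow> nat" where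
  "time_bound \<sigma> \<alpha> l =
     \<sigma> * regex_length \<alpha> * max 1 (occurrences \<alpha>) + max 1 (card (vars \<alpha>)) * l"

end

theory Submission
  imports Defs
begin

text \<open>
  A regex is turned into a graph whose walks spell its marked ref-words. By determinism, the
  brackets and variables that may stand between one symbol occurrence \<open>v\<close> and the next consumed
  letter \<open>a\<close> are unique as long as the variables crossed are empty; they are found by one search of
  the graph from each \<open>v\<close>, followed by reading off one path for each \<open>a\<close>, which gives
  \<open>|\<Sigma>||\<alpha>|n\<close>. A variable is crossed only when nothing new can be reached without it, so the path
  found to the end of the regex crosses as few variables as possible. During matching, the value of a variable is a factor of the
  input, given by two positions. Between two consumed letters the position is fixed, so of all
  events on a path only the first few of each variable matter. Hence \<open>O(k)\<close> events are kept per
  path, and one step takes time \<open>O(k)\<close> plus the length of the factor compared.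

  The algorithm is written in a small while language with arrays, verified by weakest preconditions
  that also track a time budget, and compiled to the machine.
\<close>

section \<open>A small imperative language and its compilation\<close>

text \<open>The obstacle is the end of the input. \<open>nondeterministic\<close> compares two
  continuations that both go on or both stop; it does not forbid that one word ends where another
  goes on with a variable, as in a regex whose last factor is an optional reference. A nonempty
  variable rules out the longer ending, an empty one admits both, so the ending to be tested is one
  that avoids variables where possible. This dictates the order of the search. Before a letter the
  choice is forced: two terminal-free continuations extend one another until they reach different
  letters, and the first symbol that produces output is the same on both. Hence committing to the
  path of the table never changes the answer. The end of the input is treated as one more letter
  \<sigma>, outside the alphabet. It labels the exit of the graph and is stored behind the word,
  where it also stops comparisons. Memory starts at 0 and marks are compared with growing stamps, so
  no array has to be cleared for each entry of the table.\<close>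

text \<open>A store consists of the arrays \<open>s 0, s 1, \<dots>\<close>; the scalar \<open>j\<close> is the entry \<open>s j 0\<close>. The
  entry \<open>i\<close> of the array \<open>j\<close> is kept in the memory cell \<open>128 * i + j\<close>.\<close>

type_synonym store = "nat \<Rightarrow> nat \<Rightarrow> nat"

datatype aexp = N nat | V nat | Pl aexp aexp | Mi aexp aexp | Ar nat aexp

fun aval :: "aexp \<Rightarrow> store \<Rightarrow> nat" where
  "aval (N n) s = n"
| "aval (V j) s = s j 0"
| "aval (Pl d e) s = aval d s + aval e s"
| "aval (Mi d e) s = aval d s - aval e s"
| "aval (Ar j e) s = s j (aval e s)"

datatype com =
    Skip
  | Asg nat aexp
  | Upd nat aexp aexp
  | Inp nat
  | Seq com com (infixr \<open>;;\<close> 60)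
  | Ite aexp com com
  | While aexp com

abbreviation put :: "store \<Rightarrow> nat \<Rightarrow> nat \<Rightarrow> nat \<Rightarrow> store" where
  "put s j i v \<equiv> s(j := (s j)(i := v))"

inductive big :: "com \<Rightarrow> store \<Rightarrow> nat list \<Rightarrow> nat \<Rightarrow> store \<Rightarrow> nat list \<Rightarrow> bool" where
  Skip: "big Skip s is 0 s is"
| Asg: "big (Asg j e) s is 1 (put s j 0 (aval e s)) is"
| Upd: "big (Upd j d e) s is 1 (put s j (aval d s) (aval e s)) is"
| Inp: "big (Inp j) s is 1 (put s j 0 (case is of [] \<Rightarrow> 0 | a # _ \<Rightarrow> a)) (tl is)"
| Seq: "big c s is t s' is' \<Longrightarrow> big d s' is' t' s'' is'' \<Longrightarrow> big (c ;; d) s is (t + t') s'' is''"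
| IteT: "aval e s \<noteq> 0 \<Longrightarrow> big c s is t s' is' \<Longrightarrow> big (Ite e c d) s is (Suc t) s' is'"
| IteF: "aval e s = 0 \<Longrightarrow> big d s is t s' is' \<Longrightarrow> big (Ite e c d) s is (Suc t) s' is'"
| WhileF: "aval e s = 0 \<Longrightarrow> big (While e c) s is 1 s is"
| WhileT: "aval e s \<noteq> 0 \<Longrightarrow> big c s is t s' is' \<Longrightarrow> big (While e c) s' is' t' s'' is'' \<Longrightarrow>
    big (While e c) s is (Suc (t + t')) s'' is''"

text \<open>The budget is an integer and may become negative; only the final postcondition asks
  whether it sufficed, so costs are subtracted without side conditions. A terminating derivation of
  \<open>big\<close> is demanded, hence this is total correctness.\<close>

definition wp :: "com \<Rightarrow> (store \<Rightarrow> nat list \<Rightarrow> int \<Rightarrow> bool) \<Rightarrow> store \<Rightarrow> nat list \<Rightarrow> int \<Rightarrow> bool" where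
  "wp c Q s is b \<longleftrightarrow> (\<exists>t s' is'. big c s is t s' is' \<and> Q s' is' (b - int t))"

inductive_cases SkipE: "big Skip s is t s' is'"
inductive_cases AsgE: "big (Asg j e) s is t s' is'"
inductive_cases UpdE: "big (Upd j d e) s is t s' is'"
inductive_cases InpE: "big (Inp j) s is t s' is'"
inductive_cases SeqE: "big (c ;; d) s is t s' is'"
inductive_cases IteE: "big (Ite e c d) s is t s' is'"

lemma wp_Skip [simp]: "wp Skip Q s is b = Q s is b"
  unfolding wp_def by (auto elim!: SkipE intro!: exI big.Skip)

lemma wp_Asg [simp]: "wp (Asg j e) Q s is b = Q (put s j 0 (aval e s)) is (b - 1)"
proof
  assume "Q (put s j 0 (aval e s)) is (b - 1)"
  then show "wp (Asg j e) Q s is b"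
    unfolding wp_def using big.Asg by (metis of_nat_1)
qed (auto simp: wp_def elim!: AsgE)

lemma wp_Upd [simp]: "wp (Upd j d e) Q s is b = Q (put s j (aval d s) (aval e s)) is (b - 1)"
proof
  assume "Q (put s j (aval d s) (aval e s)) is (b - 1)"
  then show "wp (Upd j d e) Q s is b"
    unfolding wp_def using big.Upd by (metis of_nat_1)
qed (auto simp: wp_def elim!: UpdE)

lemma wp_Inp [simp]:
  "wp (Inp j) Q s is b = Q (put s j 0 (case is of [] \<Rightarrow> 0 | a # _ \<Rightarrow> a)) (tl is) (b - 1)"
proof
  assume "Q (put s j 0 (case is of [] \<Rightarrow> 0 | a # _ \<Rightarrow> a)) (tl is) (b - 1)"
  then show "wp (Inp j) Q s is b"
    unfolding wp_def using big.Inp by (metis of_nat_1)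
qed (auto simp: wp_def elim!: InpE)

lemma wp_Seq [simp]: "wp (c ;; d) Q s is b = wp c (wp d Q) s is b"
proof
  assume "wp (c ;; d) Q s is b"
  then show "wp c (wp d Q) s is b"
    unfolding wp_def by (elim exE conjE SeqE) (force simp: algebra_simps)
next
  assume "wp c (wp d Q) s is b"
  then show "wp (c ;; d) Q s is b"
    unfolding wp_def by (auto simp: diff_diff_eq intro: big.Seq) (metis big.Seq of_nat_add)
qed

lemma wp_Ite [simp]:
  "wp (Ite e c d) Q s is b = (if aval e s = 0 then wp d Q s is (b - 1) else wp c Q s is (b - 1))"
proof
  assume "wp (Ite e c d) Q s is b"
  then show "if aval e s = 0 then wp d Q s is (b - 1) else wp c Q s is (b - 1)"
    unfolding wp_def by (elim exE conjE IteE) (auto simp: diff_diff_eq intro!: exI)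
next
  assume *: "if aval e s = 0 then wp d Q s is (b - 1) else wp c Q s is (b - 1)"
  show "wp (Ite e c d) Q s is b"
  proof (cases "aval e s = 0")
    case True
    then obtain t s' is' where "big d s is t s' is'" "Q s' is' (b - 1 - int t)"
      using * by (auto simp: wp_def)
    then have "big (Ite e c d) s is (Suc t) s' is' \<and> Q s' is' (b - int (Suc t))"
      using True by (auto intro: big.intros simp: algebra_simps)
    then show ?thesis unfolding wp_def by blast
  next
    case False
    then obtain t s' is' where "big c s is t s' is'" "Q s' is' (b - 1 - int t)"
      using * by (auto simp: wp_def)
    then have "big (Ite e c d) s is (Suc t) s' is' \<and> Q s' is' (b - int (Suc t))"
      using False by (auto intro: big.intros simp: algebra_simps)
    then show ?thesis unfolding wp_def by blast
  qed
qed

lemma wp_While_done: "aval e s = 0 \<Longrightarrow> Q s is (b - 1) \<Longrightarrow> wp (While e c) Q s is b"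
  unfolding wp_def using big.WhileF by (metis of_nat_1)

lemma wp_While_step:
  assumes "aval e s \<noteq> 0" "wp c (wp (While e c) Q) s is (b - 1)"
  shows "wp (While e c) Q s is b"
proof -
  obtain t s' is' t' s'' is'' where "big c s is t s' is'" "big (While e c) s' is' t' s'' is''"
    "Q s'' is'' (b - 1 - int t - int t')"
    using assms(2) by (auto simp: wp_def)
  then have "big (While e c) s is (Suc (t + t')) s'' is''" "Q s'' is'' (b - int (Suc (t + t')))"
    using big.WhileT[OF assms(1)] by (auto simp: diff_diff_eq add.assoc)
  then show ?thesis unfolding wp_def by blast
qed

lemma wp_mono:
  assumes "wp c Q s is b" "\<And>s is b. Q s is b \<Longrightarrow> Q' s is b"
  shows "wp c Q' s is b"
  using assms unfolding wp_def by blast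

text \<open>The budget belongs to the invariant. The cost of a loop is therefore stated there, as a
  lower bound on the remaining budget in terms of the progress made.\<close>

lemma wp_While:
  fixes M :: "store \<Rightarrow> nat"
  assumes "I s is b"
    and step: "\<And>s is b. I s is b \<Longrightarrow> aval e s \<noteq> 0 \<Longrightarrow>
      wp c (\<lambda>s' is' b'. I s' is' b' \<and> M s' < M s) s is (b - 1)"
    and fin: "\<And>s is b. I s is b \<Longrightarrow> aval e s = 0 \<Longrightarrow> Q s is (b - 1)"
  shows "wp (While e c) Q s is b"
  using assms(1)
proof (induction "M s" arbitrary: s "is" b rule: less_induct)
  case less
  show ?case
  proof (cases "aval e s = 0")
    case True
    then show ?thesis using less.prems by (blast intro: wp_While_done fin)
  next
    case False
    show ?thesis
      by (rule wp_While_step[OF False], rule wp_mono[OF step[OF less.prems False]])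
        (auto intro: less.hyps)
  qed
qed

subsection \<open>Compilation\<close>

text \<open>The stride 128 is a power of two, so an address is obtained by seven doublings on a
  machine without multiplication. Arrays have numbers below 64; thus the cells 64 to 127 hold no
  array entry and serve as temporaries.\<close>

fun cexp :: "nat \<Rightarrow> aexp \<Rightarrow> instr list" where
  "cexp t (N n) = [Const t n]"
| "cexp t (V j) = [Move t j]"
| "cexp t (Pl d e) = cexp t d @ cexp (Suc t) e @ [Add t t (Suc t)]"
| "cexp t (Mi d e) = cexp t d @ cexp (Suc t) e @ [Sub t t (Suc t)]"
| "cexp t (Ar j e) = cexp t e @ replicate 7 (Add t t t) @
    [Const (Suc t) j, Add t t (Suc t), Load t t]"

fun ccom :: "nat \<Rightarrow> com \<Rightarrow> instr list" where
  "ccom p Skip = []"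
| "ccom p (Asg j e) = cexp 64 e @ [Move j 64]"
| "ccom p (Upd j d e) = cexp 64 d @ cexp 65 e @ replicate 7 (Add 64 64 64) @
    [Const 66 j, Add 64 64 66, Store 64 65]"
| "ccom p (Inp j) = [Read j]"
| "ccom p (c ;; d) = (let c' = ccom p c in c' @ ccom (p + length c') d)"
| "ccom p (Ite e c d) =
    (let e' = cexp 64 e; q = p + length e' + 1; c' = ccom q c; q' = q + length c' + 1; d' = ccom q' d
     in e' @ [JumpZero 64 q'] @ c' @ [Jump (q' + length d')] @ d')"
| "ccom p (While e c) =
    (let e' = cexp 64 e; q = p + length e' + 1; c' = ccom q c
     in e' @ [JumpZero 64 (q + length c' + 1)] @ c' @ [Jump p])"

fun edepth :: "aexp \<Rightarrow> nat" where
  "edepth (N n) = 1"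
| "edepth (V j) = 1"
| "edepth (Pl d e) = max (edepth d) (Suc (edepth e))"
| "edepth (Mi d e) = max (edepth d) (Suc (edepth e))"
| "edepth (Ar j e) = Suc (edepth e)"

fun evars :: "aexp \<Rightarrow> nat set" where
  "evars (N n) = {}"
| "evars (V j) = {j}"
| "evars (Pl d e) = evars d \<union> evars e"
| "evars (Mi d e) = evars d \<union> evars e"
| "evars (Ar j e) = insert j (evars e)"

text \<open>Temporaries start at cell 64 or 65; depth 32 keeps them well below cell 128, where array
  entries begin again.\<close>

definition eok :: "aexp \<Rightarrow> bool" where
  "eok e \<longleftrightarrow> edepth e \<le> 32 \<and> (\<forall>j\<in>evars e. j < 64)"

fun cok :: "com \<Rightarrow> bool" where
  "cok Skip = True"
| "cok (Asg j e) = (j < 64 \<and> eok e)"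
| "cok (Upd j d e) = (j < 64 \<and> eok d \<and> eok e)"
| "cok (Inp j) = (j < 64)"
| "cok (c ;; d) = (cok c \<and> cok d)"
| "cok (Ite e c d) = (eok e \<and> cok c \<and> cok d)"
| "cok (While e c) = (eok e \<and> cok c)"

section \<open>Correctness of the compiled code\<close>

definition code_at :: "instr list \<Rightarrow> nat \<Rightarrow> instr list \<Rightarrow> bool" where
  "code_at P p c \<longleftrightarrow> (\<exists>P1 P2. P = P1 @ c @ P2 \<and> p = length P1)"

lemma code_at_append:
  "code_at P p (c @ d) \<longleftrightarrow> code_at P p c \<and> code_at P (p + length c) d"
proof
  assume "code_at P p (c @ d)"
  then obtain P1 P2 where "P = P1 @ (c @ d) @ P2" "p = length P1"
    by (auto simp: code_at_def)
  then have "P = P1 @ c @ (d @ P2)" "P = (P1 @ c) @ d @ P2" "p + length c = length (P1 @ c)"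
    by auto
  then show "code_at P p c \<and> code_at P (p + length c) d"
    using \<open>p = length P1\<close> unfolding code_at_def by metis
next
  assume "code_at P p c \<and> code_at P (p + length c) d"
  then obtain P1 P2 P3 P4 where "P = P1 @ c @ P2" "p = length P1"
    "P = P3 @ d @ P4" "p + length c = length P3" unfolding code_at_def by blast
  then have "P1 @ c = P3 \<and> P2 = d @ P4"
    by (metis append_assoc append_eq_append_conv length_append)
  then have "P = P1 @ (c @ d) @ P4" using \<open>P = P1 @ c @ P2\<close> by simp
  then show "code_at P p (c @ d)" using \<open>p = length P1\<close> unfolding code_at_def by blast
qed

lemma code_at_Nil: "code_at P p [] \<longleftrightarrow> p \<le> length P"
  unfolding code_at_def by (metis append_Nil append_take_drop_id le_add1 length_append length_take min_absorb2)

lemma code_at_Cons: "code_at P p (i # c) \<longleftrightarrow> p < length P \<and> P ! p = i \<and> code_at P (Suc p) c"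
proof -
  have "code_at P p [i] \<longleftrightarrow> p < length P \<and> P ! p = i"
    unfolding code_at_def
    by (auto simp: nth_append) (metis id_take_nth_drop length_take less_or_eq_imp_le min_absorb2)
  then show ?thesis using code_at_append[of P p "[i]" c] by simp
qed

definition rel :: "(nat \<Rightarrow> nat) \<Rightarrow> store \<Rightarrow> bool" where
  "rel m s \<longleftrightarrow> (\<forall>j<64. \<forall>i. m (128 * i + j) = s j i)"

lemma relD: "rel m s \<Longrightarrow> j < 64 \<Longrightarrow> m (128 * i + j) = s j i"
  by (simp add: rel_def)

lemma rel_scalar: "rel m s \<Longrightarrow> j < 64 \<Longrightarrow> m j = s j 0"
  using relD[of m s j 0] by simp

lemma rel_temp: "rel m s \<Longrightarrow> 64 \<le> t \<Longrightarrow> t < 128 \<Longrightarrow> rel (m(t := v)) s"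
  unfolding rel_def
proof (intro allI impI)
  fix j i :: nat assume *: "\<forall>j<64. \<forall>i. m (128 * i + j) = s j i" "64 \<le> t" "t < 128" "j < 64"
  then have "128 * i + j \<noteq> t" by (cases i) auto
  then show "(m(t := v)) (128 * i + j) = s j i" using * by simp
qed

lemma rel_put:
  assumes "rel m s" "j < 64"
  shows "rel (m(128 * i + j := v)) (put s j i v)"
  unfolding rel_def
proof (intro allI impI)
  fix j' i' :: nat assume "j' < 64"
  then have "(128 * i' + j') div 128 = i'" "(128 * i + j) div 128 = i" using assms(2) by auto
  then have "128 * i' + j' = 128 * i + j \<longleftrightarrow> i' = i \<and> j' = j" by (metis add_left_cancel)
  then show "(m(128 * i + j := v)) (128 * i' + j') = put s j i v j' i'"
    using relD[OF assms(1) \<open>j' < 64\<close>] by auto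
qed

text \<open>Stated for every remaining fuel \<open>n\<close>: it presupposes nothing about halting,
  and consecutive runs compose by adding their step counts.\<close>

definition runs :: "instr list \<Rightarrow> nat \<Rightarrow> nat \<Rightarrow> nat list \<Rightarrow> (nat \<Rightarrow> nat) \<Rightarrow> nat \<Rightarrow> nat list \<Rightarrow>
    (nat \<Rightarrow> nat) \<Rightarrow> bool" where
  "runs P k p is m p' is' m' \<longleftrightarrow> (\<forall>n. ram_run P (k + n) p is m = ram_run P n p' is' m')"

lemma runs_0: "runs P 0 p is m p is m"
  by (simp add: runs_def)

lemma runs_trans:
  "runs P k p is m p' is' m' \<Longrightarrow> runs P k' p' is' m' p'' is'' m'' \<Longrightarrow> runs P (k + k') p is m p'' is'' m''"
  by (simp add: runs_def add.assoc)

lemma runs_instr: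
  assumes "p < length P"
  shows "P ! p = Const r c \<Longrightarrow> runs P 1 p is m (Suc p) is (m(r := c))"
    and "P ! p = Move r u \<Longrightarrow> runs P 1 p is m (Suc p) is (m(r := m u))"
    and "P ! p = Add r u v \<Longrightarrow> runs P 1 p is m (Suc p) is (m(r := m u + m v))"
    and "P ! p = Sub r u v \<Longrightarrow> runs P 1 p is m (Suc p) is (m(r := m u - m v))"
    and "P ! p = Load r u \<Longrightarrow> runs P 1 p is m (Suc p) is (m(r := m (m u)))"
    and "P ! p = Store r u \<Longrightarrow> runs P 1 p is m (Suc p) is (m(m r := m u))"
    and "P ! p = Read r \<Longrightarrow>
      runs P 1 p is m (Suc p) (tl is) (m(r := (case is of [] \<Rightarrow> 0 | a # _ \<Rightarrow> a)))"
    and "P ! p = Jump l \<Longrightarrow> runs P 1 p is m l is m"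
    and "P ! p = JumpZero r l \<Longrightarrow> m r = 0 \<Longrightarrow> runs P 1 p is m l is m"
    and "P ! p = JumpZero r l \<Longrightarrow> m r \<noteq> 0 \<Longrightarrow> runs P 1 p is m (Suc p) is m"
  using assms by (simp_all add: runs_def)

lemma runs_double:
  assumes "code_at P p (replicate n (Add t t t))"
  shows "runs P n p is m (p + n) is (m(t := 2 ^ n * m t))"
  using assms
proof (induction n arbitrary: p m)
  case (Suc n)
  then have "p < length P" "P ! p = Add t t t" "code_at P (Suc p) (replicate n (Add t t t))"
    by (auto simp: code_at_Cons)
  from runs_trans[OF runs_instr(3)[OF this(1,2)] Suc.IH[OF this(3)]]
  have "runs P (1 + n) p is m (Suc p + n) is
    ((m(t := m t + m t))(t := 2 ^ n * (m(t := m t + m t)) t))" .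
  moreover have "(m(t := m t + m t))(t := 2 ^ n * (m(t := m t + m t)) t) = m(t := 2 ^ Suc n * m t)"
    by (auto simp: fun_eq_iff)
  ultimately have "runs P (Suc n) p is m (p + Suc n) is (m(t := 2 ^ Suc n * m t))" by simp
  then show ?case .
qed (simp add: runs_0)

lemma runs_address:
  assumes "code_at P p (replicate 7 (Add t t t) @ [Const t' j, Add t t t'])" "t \<noteq> t'"
  shows "runs P 9 p is m (p + 9) is (m(t := 128 * m t + j, t' := j))"
proof -
  let ?m = "m(t := 2 ^ 7 * m t)"
  have c: "p + 7 < length P" "P ! (p + 7) = Const t' j" "Suc (p + 7) < length P"
    "P ! Suc (p + 7) = Add t t t'" "code_at P p (replicate 7 (Add t t t))"
    using assms(1) by (auto simp: code_at_append code_at_Cons)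
  have "runs P (7 + (1 + 1)) p is m (Suc (Suc (p + 7))) is
      (?m(t' := j, t := (?m(t' := j)) t + (?m(t' := j)) t'))"
    by (intro runs_trans[OF runs_double[OF c(5)]] runs_trans[OF runs_instr(1)[OF c(1,2)]]
        runs_instr(3) c)
  then show ?thesis using assms(2) by (simp add: numeral_eq_Suc fun_upd_twist)
qed

text \<open>The cells from 64 up to \<open>t\<close> hold pending operands and must survive, because
  the second operand of a sum is evaluated one cell above the first.\<close>

lemma cexp_correct:
  assumes "code_at P p (cexp t e)" "rel m s" "64 \<le> t" "t + edepth e < 128" "\<forall>j\<in>evars e. j < 64"
  shows "\<exists>m'. rel m' s \<and> m' t = aval e s \<and> (\<forall>r. 64 \<le> r \<and> r < t \<longrightarrow> m' r = m r) \<and>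
    runs P (length (cexp t e)) p is m (p + length (cexp t e)) is m'"
  using assms
proof (induction e arbitrary: p t m)
  case (N n)
  then have "rel (m(t := n)) s" by (simp add: rel_temp)
  moreover have "runs P 1 p is m (Suc p) is (m(t := n))"
    using N by (intro runs_instr) (auto simp: code_at_Cons)
  ultimately show ?case by fastforce
next
  case (V j)
  then have "rel (m(t := s j 0)) s" by (simp add: rel_temp)
  moreover have "runs P 1 p is m (Suc p) is (m(t := m j))"
    using V by (intro runs_instr) (auto simp: code_at_Cons)
  moreover have "m j = s j 0" using V by (simp add: rel_scalar)
  ultimately show ?case by fastforce
next
  case (Pl d e)
  let ?p = "p + length (cexp t d)" and ?q = "p + length (cexp t d) + length (cexp (Suc t) e)"
  note c = Pl.prems(1)[unfolded cexp.simps code_at_append code_at_Cons]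
  have dep: "t + edepth d < 128" "Suc t + edepth e < 128"
    using Pl.prems(4) by (auto simp: max_def split: if_splits)
  obtain m1 where m1: "rel m1 s" "m1 t = aval d s" "\<forall>r. 64 \<le> r \<and> r < t \<longrightarrow> m1 r = m r"
    "runs P (length (cexp t d)) p is m ?p is m1"
    using Pl.IH(1)[of p t m] Pl.prems c dep by auto
  obtain m2 where m2: "rel m2 s" "m2 (Suc t) = aval e s"
    "\<forall>r. 64 \<le> r \<and> r < Suc t \<longrightarrow> m2 r = m1 r"
    "runs P (length (cexp (Suc t) e)) ?p is m1 ?q is m2"
    using Pl.IH(2)[of ?p "Suc t" m1] Pl.prems c m1 dep by auto
  have "runs P 1 ?q is m2 (Suc ?q) is (m2(t := m2 t + m2 (Suc t)))"
    using c by (intro runs_instr) auto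
  from runs_trans[OF m1(4) runs_trans[OF m2(4) this]]
  have "runs P (length (cexp t (Pl d e))) p is m (p + length (cexp t (Pl d e))) is
    (m2(t := m2 t + m2 (Suc t)))" by (simp add: add.assoc)
  moreover have "rel (m2(t := m2 t + m2 (Suc t))) s" using m2(1) Pl.prems by (simp add: rel_temp)
  moreover have "(m2(t := m2 t + m2 (Suc t))) t = aval (Pl d e) s" using m1 m2 Pl.prems by simp
  moreover have "\<forall>r. 64 \<le> r \<and> r < t \<longrightarrow> (m2(t := m2 t + m2 (Suc t))) r = m r"
    using m1(3) m2(3) by simp
  ultimately show ?case by blast
next
  case (Mi d e)
  let ?p = "p + length (cexp t d)" and ?q = "p + length (cexp t d) + length (cexp (Suc t) e)"
  note c = Mi.prems(1)[unfolded cexp.simps code_at_append code_at_Cons]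
  have dep: "t + edepth d < 128" "Suc t + edepth e < 128"
    using Mi.prems(4) by (auto simp: max_def split: if_splits)
  obtain m1 where m1: "rel m1 s" "m1 t = aval d s" "\<forall>r. 64 \<le> r \<and> r < t \<longrightarrow> m1 r = m r"
    "runs P (length (cexp t d)) p is m ?p is m1"
    using Mi.IH(1)[of p t m] Mi.prems c dep by auto
  obtain m2 where m2: "rel m2 s" "m2 (Suc t) = aval e s"
    "\<forall>r. 64 \<le> r \<and> r < Suc t \<longrightarrow> m2 r = m1 r"
    "runs P (length (cexp (Suc t) e)) ?p is m1 ?q is m2"
    using Mi.IH(2)[of ?p "Suc t" m1] Mi.prems c m1 dep by auto
  have "runs P 1 ?q is m2 (Suc ?q) is (m2(t := m2 t - m2 (Suc t)))"
    using c by (intro runs_instr) auto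
  from runs_trans[OF m1(4) runs_trans[OF m2(4) this]]
  have "runs P (length (cexp t (Mi d e))) p is m (p + length (cexp t (Mi d e))) is
    (m2(t := m2 t - m2 (Suc t)))" by (simp add: add.assoc)
  moreover have "rel (m2(t := m2 t - m2 (Suc t))) s" using m2(1) Mi.prems by (simp add: rel_temp)
  moreover have "(m2(t := m2 t - m2 (Suc t))) t = aval (Mi d e) s" using m1 m2 Mi.prems by simp
  moreover have "\<forall>r. 64 \<le> r \<and> r < t \<longrightarrow> (m2(t := m2 t - m2 (Suc t))) r = m r"
    using m1(3) m2(3) by simp
  ultimately show ?case by blast
next
  case (Ar j e)
  let ?p = "p + length (cexp t e)"
  have c: "code_at P p (cexp t e)"
    "code_at P ?p (replicate 7 (Add t t t) @ [Const (Suc t) j, Add t t (Suc t)])"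
    "?p + 9 < length P" "P ! (?p + 9) = Load t t"
    using Ar.prems(1) by (simp_all add: code_at_append code_at_Cons code_at_Nil add.commute add.left_commute)
  obtain m1 where m1: "rel m1 s" "m1 t = aval e s" "\<forall>r. 64 \<le> r \<and> r < t \<longrightarrow> m1 r = m r"
    "runs P (length (cexp t e)) p is m ?p is m1"
    using Ar.IH(1)[of p t m] Ar.prems c by auto
  let ?m2 = "m1(t := 128 * m1 t + j, Suc t := j)"
  let ?m3 = "?m2(t := ?m2 (?m2 t))"
  have r2: "rel ?m2 s" using m1(1) Ar.prems by (intro rel_temp) auto
  have "runs P 9 ?p is m1 (?p + 9) is ?m2" using runs_address[OF c(2)] by simp
  moreover have "runs P 1 (?p + 9) is ?m2 (Suc (?p + 9)) is ?m3" using c by (intro runs_instr)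
  ultimately have "runs P (length (cexp t e) + (9 + 1)) p is m (Suc (?p + 9)) is ?m3"
    by (intro runs_trans[OF m1(4)] runs_trans[of P 9])
  moreover have "length (cexp t (Ar j e)) = length (cexp t e) + (9 + 1)"
    "p + length (cexp t (Ar j e)) = Suc (?p + 9)" by simp_all
  ultimately have "runs P (length (cexp t (Ar j e))) p is m (p + length (cexp t (Ar j e))) is ?m3"
    by metis
  moreover have "rel ?m3 s" by (rule rel_temp[OF r2]) (use Ar.prems in auto)
  moreover have "?m3 t = aval (Ar j e) s"
    using relD[OF r2, of j "aval e s"] Ar.prems m1(2) by simp
  moreover have "\<forall>r. 64 \<le> r \<and> r < t \<longrightarrow> ?m3 r = m r" using m1(3) by auto
  ultimately show ?case by blast
qed

lemma cexp_correct64: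
  assumes "code_at P p (cexp 64 e)" "rel m s" "eok e"
  obtains m' where "rel m' s" "m' 64 = aval e s"
    "runs P (length (cexp 64 e)) p is m (p + length (cexp 64 e)) is m'"
  using cexp_correct[OF assms(1,2), of "is"] assms(3) by (fastforce simp: eok_def)

text \<open>Each unit of time pays for one assignment, one input or one test with its jumps. The
  instructions this takes are a part of the program text, so the length \<open>C\<close> of the text
  bounds them.\<close>

lemma ccom_correct:
  assumes "big c s is t s' is'" "code_at P p (ccom p c)" "length (ccom p c) \<le> C" "cok c" "rel m s"
  shows "\<exists>k m'. k \<le> C * t \<and> rel m' s' \<and> runs P k p is m (p + length (ccom p c)) is' m'"
  using assms
proof (induction arbitrary: p m)
  case (Skip s "is")
  then show ?case by (auto intro: runs_0)
next
  case (Asg j e s "is")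
  note c = Asg.prems(1)[unfolded ccom.simps code_at_append code_at_Cons]
  obtain m1 where m1: "rel m1 s" "m1 64 = aval e s"
    "runs P (length (cexp 64 e)) p is m (p + length (cexp 64 e)) is m1"
    using c Asg.prems by (auto elim: cexp_correct64)
  have "runs P 1 (p + length (cexp 64 e)) is m1 (Suc (p + length (cexp 64 e))) is (m1(j := m1 64))"
    using c by (intro runs_instr) auto
  from runs_trans[OF m1(3) this]
  have "runs P (length (cexp 64 e) + 1) p is m (p + length (ccom p (Asg j e))) is (m1(j := m1 64))"
    by simp
  moreover have "rel (m1(j := m1 64)) (put s j 0 (aval e s))"
    using m1 Asg.prems rel_put[OF m1(1), of j 0 "m1 64"] by simp
  moreover have "length (cexp 64 e) + 1 \<le> C * 1" using Asg.prems(2) by simp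
  ultimately show ?case by (intro exI conjI)
next
  case (Upd j d e s "is")
  let ?p = "p + length (cexp 64 d)" and ?q = "p + length (cexp 64 d) + length (cexp 65 e)"
  have c: "code_at P p (cexp 64 d)" "code_at P ?p (cexp 65 e)"
    "code_at P ?q (replicate 7 (Add 64 64 64) @ [Const 66 j, Add 64 64 66])"
    "?q + 9 < length P" "P ! (?q + 9) = Store 64 65"
    using Upd.prems(1) by (simp_all add: code_at_append code_at_Cons code_at_Nil add.commute add.left_commute)
  obtain m1 where m1: "rel m1 s" "m1 64 = aval d s"
    "runs P (length (cexp 64 d)) p is m ?p is m1"
    using c Upd.prems by (auto elim: cexp_correct64)
  obtain m2 where m2: "rel m2 s" "m2 65 = aval e s" "m2 64 = m1 64"
    "runs P (length (cexp 65 e)) ?p is m1 ?q is m2"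
    using cexp_correct[of P ?p 65 e m1 s "is"] c m1 Upd.prems
    by (auto simp: eok_def)
  let ?m3 = "m2(64 := 128 * m2 64 + j, 66 := j)"
  have r3: "rel ?m3 s" using m2(1) by (auto intro!: rel_temp)
  have r4: "rel (?m3(?m3 64 := ?m3 65)) (put s j (aval d s) (aval e s))"
    using rel_put[OF r3, of j "aval d s" "aval e s"] Upd.prems m1 m2 by simp
  have "runs P 1 (?q + 9) is ?m3 (Suc (?q + 9)) is (?m3(?m3 64 := ?m3 65))"
    by (rule runs_instr(6)[OF c(4,5)])
  moreover have "runs P 9 ?q is m2 (?q + 9) is ?m3" using runs_address[OF c(3)] by simp
  ultimately have "runs P (length (cexp 64 d) + (length (cexp 65 e) + (9 + 1))) p is m
      (Suc (?q + 9)) is (?m3(?m3 64 := ?m3 65))"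
    by (intro runs_trans[OF m1(3)] runs_trans[OF m2(4)] runs_trans[of P 9])
  then have "runs P (length (ccom p (Upd j d e))) p is m (p + length (ccom p (Upd j d e))) is
      (?m3(?m3 64 := ?m3 65))" by (simp add: add.assoc numeral_eq_Suc)
  moreover have "length (ccom p (Upd j d e)) \<le> C * 1" using Upd.prems(2) by simp
  ultimately show ?case using r4 by (intro exI conjI)
next
  case (Inp j s "is")
  then have "runs P 1 p is m (p + length (ccom p (Inp j))) (tl is)
      (m(j := (case is of [] \<Rightarrow> 0 | a # _ \<Rightarrow> a)))"
    using runs_instr(7)[of p P j "is" m] by (simp add: code_at_Cons)
  moreover have "rel (m(j := (case is of [] \<Rightarrow> 0 | a # _ \<Rightarrow> a)))
      (put s j 0 (case is of [] \<Rightarrow> 0 | a # _ \<Rightarrow> a))"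
    using Inp.prems rel_put[OF Inp.prems(4), of j 0] by simp
  moreover have "1 \<le> C * 1" using Inp.prems(2) by simp
  ultimately show ?case by (intro exI conjI)
next
  case (Seq c s "is" t s' is' d t' s'' is'')
  let ?q = "p + length (ccom p c)"
  note c = Seq.prems(1)[unfolded ccom.simps Let_def code_at_append]
  obtain k1 m1 where 1: "k1 \<le> C * t" "rel m1 s'" "runs P k1 p is m ?q is' m1"
    using Seq.IH(1)[of p m] Seq.prems c by (auto simp: Let_def)
  obtain k2 m2 where 2: "k2 \<le> C * t'" "rel m2 s''"
    "runs P k2 ?q is' m1 (?q + length (ccom ?q d)) is'' m2"
    using Seq.IH(2)[of ?q m1] Seq.prems c 1 by (auto simp: Let_def)
  show ?case
    using 1 2 runs_trans[OF 1(3) 2(3)]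
    by (intro exI[of _ "k1 + k2"] exI[of _ m2]) (auto simp: Let_def algebra_simps)
next
  case (IteT e s c "is" t s' is' d)
  let ?p = "p + length (cexp 64 e)"
  let ?q = "p + length (cexp 64 e) + 1"
  let ?r = "?q + length (ccom ?q c)"
  note c = IteT.prems(1)[unfolded ccom.simps Let_def code_at_append code_at_Cons]
  obtain m1 where m1: "rel m1 s" "m1 64 = aval e s"
    "runs P (length (cexp 64 e)) p is m ?p is m1"
    using c IteT.prems by (auto elim: cexp_correct64)
  obtain k2 m2 where 2: "k2 \<le> C * t" "rel m2 s'" "runs P k2 (Suc ?p) is m1 ?r is' m2"
    using IteT.IH(1)[of ?q m1] IteT.prems c m1 by (auto simp: Let_def)
  have "runs P (length (cexp 64 e) + (1 + (k2 + 1))) p is m (p + length (ccom p (Ite e c d))) is' m2"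
    using c m1(2) IteT.hyps(1)
    by (intro runs_trans[OF m1(3)] runs_trans[OF runs_instr(10)] runs_trans[OF 2(3)] runs_instr(8))
      (auto simp: Let_def add.assoc)
  moreover have "length (cexp 64 e) + (1 + (k2 + 1)) \<le> C * Suc t"
    using IteT.prems(2) 2 by (auto simp: Let_def)
  ultimately show ?case using 2(2) by blast
next
  case (IteF e s d "is" t s' is' c)
  let ?p = "p + length (cexp 64 e)"
  let ?q = "p + length (cexp 64 e) + 1 + length (ccom (p + length (cexp 64 e) + 1) c) + 1"
  note c = IteF.prems(1)[unfolded ccom.simps Let_def code_at_append code_at_Cons]
  obtain m1 where m1: "rel m1 s" "m1 64 = aval e s"
    "runs P (length (cexp 64 e)) p is m ?p is m1"
    using c IteF.prems by (auto elim: cexp_correct64)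
  obtain k2 m2 where 2: "k2 \<le> C * t" "rel m2 s'"
    "runs P k2 ?q is m1 (?q + length (ccom ?q d)) is' m2"
    using IteF.IH(1)[of ?q m1] IteF.prems c m1 by (auto simp: Let_def add.assoc)
  have "p + length (ccom p (Ite e c d)) = ?q + length (ccom ?q d)"
    by (simp add: Let_def)
  then have "runs P (length (cexp 64 e) + (1 + k2)) p is m (p + length (ccom p (Ite e c d))) is' m2"
    using c m1(2) IteF.hyps(1) 2(3)
    by (intro runs_trans[OF m1(3)] runs_trans[OF runs_instr(9)]) (auto simp: add.assoc)
  moreover have "length (cexp 64 e) + (1 + k2) \<le> C * Suc t"
    using IteF.prems(2) 2 by (auto simp: Let_def)
  ultimately show ?case using 2(2) by blast
next
  case (WhileF e s c "is")
  note c = WhileF.prems(1)[unfolded ccom.simps Let_def code_at_append code_at_Cons]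
  obtain m1 where m1: "rel m1 s" "m1 64 = aval e s"
    "runs P (length (cexp 64 e)) p is m (p + length (cexp 64 e)) is m1"
    using c WhileF.prems by (auto elim: cexp_correct64)
  have "runs P (length (cexp 64 e) + 1) p is m (p + length (ccom p (While e c))) is m1"
    using c m1(2) WhileF.hyps
    by (intro runs_trans[OF m1(3)] runs_instr(9)) (auto simp: Let_def add.assoc)
  moreover have "length (cexp 64 e) + 1 \<le> C * 1"
    using WhileF.prems(2) by (auto simp: Let_def)
  ultimately show ?case using m1 by blast
next
  case (WhileT e s c "is" t s' is' t' s'' is'')
  let ?p = "p + length (cexp 64 e)"
  let ?q = "p + length (cexp 64 e) + 1"
  note c = WhileT.prems(1)[unfolded ccom.simps Let_def code_at_append code_at_Cons]
  obtain m1 where m1: "rel m1 s" "m1 64 = aval e s"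
    "runs P (length (cexp 64 e)) p is m ?p is m1"
    using c WhileT.prems by (auto elim: cexp_correct64)
  obtain k2 m2 where 2: "k2 \<le> C * t" "rel m2 s'"
    "runs P k2 (Suc ?p) is m1 (?q + length (ccom ?q c)) is' m2"
    using WhileT.IH(1)[of ?q m1] WhileT.prems c m1 by (auto simp: Let_def)
  obtain k3 m3 where 3: "k3 \<le> C * t'" "rel m3 s''"
    "runs P k3 p is' m2 (p + length (ccom p (While e c))) is'' m3"
    using WhileT.IH(2)[of p m2] WhileT.prems 2 by auto
  have "runs P (length (cexp 64 e) + (1 + (k2 + (1 + k3)))) p is m
      (p + length (ccom p (While e c))) is'' m3"
  proof -
    let ?r = "?q + length (ccom ?q c)"
    have "runs P 1 ?r is' m2 p is' m2" using c by (intro runs_instr(8)) auto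
    moreover have "runs P 1 ?p is m1 (Suc ?p) is m1"
      using c m1(2) WhileT.hyps(1) by (intro runs_instr(10)) auto
    ultimately show ?thesis by (intro runs_trans[OF m1(3)] runs_trans[OF _ runs_trans[OF 2(3)]]
        runs_trans[OF _ 3(3)])
  qed
  moreover have "length (cexp 64 e) + (1 + (k2 + (1 + k3))) \<le> C * Suc (t + t')"
    using WhileT.prems(2) 2 3 by (auto simp: Let_def algebra_simps)
  ultimately show ?case using 3(2) by blast
qed

lemma ram_run_mono: "ram_run P t p is m = Some v \<Longrightarrow> ram_run P (t + k) p is m = Some v"
  by (induction t arbitrary: p "is" m) (auto split: instr.splits if_splits)

definition decider :: "com \<Rightarrow> nat \<Rightarrow> instr list" where
  "decider c r = (let c' = ccom 0 c in c' @ [JumpZero r (length c' + 2), Accept, Reject])"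

text \<open>The 2 pays for the final test and the verdict. The empty memory represents the store
  with all entries 0, so every array is initialized at no cost.\<close>

lemma ram_result_decider:
  assumes "cok c" "r < 64"
    and wp: "wp c (\<lambda>s is b. 0 \<le> b \<and> (s r 0 \<noteq> 0 \<longleftrightarrow> v)) (\<lambda>_ _. 0) inp (int t)"
    and le: "length (ccom 0 c) * t + 2 \<le> T"
  shows "ram_result (decider c r) T inp = Some v"
proof -
  let ?c = "ccom 0 c" and ?P = "decider c r"
  obtain t' s' is' where t': "big c (\<lambda>_ _. 0) inp t' s' is'" "int t' \<le> int t" "s' r 0 \<noteq> 0 \<longleftrightarrow> v"
    using wp by (auto simp: wp_def)
  have code: "code_at ?P 0 (?c @ [JumpZero r (length ?c + 2), Accept, Reject])"
    unfolding code_at_def decider_def Let_def by (intro exI[of _ "[]"]) simp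
  have "rel (\<lambda>_. 0) (\<lambda>_ _. 0)" by (simp add: rel_def)
  then obtain k m' where k: "k \<le> length ?c * t'" "rel m' s'"
    "runs ?P k 0 inp (\<lambda>_. 0) (length ?c) is' m'"
    using ccom_correct[OF t'(1), of ?P 0 "length ?c" "\<lambda>_. 0"] code assms(1)
    by (auto simp: code_at_append)
  have c: "length ?c < length ?P" "?P ! length ?c = JumpZero r (length ?c + 2)"
    "Suc (length ?c) < length ?P" "?P ! Suc (length ?c) = Accept"
    "Suc (Suc (length ?c)) < length ?P" "?P ! Suc (Suc (length ?c)) = Reject"
    using code by (auto simp: code_at_append code_at_Cons)
  have "ram_run ?P (k + 2) 0 inp (\<lambda>_. 0) = ram_run ?P 2 (length ?c) is' m'"
    using k(3) unfolding runs_def by blast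
  also have "\<dots> = Some (m' r \<noteq> 0)" using c by (simp add: numeral_2_eq_2)
  also have "m' r \<noteq> 0 \<longleftrightarrow> v" using t'(3) rel_scalar[OF k(2) assms(2)] by simp
  finally have "ram_run ?P (k + 2) 0 inp (\<lambda>_. 0) = Some v" .
  moreover have "k + 2 \<le> T"
    using k(1) le t'(2) mult_le_mono2[of t' t "length ?c"] by linarith
  ultimately show ?thesis
    unfolding ram_result_def using ram_run_mono by (metis le_Suc_ex)
qed

section \<open>Dereferencing from left to right\<close>

text \<open>The value of a variable is kept as a factor of the word produced so far, given by its start
  and its end position. An empty value may be relocated to the current position, which makes
  the effect of all symbols that produce no output depend on that position only.\<close>

fun sstep :: "('a, 'v) symbol \<Rightarrow> 'a list \<times> ('v \<Rightarrow> nat) \<times> ('v \<Rightarrow> nat) \<Rightarrow>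
    'a list \<times> ('v \<Rightarrow> nat) \<times> ('v \<Rightarrow> nat)" where
  "sstep (Term a) (u, S, E) = (u @ [a], S, E)"
| "sstep (Open x) (u, S, E) = (u, S(x := length u), E(x := length u))"
| "sstep (Close x) (u, S, E) = (u, S, E(x := length u))"
| "sstep (Var x) (u, S, E) =
    (if S x = E x then (u, S(x := length u), E(x := length u))
     else (u @ take (E x - S x) (drop (S x) u), S, E))"

definition sem :: "('a, 'v) symbol list \<Rightarrow> 'a list \<times> ('v \<Rightarrow> nat) \<times> ('v \<Rightarrow> nat)" where
  "sem r = fold sstep r ([], \<lambda>_. 0, \<lambda>_. 0)"

text \<open>\<open>A\<close> is the set of open variables. References to open variables are excluded
  too, since their factor is not yet complete; the condition on \<open>Bind\<close> in
  \<open>is_nonempty_regex\<close> provides this.\<close>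

fun wb :: "'v set \<Rightarrow> ('a, 'v) symbol list \<Rightarrow> bool" where
  "wb A [] = True"
| "wb A (Term a # r) = wb A r"
| "wb A (Var x # r) = (x \<notin> A \<and> wb A r)"
| "wb A (Open x # r) = (x \<notin> A \<and> wb (insert x A) r)"
| "wb A (Close x # r) = (x \<in> A \<and> wb (A - {x}) r)"

lemma wb_concat:
  assumes "\<And>u s. u \<in> L \<Longrightarrow> wb A (u @ s) = wb A s" "set us \<subseteq> L"
  shows "wb A (concat us @ s) = wb A s"
  using assms(2) by (induction us) (auto simp: assms(1))

text \<open>The continuation \<open>s\<close> makes one statement of two: \<open>r\<close> is well
  bracketed, and afterwards the same variables are open as before. This is what the cases of
  concatenation and iteration need.\<close>

lemma wb_ref_language:
  assumes "is_nonempty_regex \<alpha>" "A \<inter> vars \<alpha> = {}" "r \<in> ref_language \<alpha>"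
  shows "wb A (r @ s) = wb A s"
  using assms
proof (induction \<alpha> arbitrary: A r s)
  case (Cat \<alpha> \<beta>)
  then show ?case by (fastforce simp: lang_conc_def Int_Un_distrib)
next
  case (Alt \<alpha> \<beta>)
  then show ?case by (auto simp: Int_Un_distrib)
next
  case (Plus \<alpha>)
  then show ?case
    using wb_concat[of "ref_language \<alpha>" A] by (auto simp: lang_plus_def)
next
  case (Bind x \<alpha>)
  then obtain u where u: "r = Open x # u @ [Close x]" "u \<in> ref_language \<alpha>" by auto
  have "x \<notin> A" "x \<notin> vars \<alpha>" "insert x A \<inter> vars \<alpha> = {}" "is_nonempty_regex \<alpha>"
    using Bind.prems by auto
  then show ?case using u Bind.IH[of "insert x A" u] by simp
qed auto

fun opn :: "('a, 'v) symbol \<Rightarrow> 'v set \<Rightarrow> 'v set" where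
  "opn (Open x) A = insert x A"
| "opn (Close x) A = A - {x}"
| "opn (Term a) A = A"
| "opn (Var x) A = A"

lemma wb_append: "wb A (p @ q) \<longleftrightarrow> wb A p \<and> wb (fold opn p A) q"
proof (induction p arbitrary: A)
  case (Cons s p)
  then show ?case by (cases s) auto
qed simp

lemma deref_after_append: "deref_after p (u @ v) = deref_after p u @ deref_after (p @ u) v"
  by (induction p u rule: deref_after.induct) (auto split: option.splits)

lemma nearest_factor_snoc: "s \<noteq> Close x \<Longrightarrow> nearest_factor x (p @ [s]) = nearest_factor x p"
  by (simp add: nearest_factor_def)

lemma nearest_factor_close:
  assumes "Open x \<notin> set v"
  shows "nearest_factor x (p @ Open x # v @ [Close x]) = Some (p, v)"
proof -
  have *: "takeWhile (\<lambda>s. s \<noteq> Open x) (rev v @ Open x # t) = rev v"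
    "dropWhile (\<lambda>s. s \<noteq> Open x) (rev v @ Open x # t) = Open x # t" for t
    using assms by (auto simp: takeWhile_append dropWhile_append)
  show ?thesis by (simp add: nearest_factor_def *)
qed

lemma sem_snoc: "sem (p @ [s]) = sstep s (sem p)"
  by (simp add: sem_def)

lemma deref_snoc: "deref (p @ [s]) = deref p @ deref_after p [s]"
  by (simp add: deref_def deref_after_append)

text \<open>For an open variable only the start is meaningful: it is the output length at its
  bracket. For any other variable the stored factor spells what the nearest factor dereferences to,
  and a variable without such a factor is stored as empty.\<close>

definition sem_inv :: "('a, 'v) symbol list \<Rightarrow> 'a list \<Rightarrow> ('v \<Rightarrow> nat) \<Rightarrow> ('v \<Rightarrow> nat) \<Rightarrow> bool" where
  "sem_inv p u S E \<longleftrightarrow> u = deref p \<and>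
    (\<forall>x. S x \<le> E x \<and> E x \<le> length u \<and>
      (if x \<in> fold opn p {}
       then \<exists>p' v. p = p' @ Open x # v \<and> Open x \<notin> set v \<and> S x = length (deref p')
       else (case nearest_factor x p of None \<Rightarrow> S x = E x
         | Some (p', v) \<Rightarrow> deref_after (p' @ [Open x]) v = take (E x - S x) (drop (S x) u))))"

lemma sem_inv_sem:
  assumes "wb {} p" "sem p = (u, S, E)"
  shows "sem_inv p u S E"
  using assms
proof (induction p arbitrary: u S E rule: rev_induct)
  case Nil
  then show ?case by (auto simp: sem_def sem_inv_def deref_def nearest_factor_def)
next
  case (snoc s p)
  obtain u' S' E' where sem: "sem p = (u', S', E')" by (metis prod_cases3)
  have "wb {} p" and wbs: "wb (fold opn p {}) [s]"
    using snoc.prems(1) by (auto simp: wb_append)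
  then have inv: "sem_inv p u' S' E'" using snoc.IH sem by blast
  then have u': "u' = deref p"
    and le: "\<And>x. S' x \<le> E' x \<and> E' x \<le> length u'"
    and op: "\<And>x. x \<in> fold opn p {} \<Longrightarrow>
      \<exists>p' v. p = p' @ Open x # v \<and> Open x \<notin> set v \<and> S' x = length (deref p')"
    and cl: "\<And>x. x \<notin> fold opn p {} \<Longrightarrow> (case nearest_factor x p of None \<Rightarrow> S' x = E' x
         | Some (p', v) \<Rightarrow> deref_after (p' @ [Open x]) v = take (E' x - S' x) (drop (S' x) u'))"
    by (auto simp: sem_inv_def split: if_splits)
  have st: "(u, S, E) = sstep s (u', S', E')" using snoc.prems(2) sem by (simp add: sem_snoc)
  have keep: "\<exists>p' v. p @ [s] = p' @ Open x # v \<and> Open x \<notin> set v \<and> S' x = length (deref p')"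
    if xo: "x \<in> fold opn p {}" "s \<noteq> Open x" for x
  proof -
    obtain p' v where "p = p' @ Open x # v" "Open x \<notin> set v" "S' x = length (deref p')"
      using op[OF xo(1)] by blast
    then show ?thesis using xo(2) by (intro exI[of _ p'] exI[of _ "v @ [s]"]) auto
  qed
  \<comment> \<open>Output is only appended, and a stored factor lies inside the old output; it
    remains correct.\<close>
  have cl': "(case nearest_factor x p of None \<Rightarrow> S' x = E' x
         | Some (p', v) \<Rightarrow> deref_after (p' @ [Open x]) v = take (E' x - S' x) (drop (S' x) (u' @ w)))"
    if "x \<notin> fold opn p {}" for x w
    using cl[OF that] le[of x] by (auto split: option.splits)
  show ?case
  proof (cases s)
    case (Term a)
    then show ?thesis
      using st u' cl'[of _ "[a]"] keep le le_trans[OF conjunct1[OF le] conjunct2[OF le]]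
      by (auto simp: sem_inv_def deref_snoc nearest_factor_snoc le_Suc_eq)
  next
    case (Open x)
    have "\<exists>p' v. p @ [Open x] = p' @ Open x # v \<and> Open x \<notin> set v \<and>
        length u' = length (deref p')"
      using u' by (intro exI[of _ p] exI[of _ "[]"]) auto
    then show ?thesis
      using st u' cl keep le Open le_trans[OF conjunct1[OF le] conjunct2[OF le]]
      by (auto simp: sem_inv_def deref_snoc nearest_factor_snoc)
  next
    case (Close x)
    then have "x \<in> fold opn p {}" using wbs by simp
    from op[OF this] obtain p' v where p: "p = p' @ Open x # v" "Open x \<notin> set v"
      "S' x = length (deref p')" by blast
    \<comment> \<open>The output since the opening bracket is exactly the value being bound, so
      start and current length delimit it.\<close>
    have d: "deref p = deref p' @ deref_after (p' @ [Open x]) v"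
      by (simp add: p(1) deref_def deref_after_append)
    have "nearest_factor x (p @ [Close x]) = Some (p', v)"
      using nearest_factor_close[OF p(2), of p'] by (simp add: p(1))
    then show ?thesis
      using st u' cl keep le Close p(3) d le_trans[OF conjunct1[OF le] conjunct2[OF le]]
      by (auto simp: sem_inv_def deref_snoc nearest_factor_snoc)
  next
    case (Var x)
    then have x: "x \<notin> fold opn p {}" using wbs by simp
    define val where "val = take (E' x - S' x) (drop (S' x) u')"
    have val: "deref_after p [Var x] = val"
      using cl[OF x] by (auto simp: val_def split: option.splits)
    show ?thesis
    proof (cases "S' x = E' x")
      case True
      \<comment> \<open>An empty factor spells the same word wherever it is placed, so it may be
        moved to the current position.\<close>
      then have "val = []" by (simp add: val_def)
      moreover have "case nearest_factor x p of None \<Rightarrow> length (deref p) = length (deref p)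
         | Some (p', v) \<Rightarrow> deref_after (p' @ [Open x]) v =
             take (length (deref p) - length (deref p)) (drop (length (deref p)) (deref p))"
        using cl[OF x] True by (auto split: option.splits)
      ultimately show ?thesis
        using st u' cl keep le Var True x val
        by (auto simp: sem_inv_def deref_snoc nearest_factor_snoc simp del: deref_after.simps)
    next
      case False
      have "S' y \<le> E' y \<and> E' y \<le> length (u' @ val)" for y
        using le[of y] by simp
      moreover have "u = u' @ val" "S = S'" "E = E'"
        using st Var False by (simp_all add: val_def)
      ultimately show ?thesis
        using u' cl'[of _ val] keep Var x val
        by (auto simp: sem_inv_def deref_snoc nearest_factor_snoc simp del: deref_after.simps)
    qed
  qed
qed

lemma deref_sem: "wb {} r \<Longrightarrow> deref r = fst (sem r)"
  using sem_inv_sem[of r "fst (sem r)" "fst (snd (sem r))" "snd (snd (sem r))"]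
  by (simp add: sem_inv_def)

lemma sem_le: "wb {} r \<Longrightarrow> sem r = (u, S, E) \<Longrightarrow> S x \<le> E x \<and> E x \<le> length u"
  using sem_inv_sem[of r u S E] by (auto simp: sem_inv_def)

lemma language_sem:
  assumes "is_nonempty_regex \<alpha>"
  shows "language \<alpha> = (\<lambda>r. fst (sem r)) ` ref_language \<alpha>"
proof -
  have "wb {} r" if "r \<in> ref_language \<alpha>" for r
    using wb_ref_language[OF assms _ that, of "{}" "[]"] by simp
  then show ?thesis unfolding language_def by (auto simp: deref_sem)
qed

section \<open>The graph of a regex\<close>

text \<open>
  A graph is given by four tables: the kind of a vertex (0: no symbol, 1: \<open>Open\<close>, 2: \<open>Close\<close>,
  3: \<open>Term\<close>, 4: \<open>Var\<close>), its label, and its at most two successors, where 0 means that there is none.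
  \<open>frag kd lb nx ny \<alpha> v k f\<close> says that \<open>\<alpha>\<close> is laid out between \<open>v\<close> and \<open>k\<close>, and that the other
  vertices used for it are \<open>f, \<dots>, f + fr \<alpha> - 1\<close>.
\<close>

fun fr :: "('a, 'v) regex \<Rightarrow> nat" where
  "fr (Cat \<alpha> \<beta>) = fr \<alpha> + fr \<beta> + 1"
| "fr (Alt \<alpha> \<beta>) = fr \<alpha> + fr \<beta> + 2"
| "fr (Plus \<alpha>) = fr \<alpha> + 1"
| "fr (Bind x \<alpha>) = fr \<alpha> + 2"
| "fr _ = 0"

type_synonym tab = "nat \<Rightarrow> nat"

fun frag :: "tab \<Rightarrow> tab \<Rightarrow> tab \<Rightarrow> tab \<Rightarrow> (nat, nat) regex \<Rightarrow> nat \<Rightarrow> nat \<Rightarrow> nat \<Rightarrow> bool" where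
  "frag kd lb nx ny Empty v k f = False"
| "frag kd lb nx ny Eps v k f = (kd v = 0 \<and> nx v = k \<and> ny v = 0)"
| "frag kd lb nx ny (Lit a) v k f = (kd v = 3 \<and> lb v = a \<and> nx v = k \<and> ny v = 0)"
| "frag kd lb nx ny (Ref x) v k f = (kd v = 4 \<and> lb v = x \<and> nx v = k \<and> ny v = 0)"
| "frag kd lb nx ny (Cat \<alpha> \<beta>) v k f =
    (frag kd lb nx ny \<alpha> v f (f + 1) \<and> frag kd lb nx ny \<beta> f k (f + 1 + fr \<alpha>))"
| "frag kd lb nx ny (Alt \<alpha> \<beta>) v k f =
    (kd v = 0 \<and> nx v = f \<and> ny v = f + 1 \<and>
     frag kd lb nx ny \<alpha> f k (f + 2) \<and> frag kd lb nx ny \<beta> (f + 1) k (f + 2 + fr \<alpha>))"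
| "frag kd lb nx ny (Plus \<alpha>) v k f =
    (kd f = 0 \<and> nx f = v \<and> ny f = k \<and> frag kd lb nx ny \<alpha> v f (f + 1))"
| "frag kd lb nx ny (Bind x \<alpha>) v k f =
    (kd v = 1 \<and> lb v = x \<and> nx v = f \<and> ny v = 0 \<and>
     kd (f + 1) = 2 \<and> lb (f + 1) = x \<and> nx (f + 1) = k \<and> ny (f + 1) = 0 \<and>
     frag kd lb nx ny \<alpha> f (f + 1) (f + 2))"

text \<open>The regular expression \<open>\<alpha>\<^sub>R\<close> with each atom replaced by its vertex.\<close>

fun vr :: "('a, 'v) regex \<Rightarrow> nat \<Rightarrow> nat \<Rightarrow> nat rexp" where
  "vr Empty v f = RZero"
| "vr Eps v f = ROne"
| "vr (Lit a) v f = RAtom v"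
| "vr (Ref x) v f = RAtom v"
| "vr (Cat \<alpha> \<beta>) v f = RConc (vr \<alpha> v (f + 1)) (vr \<beta> f (f + 1 + fr \<alpha>))"
| "vr (Alt \<alpha> \<beta>) v f = RAlt (vr \<alpha> f (f + 2)) (vr \<beta> (f + 1) (f + 2 + fr \<alpha>))"
| "vr (Plus \<alpha>) v f = RPlus (vr \<alpha> v (f + 1))"
| "vr (Bind x \<alpha>) v f = RConc (RAtom v) (RConc (vr \<alpha> f (f + 2)) (RAtom (f + 1)))"

definition vs :: "('a, 'v) regex \<Rightarrow> nat \<Rightarrow> nat \<Rightarrow> nat set" where
  "vs \<alpha> v f = insert v {f..<f + fr \<alpha>}"

text \<open>No atom occurs twice, so atoms serve as names of their positions.\<close>

fun lin :: "'s rexp \<Rightarrow> bool" where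
  "lin (RConc d e) \<longleftrightarrow> lin d \<and> lin e \<and> set_rexp d \<inter> set_rexp e = {}"
| "lin (RAlt d e) \<longleftrightarrow> lin d \<and> lin e \<and> set_rexp d \<inter> set_rexp e = {}"
| "lin (RPlus d) \<longleftrightarrow> lin d"
| "lin _ \<longleftrightarrow> True"

lemma set_vr: "set_rexp (vr \<alpha> v f) \<subseteq> vs \<alpha> v f"
proof (induction \<alpha> arbitrary: v f)
  case (Cat \<alpha> \<beta>)
  from Cat[of v "f + 1"] Cat(2)[of f "f + 1 + fr \<alpha>"] show ?case
    by (auto simp: vs_def subset_iff)
next
  case (Alt \<alpha> \<beta>)
  from Alt(1)[of f "f + 2"] Alt(2)[of "f + 1" "f + 2 + fr \<alpha>"] show ?case
    by (auto simp: vs_def subset_iff)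
next
  case (Plus \<alpha>)
  from Plus[of v "f + 1"] show ?case by (auto simp: vs_def subset_iff)
next
  case (Bind x \<alpha>)
  from Bind[of f "f + 2"] show ?case by (auto simp: vs_def subset_iff)
qed (auto simp: vs_def)

lemma disjoint_if: "A \<subseteq> A' \<Longrightarrow> B \<subseteq> B' \<Longrightarrow> A' \<inter> B' = {} \<Longrightarrow> A \<inter> B = {}"
  by blast

lemma lin_vr: "v < f \<Longrightarrow> lin (vr \<alpha> v f)"
proof (induction \<alpha> arbitrary: v f)
  case (Cat \<alpha> \<beta>)
  have "set_rexp (vr \<alpha> v (f + 1)) \<inter> set_rexp (vr \<beta> f (f + 1 + fr \<alpha>)) = {}"
    by (rule disjoint_if[OF set_vr set_vr]) (use Cat.prems in \<open>auto simp: vs_def\<close>)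
  then show ?case using Cat by simp
next
  case (Alt \<alpha> \<beta>)
  have "set_rexp (vr \<alpha> f (f + 2)) \<inter> set_rexp (vr \<beta> (f + 1) (f + 2 + fr \<alpha>)) = {}"
    by (rule disjoint_if[OF set_vr set_vr]) (use Alt.prems in \<open>auto simp: vs_def\<close>)
  then show ?case using Alt by simp
next
  case (Bind x \<alpha>)
  have "set_rexp (vr \<alpha> f (f + 2)) \<inter> {v, f + 1} = {}"
    by (rule disjoint_if[OF set_vr order_refl]) (use Bind.prems in \<open>auto simp: vs_def\<close>)
  then show ?case using Bind by auto
qed auto

lemma lang_conc_mono: "A \<subseteq> B \<Longrightarrow> lang_conc A K \<subseteq> lang_conc B K"
  by (auto simp: lang_conc_def)

section \<open>Marks and vertices as names of the atoms\<close>

lemma lang_conc_map: "lang_conc (map g ` A) (map g ` B) = map g ` lang_conc A B"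
  by (auto simp: lang_conc_def image_iff) (metis map_append)+

lemma lang_plus_map: "lang_plus (map g ` A) = map g ` lang_plus A"
proof -
  have "(\<exists>vs. us = map (map g) vs \<and> set vs \<subseteq> A)" if "set us \<subseteq> map g ` A" for us
    using that
  proof (induction us)
    case (Cons u us)
    then obtain vs v where "us = map (map g) vs" "set vs \<subseteq> A" "u = map g v" "v \<in> A" by auto
    then show ?case by (intro exI[of _ "v # vs"]) auto
  qed simp
  then have "lang_plus (map g ` A) \<subseteq> map g ` lang_plus A"
    by (fastforce simp: lang_plus_def simp flip: map_concat)
  moreover have "map g ` lang_plus A \<subseteq> lang_plus (map g ` A)"
  proof
    fix r assume "r \<in> map g ` lang_plus A"
    then obtain vs where vs: "r = map g (concat vs)" "vs \<noteq> []" "set vs \<subseteq> A"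
      by (auto simp: lang_plus_def)
    then have "r = concat (map (map g) vs)" "map (map g) vs \<noteq> []" "set (map (map g) vs) \<subseteq> map g ` A"
      by (auto simp: map_concat)
    then show "r \<in> lang_plus (map g ` A)" unfolding lang_plus_def by blast
  qed
  ultimately show ?thesis by blast
qed

lemma rexp_lang_map: "rexp_lang (map_rexp g e) = map g ` rexp_lang e"
  by (induction e) (auto simp: lang_conc_map lang_plus_map)

lemma set_rexp_lang: "r \<in> rexp_lang e \<Longrightarrow> set r \<subseteq> set_rexp e"
  by (induction e arbitrary: r) (fastforce simp: lang_conc_def lang_plus_def)+

lemma inj_on_combine:
  fixes h1 h2 :: "'s \<Rightarrow> nat"
  assumes "inj_on h1 A" "h1 ` A \<subseteq> {i..<j}" "inj_on h2 B" "h2 ` B \<subseteq> {j..<k}" "i \<le> j" "j \<le> k"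
    and "A \<inter> B = {}"
  shows "\<exists>h. inj_on h (A \<union> B) \<and> h ` (A \<union> B) \<subseteq> {i..<k} \<and> (\<forall>u\<in>A. h u = h1 u) \<and> (\<forall>u\<in>B. h u = h2 u)"
proof -
  define h where "h u = (if u \<in> A then h1 u else h2 u)" for u
  have hA: "\<forall>u\<in>A. h u = h1 u" and hB: "\<forall>u\<in>B. h u = h2 u" using assms(7) by (auto simp: h_def)
  then have im: "h ` A = h1 ` A" "h ` B = h2 ` B" by auto
  have "inj_on h A" "inj_on h B" using hA hB assms(1,3) by (auto simp: inj_on_def)
  moreover have "h ` A \<inter> h ` B = {}" unfolding im using assms(2,4) by fastforce
  ultimately have "inj_on h (A \<union> B)" unfolding inj_on_Un by blast
  moreover have "h ` (A \<union> B) \<subseteq> {i..<k}"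
    unfolding image_Un im using assms(2,4-6) by fastforce
  ultimately show ?thesis using hA hB by blast
qed

text \<open>Marks and vertices both tell all atoms apart, hence they differ by an injective renaming
  \<open>h\<close>. The bounds on its range allow the renamings of two subexpressions to be glued
  together.\<close>

lemma mark_map_rexp:
  assumes "lin e"
  shows "\<exists>h. inj_on h (set_rexp e) \<and> h ` set_rexp e \<subseteq> {i..<snd (mark i (map_rexp g e))} \<and>
    i \<le> snd (mark i (map_rexp g e)) \<and>
    fst (mark i (map_rexp g e)) = map_rexp (\<lambda>u. (g u, h u)) e"
  using assms
proof (induction e arbitrary: i)
  case (RAtom s)
  then show ?case by (intro exI[of _ "\<lambda>_. i"]) auto
next
  case (RConc d e)
  let ?j = "snd (mark i (map_rexp g d))"
  obtain h1 where h1: "inj_on h1 (set_rexp d)" "h1 ` set_rexp d \<subseteq> {i..<?j}" "i \<le> ?j"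
    "fst (mark i (map_rexp g d)) = map_rexp (\<lambda>u. (g u, h1 u)) d"
    using RConc.IH(1)[of i] RConc.prems unfolding lin.simps by blast
  let ?k = "snd (mark ?j (map_rexp g e))"
  obtain h2 where h2: "inj_on h2 (set_rexp e)" "h2 ` set_rexp e \<subseteq> {?j..<?k}" "?j \<le> ?k"
    "fst (mark ?j (map_rexp g e)) = map_rexp (\<lambda>u. (g u, h2 u)) e"
    using RConc.IH(2)[of ?j] RConc.prems unfolding lin.simps by blast
  have disj: "set_rexp d \<inter> set_rexp e = {}" using RConc.prems by simp
  obtain h where h: "inj_on h (set_rexp d \<union> set_rexp e)" "h ` (set_rexp d \<union> set_rexp e) \<subseteq> {i..<?k}"
    "\<forall>u\<in>set_rexp d. h u = h1 u" "\<forall>u\<in>set_rexp e. h u = h2 u"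
    using inj_on_combine[OF h1(1,2) h2(1,2) h1(3) h2(3) disj] by blast
  have "map_rexp (\<lambda>u. (g u, h u)) d = map_rexp (\<lambda>u. (g u, h1 u)) d"
    "map_rexp (\<lambda>u. (g u, h u)) e = map_rexp (\<lambda>u. (g u, h2 u)) e"
    using h(3,4) by (auto intro!: rexp.map_cong0)
  then show ?case
    using h h1 h2 by (intro exI[of _ h]) (auto simp: split_beta Let_def)
next
  case (RAlt d e)
  let ?j = "snd (mark i (map_rexp g d))"
  obtain h1 where h1: "inj_on h1 (set_rexp d)" "h1 ` set_rexp d \<subseteq> {i..<?j}" "i \<le> ?j"
    "fst (mark i (map_rexp g d)) = map_rexp (\<lambda>u. (g u, h1 u)) d"
    using RAlt.IH(1)[of i] RAlt.prems unfolding lin.simps by blast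
  let ?k = "snd (mark ?j (map_rexp g e))"
  obtain h2 where h2: "inj_on h2 (set_rexp e)" "h2 ` set_rexp e \<subseteq> {?j..<?k}" "?j \<le> ?k"
    "fst (mark ?j (map_rexp g e)) = map_rexp (\<lambda>u. (g u, h2 u)) e"
    using RAlt.IH(2)[of ?j] RAlt.prems unfolding lin.simps by blast
  have disj: "set_rexp d \<inter> set_rexp e = {}" using RAlt.prems by simp
  obtain h where h: "inj_on h (set_rexp d \<union> set_rexp e)" "h ` (set_rexp d \<union> set_rexp e) \<subseteq> {i..<?k}"
    "\<forall>u\<in>set_rexp d. h u = h1 u" "\<forall>u\<in>set_rexp e. h u = h2 u"
    using inj_on_combine[OF h1(1,2) h2(1,2) h1(3) h2(3) disj] by blast
  have "map_rexp (\<lambda>u. (g u, h u)) d = map_rexp (\<lambda>u. (g u, h1 u)) d"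
    "map_rexp (\<lambda>u. (g u, h u)) e = map_rexp (\<lambda>u. (g u, h2 u)) e"
    using h(3,4) by (auto intro!: rexp.map_cong0)
  then show ?case
    using h h1 h2 by (intro exI[of _ h]) (auto simp: split_beta Let_def)
next
  case (RPlus e)
  then show ?case by (auto simp: split_beta Let_def)
qed auto

section \<open>Walks and the words they spell\<close>

locale graph =
  fixes kd lb nx ny :: tab
begin

text \<open>Vertices of kind 0 fall under the last case, but a walk never lists them.\<close>

definition sym :: "nat \<Rightarrow> (nat, nat) symbol" where
  "sym u = (if kd u = 1 then Open (lb u) else if kd u = 2 then Close (lb u)
    else if kd u = 3 then Term (lb u) else Var (lb u))"

abbreviation "fra \<equiv> frag kd lb nx ny"

text \<open>A vertex is read when it is left; the symbol of the target is not part of the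
  list.\<close>

inductive walk :: "nat \<Rightarrow> nat list \<Rightarrow> nat \<Rightarrow> bool" where
  walk_refl: "walk u [] u"
| walk_eps: "kd u = 0 \<Longrightarrow> u' = nx u \<or> u' = ny u \<Longrightarrow> u' \<noteq> 0 \<Longrightarrow> walk u' l t \<Longrightarrow> walk u l t"
| walk_sym: "kd u \<noteq> 0 \<Longrightarrow> nx u \<noteq> 0 \<Longrightarrow> walk (nx u) l t \<Longrightarrow> walk u (u # l) t"

definition lab :: "nat \<Rightarrow> nat list" where
  "lab u = (if kd u = 0 then [] else [u])"

lemma walk_nx: "nx u \<noteq> 0 \<Longrightarrow> walk u (lab u) (nx u)"
  by (auto simp: lab_def intro: walk.intros)

lemma walk_trans: "walk u l m \<Longrightarrow> walk m l' t \<Longrightarrow> walk u (l @ l') t"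
  by (induction rule: walk.induct) (auto intro: walk.intros)

lemma walk_split: "walk u l t \<Longrightarrow> l = l1 @ l2 \<Longrightarrow> \<exists>m. walk u l1 m \<and> walk m l2 t"
proof (induction arbitrary: l1 rule: walk.induct)
  case (walk_sym u l t)
  show ?case
  proof (cases l1)
    case Nil
    then show ?thesis using walk_sym walk.walk_sym walk_refl by fastforce
  next
    case (Cons a l1')
    then show ?thesis using walk_sym walk.walk_sym by fastforce
  qed
qed (auto intro: walk.intros)

lemma walk_ConsD: "walk u l t \<Longrightarrow> l = v # l' \<Longrightarrow> kd v \<noteq> 0 \<and> walk u [] v \<and> walk (nx v) l' t"
  by (induction rule: walk.induct) (auto intro: walk.intros)

lemma walk_kd: "walk u l t \<Longrightarrow> u' \<in> set l \<Longrightarrow> kd u' \<noteq> 0"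
  by (induction rule: walk.induct) auto

lemma ref_rexp_vr: "fra \<alpha> v k f \<Longrightarrow> ref_rexp \<alpha> = map_rexp sym (vr \<alpha> v f)"
  by (induction \<alpha> arbitrary: v k f) (auto simp: sym_def)

lemma walk_if_rexp_lang:
  assumes "fra \<alpha> v k f" "l \<in> rexp_lang (vr \<alpha> v f)" "v \<noteq> 0" "k \<noteq> 0" "0 < f"
  shows "walk v l k"
  using assms
proof (induction \<alpha> arbitrary: v k f l)
  case (Cat \<alpha> \<beta>)
  then obtain l1 l2 where l: "l = l1 @ l2" "l1 \<in> rexp_lang (vr \<alpha> v (f + 1))"
    "l2 \<in> rexp_lang (vr \<beta> f (f + 1 + fr \<alpha>))" by (auto simp: lang_conc_def)
  show ?case unfolding l(1)
    by (rule walk_trans[OF Cat.IH(1)[OF _ l(2)] Cat.IH(2)[OF _ l(3)]]) (use Cat.prems in auto)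
next
  case (Alt \<alpha> \<beta>)
  then consider "l \<in> rexp_lang (vr \<alpha> f (f + 2))" | "l \<in> rexp_lang (vr \<beta> (f + 1) (f + 2 + fr \<alpha>))"
    by auto
  then show ?case
  proof cases
    case 1
    then have "walk f l k" using Alt.IH(1)[of f k "f + 2" l] Alt.prems by simp
    then show ?thesis using Alt.prems by (intro walk_eps[of v f]) auto
  next
    case 2
    then have "walk (f + 1) l k"
      using Alt.IH(2)[of "f + 1" k "f + 2 + fr \<alpha>" l] Alt.prems by simp
    then show ?thesis using Alt.prems by (intro walk_eps[of v "f + 1"]) auto
  qed
next
  case (Plus \<alpha>)
  have "walk v (concat us) f \<and> walk f [] k" if "us \<noteq> []" "set us \<subseteq> rexp_lang (vr \<alpha> v (f + 1))" for us
    using that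
  proof (induction us)
    case (Cons u us)
    have u: "walk v u f" by (rule Plus.IH[of v f "f + 1"]) (use Plus.prems Cons.prems in auto)
    have k: "walk f [] k" using Plus.prems by (auto intro: walk.intros)
    show ?case
    proof (cases "us = []")
      case False
      then have "walk v (concat us) f" using Cons by auto
      then have "walk f (concat us) f" using Plus.prems by (auto intro: walk_eps)
      from walk_trans[OF u this] show ?thesis using k by simp
    qed (use u k in auto)
  qed simp
  then show ?case using Plus.prems walk_trans[of v _ f "[]" k] by (auto simp: lang_plus_def)
next
  case (Bind x \<alpha>)
  then obtain u where u: "l = v # u @ [f + 1]" "u \<in> rexp_lang (vr \<alpha> f (f + 2))"
    by (auto simp: lang_conc_def)
  have "walk f u (f + 1)" by (rule Bind.IH[OF _ u(2)]) (use Bind.prems in auto)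
  moreover have "walk (f + 1) [f + 1] k" using Bind.prems by (auto intro!: walk.intros)
  ultimately have "walk f (u @ [f + 1]) k" by (rule walk_trans)
  then show ?case using Bind.prems u(1) by (auto intro!: walk_sym)
next
  case (Eps v k f l)
  then show ?case using walk_nx[of v] by (auto simp: lab_def)
next
  case (Lit a v k f l)
  then show ?case using walk_nx[of v] by (auto simp: lab_def)
next
  case (Ref x v k f l)
  then show ?case using walk_nx[of v] by (auto simp: lab_def)
qed auto

text \<open>\<open>M u\<close> over-approximates the words spelled from \<open>u\<close> to the exit
  \<open>k\<close>. Closure under single edges is a local condition, which replaces an analysis of
  the shape of walks.\<close>

definition suffix_closed :: "nat set \<Rightarrow> nat \<Rightarrow> (nat \<Rightarrow> nat list set) \<Rightarrow> bool" where
  "suffix_closed U k M \<longleftrightarrow> (\<forall>u\<in>U. \<forall>u'. (u' = nx u \<or> u' = ny u) \<longrightarrow> u' \<noteq> 0 \<longrightarrow>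
    (u' \<in> U \<or> u' = k) \<and> (\<forall>l\<in>M u'. lab u @ l \<in> M u))"

lemma suffix_closed_Un:
  assumes "suffix_closed U k M" "suffix_closed U' k' M'" "U \<inter> U' = {}" "k' \<notin> U"
    and "k \<in> U' \<or> k = k'" "M k = M' k"
  shows "suffix_closed (U \<union> U') k' (\<lambda>u. if u \<in> U then M u else M' u)"
  unfolding suffix_closed_def
proof (intro ballI allI impI)
  fix u u' assume u: "u \<in> U \<union> U'" "u' = nx u \<or> u' = ny u" "u' \<noteq> 0"
  show "(u' \<in> U \<union> U' \<or> u' = k') \<and> (\<forall>l\<in>if u' \<in> U then M u' else M' u'.
      lab u @ l \<in> (if u \<in> U then M u else M' u))"
  proof (cases "u \<in> U")
    case True
    then have "u' \<in> U \<or> u' = k" "\<forall>l\<in>M u'. lab u @ l \<in> M u"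
      using assms(1) u(2,3) unfolding suffix_closed_def by blast+
    then show ?thesis using True assms(5,6) by auto
  next
    case False
    then have "u \<in> U'" using u(1) by blast
    then have "u' \<in> U' \<or> u' = k'" "\<forall>l\<in>M' u'. lab u @ l \<in> M' u"
      using assms(2) u(2,3) unfolding suffix_closed_def by blast+
    moreover have "u' \<notin> U" using calculation(1) assms(3,4) by blast
    ultimately show ?thesis using False by auto
  qed
qed

text \<open>Assigning to each vertex a language of suffixes that is closed under the edges shows that every
  walk through the graph of \<open>\<alpha>\<close> spells a word of \<open>\<alpha>\<close>.\<close>

lemma ex_suffix_closed:
  assumes "fra \<alpha> v k f" "v < f" "k < f" "v \<noteq> k"
  shows "\<exists>M. M k = K \<and> M v \<subseteq> lang_conc (rexp_lang (vr \<alpha> v f)) K \<and> suffix_closed (vs \<alpha> v f) k M"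
  using assms
proof (induction \<alpha> arbitrary: v k f K)
  case Eps
  then show ?case
    by (intro exI[of _ "\<lambda>_. K"]) (auto simp: lang_conc_def suffix_closed_def vs_def lab_def)
next
  case (Lit a)
  then show ?case
    by (intro exI[of _ "(\<lambda>_. lang_conc {[v]} K)(k := K)"])
      (auto simp: lang_conc_def suffix_closed_def vs_def lab_def)
next
  case (Ref x)
  then show ?case
    by (intro exI[of _ "(\<lambda>_. lang_conc {[v]} K)(k := K)"])
      (auto simp: lang_conc_def suffix_closed_def vs_def lab_def)
next
  case (Cat \<alpha> \<beta>)
  let ?B = "rexp_lang (vr \<beta> f (f + 1 + fr \<alpha>))"
  obtain M2 where M2: "M2 k = K" "M2 f \<subseteq> lang_conc ?B K"
    "suffix_closed (vs \<beta> f (f + 1 + fr \<alpha>)) k M2"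
    using Cat.IH(2)[of f k "f + 1 + fr \<alpha>" K] Cat.prems by auto
  obtain M1 where M1: "M1 f = M2 f" "M1 v \<subseteq> lang_conc (rexp_lang (vr \<alpha> v (f + 1))) (M2 f)"
    "suffix_closed (vs \<alpha> v (f + 1)) f M1"
    using Cat.IH(1)[of v f "f + 1" "M2 f"] Cat.prems by auto
  have "suffix_closed (vs \<alpha> v (f + 1) \<union> vs \<beta> f (f + 1 + fr \<alpha>)) k
      (\<lambda>u. if u \<in> vs \<alpha> v (f + 1) then M1 u else M2 u)"
    using Cat.prems by (intro suffix_closed_Un[OF M1(3) M2(3)]) (auto simp: vs_def M1)
  moreover have "vs \<alpha> v (f + 1) \<union> vs \<beta> f (f + 1 + fr \<alpha>) = vs (Cat \<alpha> \<beta>) v f"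
    by (auto simp: vs_def)
  moreover have "M1 v \<subseteq> lang_conc (rexp_lang (vr (Cat \<alpha> \<beta>) v f)) K"
    using M1(2) M2(2) by (auto simp: lang_conc_def) (smt (verit) append_assoc mem_Collect_eq subset_iff)
  ultimately show ?case
    using M2(1) Cat.prems
    by (intro exI[of _ "\<lambda>u. if u \<in> vs \<alpha> v (f + 1) then M1 u else M2 u"]) (auto simp: vs_def)
next
  case (Alt \<alpha> \<beta>)
  let ?A = "rexp_lang (vr \<alpha> f (f + 2))" and ?B = "rexp_lang (vr \<beta> (f + 1) (f + 2 + fr \<alpha>))"
  let ?VA = "vs \<alpha> f (f + 2)" and ?VB = "vs \<beta> (f + 1) (f + 2 + fr \<alpha>)"
  obtain M1 where M1: "M1 k = K" "M1 f \<subseteq> lang_conc ?A K" "suffix_closed ?VA k M1"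
    using Alt.IH(1)[of f k "f + 2" K] Alt.prems by auto
  obtain M2 where M2: "M2 k = K" "M2 (f + 1) \<subseteq> lang_conc ?B K" "suffix_closed ?VB k M2"
    using Alt.IH(2)[of "f + 1" k "f + 2 + fr \<alpha>" K] Alt.prems by auto
  have disj: "?VA \<inter> ?VB = {}" "k \<notin> ?VA" "v \<notin> ?VA \<union> ?VB" using Alt.prems by (auto simp: vs_def)
  define M where "M u = (if u \<in> ?VA then M1 u else M2 u)" for u
  have M: "suffix_closed (?VA \<union> ?VB) k M"
    unfolding M_def using suffix_closed_Un[OF M1(3) M2(3) disj(1,2)] M1(1) M2(1) by simp
  have Mk: "M k = K" "M f = M1 f" "M (f + 1) = M2 (f + 1)"
    using disj M2(1) by (auto simp: M_def vs_def)
  have V: "vs (Alt \<alpha> \<beta>) v f = insert v (?VA \<union> ?VB)" by (auto simp: vs_def)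
  have fV: "f \<in> ?VA" "f + 1 \<in> ?VB" by (auto simp: vs_def)
  have "suffix_closed (vs (Alt \<alpha> \<beta>) v f) k (M(v := M f \<union> M (f + 1)))"
    unfolding V suffix_closed_def
  proof (intro ballI allI impI)
    fix u u' assume u: "u \<in> insert v (?VA \<union> ?VB)" "u' = nx u \<or> u' = ny u" "u' \<noteq> 0"
    show "(u' \<in> insert v (?VA \<union> ?VB) \<or> u' = k) \<and>
      (\<forall>l\<in>(M(v := M f \<union> M (f + 1))) u'. lab u @ l \<in> (M(v := M f \<union> M (f + 1))) u)"
    proof (cases "u = v")
      case True
      then have "u' = f \<or> u' = f + 1" "lab u = []" using u Alt.prems by (auto simp: lab_def)
      then show ?thesis using fV True Alt.prems by auto
    next
      case False
      then have "(u' \<in> ?VA \<union> ?VB \<or> u' = k) \<and> (\<forall>l\<in>M u'. lab u @ l \<in> M u)"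
        using u M unfolding suffix_closed_def by blast
      moreover have "u' \<noteq> v" using calculation disj(3) Alt.prems by auto
      ultimately show ?thesis using False by auto
    qed
  qed
  moreover have "(M(v := M f \<union> M (f + 1))) v \<subseteq> lang_conc (rexp_lang (vr (Alt \<alpha> \<beta>) v f)) K"
    using Mk M1(2) M2(2) lang_conc_mono[of ?A "?A \<union> ?B" K] lang_conc_mono[of ?B "?A \<union> ?B" K]
    by auto
  moreover have "(M(v := M f \<union> M (f + 1))) k = K" using Mk Alt.prems by simp
  ultimately show ?case by blast
next
  case (Plus \<alpha>)
  let ?A = "rexp_lang (vr \<alpha> v (f + 1))"
  \<comment> \<open>At the loop vertex one either leaves at once or passes through the body again,
    which explains the two parts of its suffix language.\<close>
  let ?K = "K \<union> lang_conc (lang_plus ?A) K"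
  obtain M1 where M1: "M1 f = ?K" "M1 v \<subseteq> lang_conc ?A ?K" "suffix_closed (vs \<alpha> v (f + 1)) f M1"
    using Plus.IH[of v f "f + 1" ?K] Plus.prems by auto
  have A: "lang_conc ?A ?K \<subseteq> lang_conc (lang_plus ?A) K"
  proof
    fix l assume "l \<in> lang_conc ?A ?K"
    then obtain l1 l2 where l: "l = l1 @ l2" "l1 \<in> ?A" "l2 \<in> ?K" by (auto simp: lang_conc_def)
    show "l \<in> lang_conc (lang_plus ?A) K"
    proof (cases "l2 \<in> K")
      case True
      have "l1 \<in> lang_plus ?A" unfolding lang_plus_def
        using l(2) by (auto intro!: exI[of _ "[l1]"])
      then show ?thesis using True l(1) by (auto simp: lang_conc_def)
    next
      case False
      then obtain us l3 where us: "l2 = concat us @ l3" "l3 \<in> K" "set us \<subseteq> ?A"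
        using l(3) by (auto simp: lang_conc_def lang_plus_def)
      have "concat (l1 # us) \<in> lang_plus ?A" unfolding lang_plus_def
        using l(2) us(3) by (intro CollectI exI[of _ "l1 # us"]) auto
      then show ?thesis using us(1,2) l(1) unfolding lang_conc_def
        by (intro CollectI exI[of _ "concat (l1 # us)"] exI[of _ l3]) auto
    qed
  qed
  have V: "vs (Plus \<alpha>) v f = insert f (vs \<alpha> v (f + 1))" by (auto simp: vs_def)
  have k: "k \<notin> vs \<alpha> v (f + 1)" "f \<notin> vs \<alpha> v (f + 1)" "v \<in> vs \<alpha> v (f + 1)" "k \<noteq> f"
    using Plus.prems by (auto simp: vs_def)
  have "suffix_closed (vs (Plus \<alpha>) v f) k (M1(k := K))"
    unfolding V suffix_closed_def
  proof (intro ballI allI impI)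
    fix u u' assume u: "u \<in> insert f (vs \<alpha> v (f + 1))" "u' = nx u \<or> u' = ny u" "u' \<noteq> 0"
    show "(u' \<in> insert f (vs \<alpha> v (f + 1)) \<or> u' = k) \<and>
      (\<forall>l\<in>(M1(k := K)) u'. lab u @ l \<in> (M1(k := K)) u)"
    proof (cases "u = f")
      case True
      then have "u' = v \<or> u' = k" "lab u = []" using u Plus.prems by (auto simp: lab_def)
      then show ?thesis using True M1(1,2) A k Plus.prems by auto
    next
      case False
      then have "u \<in> vs \<alpha> v (f + 1)" using u by blast
      then have "(u' \<in> vs \<alpha> v (f + 1) \<or> u' = f) \<and> (\<forall>l\<in>M1 u'. lab u @ l \<in> M1 u)"
        using u(2,3) M1(3) unfolding suffix_closed_def by blast
      then show ?thesis using \<open>u \<in> vs \<alpha> v (f + 1)\<close> k by auto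
    qed
  qed
  moreover have "(M1(k := K)) v \<subseteq> lang_conc (rexp_lang (vr (Plus \<alpha>) v f)) K"
    using M1(2) A Plus.prems by auto
  moreover have "(M1(k := K)) k = K" by simp
  ultimately show ?case by blast
next
  case (Bind x \<alpha>)
  let ?A = "rexp_lang (vr \<alpha> f (f + 2))"
  let ?K = "lang_conc {[f + 1]} K"
  have "\<exists>M. M (f + 1) = ?K \<and> M f \<subseteq> lang_conc ?A ?K \<and> suffix_closed (vs \<alpha> f (f + 2)) (f + 1) M"
    by (rule Bind.IH) (use Bind.prems(1) in simp_all)
  then obtain M1 where M1: "M1 (f + 1) = ?K" "M1 f \<subseteq> lang_conc ?A ?K"
    "suffix_closed (vs \<alpha> f (f + 2)) (f + 1) M1" by blast
  have V: "vs (Bind x \<alpha>) v f = insert v (insert (f + 1) (vs \<alpha> f (f + 2)))" by (auto simp: vs_def)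
  have k: "k \<notin> vs \<alpha> f (f + 2)" "v \<notin> vs \<alpha> f (f + 2)" "f + 1 \<notin> vs \<alpha> f (f + 2)"
    "f \<in> vs \<alpha> f (f + 2)" "k \<noteq> f + 1" "v \<noteq> f + 1" "k \<noteq> f" "v \<noteq> f"
    using Bind.prems by (auto simp: vs_def)
  let ?M = "M1(v := lang_conc {[v]} (M1 f), k := K)"
  have "suffix_closed (vs (Bind x \<alpha>) v f) k ?M"
    unfolding V suffix_closed_def
  proof (intro ballI allI impI)
    fix u u' assume u: "u \<in> insert v (insert (f + 1) (vs \<alpha> f (f + 2)))" "u' = nx u \<or> u' = ny u" "u' \<noteq> 0"
    consider "u = v" | "u = f + 1" | "u \<in> vs \<alpha> f (f + 2)" using u by blast
    then show "(u' \<in> insert v (insert (f + 1) (vs \<alpha> f (f + 2))) \<or> u' = k) \<and>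
      (\<forall>l\<in>?M u'. lab u @ l \<in> ?M u)"
    proof cases
      case 1
      then have "u' = f" "lab u = [v]" using u Bind.prems by (auto simp: lab_def)
      then show ?thesis using 1 k Bind.prems by (auto simp: lang_conc_def)
    next
      case 2
      then have "u' = k" "lab u = [f + 1]" using u Bind.prems by (auto simp: lab_def)
      then show ?thesis using 2 k M1(1) by (auto simp: lang_conc_def)
    next
      case 3
      then have "(u' \<in> vs \<alpha> f (f + 2) \<or> u' = f + 1) \<and> (\<forall>l\<in>M1 u'. lab u @ l \<in> M1 u)"
        using u(2,3) M1(3) unfolding suffix_closed_def by blast
      then show ?thesis using 3 k by auto
    qed
  qed
  moreover have "lang_conc {[v]} (M1 f) \<subseteq> lang_conc (rexp_lang (vr (Bind x \<alpha>) v f)) K"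
  proof
    fix l assume "l \<in> lang_conc {[v]} (M1 f)"
    then obtain l1 l2 where l: "l = v # l1 @ (f + 1) # l2" "l1 \<in> ?A" "l2 \<in> K"
      using M1(2) by (auto simp: lang_conc_def subset_iff)
    have "l1 @ [f + 1] \<in> lang_conc ?A {[f + 1]}" unfolding lang_conc_def using l(2) by blast
    then have "[v] @ l1 @ [f + 1] \<in> rexp_lang (vr (Bind x \<alpha>) v f)"
      unfolding vr.simps rexp_lang.simps lang_conc_def[of "{[v]}"] by blast
    moreover have "l = ([v] @ l1 @ [f + 1]) @ l2" using l(1) by simp
    ultimately show "l \<in> lang_conc (rexp_lang (vr (Bind x \<alpha>) v f)) K"
      using l(3) unfolding lang_conc_def by blast
  qed
  then have "?M v \<subseteq> lang_conc (rexp_lang (vr (Bind x \<alpha>) v f)) K" using Bind.prems(4) by simp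
  moreover have "?M k = K" by simp
  ultimately show ?case by blast
qed simp

text \<open>Since \<open>Empty\<close> has no layout, no vertex is a dead end. Every walk from the
  entry is thus a prefix of a ref-word, and determinism applies to it.\<close>

lemma coreachable:
  assumes "fra \<alpha> v k f" "u \<in> vs \<alpha> v f" "v \<noteq> 0" "k \<noteq> 0" "0 < f"
  shows "\<exists>l. walk u l k"
  using assms
proof (induction \<alpha> arbitrary: v k f u)
  case (Cat \<alpha> \<beta>)
  have f: "\<exists>l. walk f l k"
    using Cat.IH(2)[of f k "f + 1 + fr \<alpha>" f] Cat.prems by (auto simp: vs_def)
  consider "u \<in> vs \<alpha> v (f + 1)" | "u \<in> vs \<beta> f (f + 1 + fr \<alpha>)"
    using Cat.prems(2) by (fastforce simp: vs_def)
  then show ?case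
  proof cases
    case 1
    then show ?thesis using Cat.IH(1)[of v f "f + 1" u] Cat.prems f walk_trans by fastforce
  next
    case 2
    then show ?thesis using Cat.IH(2)[of f k "f + 1 + fr \<alpha>" u] Cat.prems by auto
  qed
next
  case (Alt \<alpha> \<beta>)
  have f: "\<exists>l. walk f l k"
    using Alt.IH(1)[of f k "f + 2" f] Alt.prems by (auto simp: vs_def)
  consider "u = v" | "u \<in> vs \<alpha> f (f + 2)" | "u \<in> vs \<beta> (f + 1) (f + 2 + fr \<alpha>)"
    using Alt.prems(2) by (fastforce simp: vs_def)
  then show ?case
  proof cases
    case 1
    then show ?thesis using f Alt.prems walk_eps[of v f] by auto
  next
    case 2
    then show ?thesis using Alt.IH(1)[of f k "f + 2" u] Alt.prems by auto
  next
    case 3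
    then show ?thesis using Alt.IH(2)[of "f + 1" k "f + 2 + fr \<alpha>" u] Alt.prems by auto
  qed
next
  case (Plus \<alpha>)
  have f: "walk f [] k" using Plus.prems by (auto intro: walk.intros)
  show ?case
  proof (cases "u = f")
    case False
    then have "\<exists>l. walk u l f"
      using Plus.IH[of v f "f + 1" u] Plus.prems by (fastforce simp: vs_def)
    then show ?thesis using f walk_trans by blast
  qed (use f in auto)
next
  case (Bind x \<alpha>)
  have f1: "walk (f + 1) [f + 1] k" using Bind.prems by (auto intro!: walk.intros)
  have f: "\<exists>l. walk f l (f + 1)"
    using Bind.IH[of f "f + 1" "f + 2" f] Bind.prems by (auto simp: vs_def)
  consider "u = v" | "u = f + 1" | "u \<in> vs \<alpha> f (f + 2)"
    using Bind.prems(2) by (fastforce simp: vs_def)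
  then show ?case
  proof cases
    case 1
    obtain l where "walk f l (f + 1)" using f by blast
    from walk_trans[OF this f1] have "walk v (v # l @ [f + 1]) k"
      using Bind.prems by (intro walk_sym) auto
    then show ?thesis using 1 by blast
  next
    case 2
    then show ?thesis using f1 by auto
  next
    case 3
    then show ?thesis
      using Bind.IH[of f "f + 1" "f + 2" u] Bind.prems f1 walk_trans by fastforce
  qed
next
  case (Eps v k f u)
  then show ?case using walk_nx[of v] by (auto simp: vs_def)
next
  case (Lit a v k f u)
  then show ?case using walk_nx[of v] by (auto simp: vs_def)
next
  case (Ref x v k f u)
  then show ?case using walk_nx[of v] by (auto simp: vs_def)
qed auto

end

section \<open>Determinism\<close>

lemma is_nonempty_regex_size: "is_nonempty_regex \<alpha> \<Longrightarrow> fr \<alpha> \<le> 2 * regex_length \<alpha>"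
  by (induction \<alpha>) auto

context graph
begin

lemma frag_facts:
  assumes "fra \<alpha> v k f" "u \<in> vs \<alpha> v f" "v \<noteq> 0" "k \<noteq> 0" "0 < f"
  shows "kd u \<le> 4 \<and> nx u \<noteq> 0 \<and> (kd u \<noteq> 0 \<longrightarrow> ny u = 0) \<and> (kd u = 3 \<longrightarrow> lb u \<in> lits \<alpha>) \<and>
    (kd u \<noteq> 0 \<and> kd u \<noteq> 3 \<longrightarrow> lb u \<in> vars \<alpha>)"
  using assms
proof (induction \<alpha> arbitrary: v k f u)
  case (Cat \<alpha> \<beta>)
  consider "u \<in> vs \<alpha> v (f + 1)" | "u \<in> vs \<beta> f (f + 1 + fr \<alpha>)"
    using Cat.prems(2) by (fastforce simp: vs_def)
  then show ?case
  proof cases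
    case 1
    then show ?thesis using Cat.IH(1)[of v f "f + 1" u] Cat.prems by auto
  next
    case 2
    then show ?thesis using Cat.IH(2)[of f k "f + 1 + fr \<alpha>" u] Cat.prems by auto
  qed
next
  case (Alt \<alpha> \<beta>)
  consider "u = v" | "u \<in> vs \<alpha> f (f + 2)" | "u \<in> vs \<beta> (f + 1) (f + 2 + fr \<alpha>)"
    using Alt.prems(2) by (fastforce simp: vs_def)
  then show ?case
  proof cases
    case 2
    then show ?thesis using Alt.IH(1)[of f k "f + 2" u] Alt.prems by auto
  next
    case 3
    then show ?thesis using Alt.IH(2)[of "f + 1" k "f + 2 + fr \<alpha>" u] Alt.prems by auto
  qed (use Alt.prems in auto)
next
  case (Plus \<alpha>)
  then show ?case
    using Plus.IH[of v f "f + 1" u] by (cases "u = f") (fastforce simp: vs_def)+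
next
  case (Bind x \<alpha>)
  consider "u = v" | "u = f + 1" | "u \<in> vs \<alpha> f (f + 2)"
    using Bind.prems(2) by (fastforce simp: vs_def)
  then show ?case
  proof cases
    case 3
    then show ?thesis using Bind.IH[of f "f + 1" "f + 2" u] Bind.prems by auto
  qed (use Bind.prems in auto)
qed (auto simp: vs_def)

abbreviation br :: "nat \<Rightarrow> bool" where "br u \<equiv> kd u = 1 \<or> kd u = 2"

lemma is_bracket_sym: "is_bracket (sym u) \<longleftrightarrow> br u"
  by (simp add: sym_def)

end

text \<open>Vertex 0 means absence. Vertex 1 is the exit, turned into a terminal with the letter
  \<sigma> that occurs nowhere else. Vertex 2 only precedes the entry 3, so that the initial
  situation is, like every other one, described by the vertex read last.\<close>

locale regex_graph = graph kd lb nx ny for kd lb nx ny :: tab +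
  fixes \<alpha> :: "(nat, nat) regex" and \<sigma> :: nat
  assumes nonempty: "is_nonempty_regex \<alpha>" and frag: "frag kd lb nx ny \<alpha> 3 1 4"
    and final: "kd 1 = 3" "lb 1 = \<sigma>" "nx 1 = 0" "ny 1 = 0"
    and start: "nx 2 = 3"
    and lits: "lits \<alpha> \<subseteq> {..<\<sigma>}"
begin

abbreviation "U \<equiv> vs \<alpha> 3 4"

definition L :: "nat list set" where "L = {l. walk 3 l 1}"

lemma L_eq: "L = rexp_lang (vr \<alpha> 3 4)"
proof
  show "rexp_lang (vr \<alpha> 3 4) \<subseteq> L"
    unfolding L_def using walk_if_rexp_lang[OF frag] by auto
  obtain M where M: "M 1 = {[]}" "M 3 \<subseteq> lang_conc (rexp_lang (vr \<alpha> 3 4)) {[]}" "suffix_closed U 1 M"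
    using ex_suffix_closed[OF frag, of "{[]}"] by auto
  have "l \<in> M u" if "walk u l t" "t = 1" "u \<in> U \<union> {1}" for u l t
    using that
  proof (induction rule: walk.induct)
    case (walk_eps u u' l t)
    then have "u \<in> U" using final by auto
    then have "u' \<in> U \<or> u' = 1" "\<forall>l\<in>M u'. lab u @ l \<in> M u"
      using M(3) walk_eps unfolding suffix_closed_def by blast+
    then show ?case using walk_eps by (auto simp: lab_def)
  next
    case (walk_sym u l t)
    then have "u \<in> U" using final by auto
    then have "nx u \<in> U \<or> nx u = 1" "\<forall>l\<in>M (nx u). lab u @ l \<in> M u"
      using M(3) walk_sym unfolding suffix_closed_def by blast+
    then show ?case using walk_sym by (auto simp: lab_def)
  qed (use M in auto)
  then show "L \<subseteq> rexp_lang (vr \<alpha> 3 4)"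
    using M(2) by (auto simp: L_def vs_def lang_conc_def)
qed

lemma U_closed: "u \<in> insert 1 U \<Longrightarrow> u' = nx u \<or> u' = ny u \<Longrightarrow> u' \<noteq> 0 \<Longrightarrow> u' \<in> insert 1 U"
proof -
  assume u: "u \<in> insert 1 U" "u' = nx u \<or> u' = ny u" "u' \<noteq> 0"
  obtain M where M: "suffix_closed U 1 M"
    using ex_suffix_closed[OF frag, of "{[]}"] by auto
  show "u' \<in> insert 1 U"
    using u M final unfolding suffix_closed_def by (metis insertE insert_iff)
qed

lemma one_notin_U: "1 \<notin> U" "2 \<notin> U" "0 \<notin> U"
  by (auto simp: vs_def)

lemma U_facts:
  assumes "u \<in> U"
  shows "kd u \<le> 4" "nx u \<noteq> 0" "kd u \<noteq> 0 \<Longrightarrow> ny u = 0" "kd u = 3 \<Longrightarrow> lb u < \<sigma>"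
    "kd u \<noteq> 0 \<Longrightarrow> kd u \<noteq> 3 \<Longrightarrow> lb u \<in> vars \<alpha>"
  using frag_facts[OF frag assms] lits by auto

lemma coreach: "u \<in> insert 1 U \<Longrightarrow> \<exists>l. walk u l 1"
  using coreachable[OF frag, of u] walk_refl by auto

lemma map_sym_L: "map sym ` L = ref_language \<alpha>"
  using ref_rexp_vr[OF frag] rexp_lang_ref_rexp[of \<alpha>] by (simp add: L_eq rexp_lang_map)

lemma marked_L:
  "\<exists>h. inj_on h (set_rexp (vr \<alpha> 3 4)) \<and>
    marked_ref_language \<alpha> = map (\<lambda>u. (sym u, h u)) ` L"
proof -
  have "lin (vr \<alpha> 3 4)" by (rule lin_vr) simp
  from mark_map_rexp[OF this, of 1 sym] show ?thesis
    unfolding marked_ref_language_def ref_rexp_vr[OF frag] L_eq by (auto simp: rexp_lang_map)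
qed

lemma set_L: "l \<in> L \<Longrightarrow> set l \<subseteq> set_rexp (vr \<alpha> 3 4)"
  by (simp add: L_eq set_rexp_lang)

lemma set_L_U: "l \<in> L \<Longrightarrow> set l \<subseteq> U"
  using set_L set_vr by blast

lemma wb_L:
  assumes "r @ s \<in> L"
  shows "wb {} (map sym r)"
proof -
  have "map sym (r @ s) \<in> ref_language \<alpha>" using assms map_sym_L by blast
  then have "wb {} (map sym (r @ s) @ [])" using wb_ref_language[OF nonempty, of "{}"] by fastforce
  then show ?thesis by (simp add: wb_append)
qed

lemma language_L: "language \<alpha> = (\<lambda>l. fst (sem (map sym l))) ` L"
  by (simp add: language_sem[OF nonempty] image_image flip: map_sym_L)

end

locale det_graph = regex_graph +
  assumes det: "deterministic \<alpha>"
begin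

text \<open>The first three disjuncts of \<open>nondeterministic\<close>, contraposed and expressed
  by vertices: after a common prefix, the next symbol other than a bracket and the brackets before
  it are determined, up to a choice between different letters.\<close>

lemma deterministic_step:
  assumes L: "r @ g1 @ t1 # s1 \<in> L" "r @ g2 @ t2 # s2 \<in> L"
    and br: "\<forall>u\<in>set g1 \<union> set g2. br u" and t: "\<not> br t1" "\<not> br t2"
  shows "(t1 = t2 \<and> g1 = g2) \<or> (t1 \<noteq> t2 \<and> kd t1 = 3 \<and> kd t2 = 3 \<and> lb t1 \<noteq> lb t2)"
proof (rule ccontr)
  assume neg: "\<not> ?thesis"
  obtain h where h: "inj_on h (set_rexp (vr \<alpha> 3 4))"
    "marked_ref_language \<alpha> = map (\<lambda>u. (sym u, h u)) ` L" using marked_L by blast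
  define m where "m u = (sym u, h u)" for u
  have inj: "inj_on m (set_rexp (vr \<alpha> 3 4))"
    using h(1) by (auto simp: inj_on_def m_def)
  have sub: "set g1 \<subseteq> set_rexp (vr \<alpha> 3 4)" "set g2 \<subseteq> set_rexp (vr \<alpha> 3 4)"
    "t1 \<in> set_rexp (vr \<alpha> 3 4)" "t2 \<in> set_rexp (vr \<alpha> 3 4)"
    using set_L[OF L(1)] set_L[OF L(2)] by auto
  have M1: "map m r @ map m g1 @ [m t1] @ map m s1 \<in> marked_ref_language \<alpha>"
    and M2: "map m r @ map m g2 @ [m t2] @ map m s2 \<in> marked_ref_language \<alpha>"
    unfolding h(2) using imageI[OF L(1), of "map m"] imageI[OF L(2), of "map m"]
    by (auto simp: m_def[abs_def])
  have B: "\<forall>g\<in>set (map m g1) \<union> set (map m g2). is_bracket (fst g)"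
    "\<forall>g\<in>set (map m g2) \<union> set (map m g1). is_bracket (fst g)"
    using br by (auto simp: m_def is_bracket_sym)
  consider "t1 = t2" "g1 \<noteq> g2" | "t1 \<noteq> t2" "kd t1 \<noteq> 3" | "t1 \<noteq> t2" "kd t2 \<noteq> 3"
    | "t1 \<noteq> t2" "kd t1 = 3" "kd t2 = 3" "lb t1 = lb t2" using neg by blast
  then have "nondeterministic \<alpha>"
  proof cases
    case 1
    have "map m g1 \<noteq> map m g2" using 1 map_inj_on[of m g1 g2] inj sub inj_on_subset[OF inj] by auto
    moreover have "\<not> is_bracket (sym t1)" using t by (simp add: is_bracket_sym)
    moreover have "m t1 = (sym t1, h t1)" "m t2 = (sym t1, h t1)" using 1 by (auto simp: m_def)
    ultimately show ?thesis
      unfolding nondeterministic_def using M1 M2 B(1) by metis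
  next
    case 2
    then have "m t1 = (Var (lb t1), h t1)" using t by (auto simp: m_def sym_def)
    moreover have "m t2 = (sym t2, h t2)" by (simp add: m_def)
    moreover have "\<not> is_bracket (sym t2)" using t by (simp add: is_bracket_sym)
    moreover have "h t1 \<noteq> h t2" using 2 h(1) sub by (auto simp: inj_on_def)
    ultimately show ?thesis
      unfolding nondeterministic_def using M1 M2 B(1) by metis
  next
    case 3
    then have "m t2 = (Var (lb t2), h t2)" using t by (auto simp: m_def sym_def)
    moreover have "m t1 = (sym t1, h t1)" by (simp add: m_def)
    moreover have "\<not> is_bracket (sym t1)" using t by (simp add: is_bracket_sym)
    moreover have "h t2 \<noteq> h t1" using 3 h(1) sub by (auto simp: inj_on_def)
    ultimately show ?thesis
      unfolding nondeterministic_def using M1 M2 B(2) by metis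
  next
    case 4
    then have "m t1 = (Term (lb t1), h t1)" "m t2 = (Term (lb t1), h t2)"
      by (auto simp: m_def sym_def)
    moreover have "h t1 \<noteq> h t2" using 4 h(1) sub by (auto simp: inj_on_def)
    ultimately show ?thesis
      unfolding nondeterministic_def using M1 M2 B(1) by metis
  qed
  then show False using det by (simp add: deterministic_def)
qed

lemma split_first:
  assumes "\<exists>u\<in>set l. \<not> br u"
  obtains g a z where "l = g @ a # z" "\<forall>u\<in>set g. br u" "\<not> br a"
  using split_list_first_prop[OF assms] by auto

text \<open>Both lists are cut at their first symbol that is not a bracket, where
  \<open>deterministic_step\<close> applies; if the cuts agree, the argument is repeated behind
  them.\<close>

lemma comparable:
  assumes "r @ l1 @ t1 # s1 \<in> L" "r @ l2 @ t2 # s2 \<in> L"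
    and "\<forall>u\<in>set l1 \<union> set l2. kd u \<noteq> 3" "\<not> br t1" "\<not> br t2"
  shows "(\<exists>q. l2 @ [t2] = l1 @ [t1] @ q) \<or> (\<exists>q. l1 @ [t1] = l2 @ [t2] @ q) \<or>
    (kd t1 = 3 \<and> kd t2 = 3 \<and> lb t1 \<noteq> lb t2)"
  using assms
proof (induction "length l1" arbitrary: r l1 l2 rule: less_induct)
  case less
  obtain g1 a1 z1 where 1: "l1 @ [t1] = g1 @ a1 # z1" "\<forall>u\<in>set g1. br u" "\<not> br a1"
    using split_first[of "l1 @ [t1]"] less.prems by auto
  obtain g2 a2 z2 where 2: "l2 @ [t2] = g2 @ a2 # z2" "\<forall>u\<in>set g2. br u" "\<not> br a2"
    using split_first[of "l2 @ [t2]"] less.prems by auto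
  have "l1 @ t1 # s1 = g1 @ a1 # z1 @ s1" "l2 @ t2 # s2 = g2 @ a2 # z2 @ s2"
    using arg_cong[OF 1(1), of "\<lambda>x. x @ s1"] arg_cong[OF 2(1), of "\<lambda>x. x @ s2"] by simp_all
  note L = less.prems(1,2)[unfolded this]
  consider "a1 = a2" "g1 = g2" | "a1 \<noteq> a2" "kd a1 = 3" "kd a2 = 3" "lb a1 \<noteq> lb a2"
    using deterministic_step[OF L] 1 2 by blast
  then show ?case
  proof cases
    case same: 1
    consider "z1 = []" | "z2 = []" | z1' z2' where "z1 = z1' @ [t1]" "z2 = z2' @ [t2]"
      using 1(1) 2(1) by (metis append_butlast_last_id last.simps last_append last_snoc list.distinct(1))
    then show ?thesis
    proof cases
      case 1
      then show ?thesis using same \<open>l1 @ [t1] = g1 @ a1 # z1\<close> 2(1) by auto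
    next
      case 2
      then show ?thesis using same \<open>l2 @ [t2] = g2 @ a2 # z2\<close> 1(1) by auto
    next
      case 3
      then have l: "l1 = g1 @ a1 # z1'" "l2 = g1 @ a1 # z2'" using 1(1) 2(1) same by auto
      have "(\<exists>q. z2' @ [t2] = z1' @ [t1] @ q) \<or> (\<exists>q. z1' @ [t1] = z2' @ [t2] @ q) \<or>
        (kd t1 = 3 \<and> kd t2 = 3 \<and> lb t1 \<noteq> lb t2)"
        by (rule less.hyps[of z1' "r @ g1 @ [a1]" z2']) (use less.prems l in auto)
      then show ?thesis unfolding l by auto
    qed
  next
    case differ: 2
    \<comment> \<open>Different first symbols are terminals, and \<open>l1\<close>,
      \<open>l2\<close> contain none; so they are the last symbols \<open>t1\<close> and
      \<open>t2\<close>.\<close>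
    have "a1 \<in> set (l1 @ [t1])" "a2 \<in> set (l2 @ [t2])" unfolding 1(1) 2(1) by auto
    then have "a1 = t1" "a2 = t2" using less.prems(3) differ by auto
    then show ?thesis using differ by blast
  qed
qed

text \<open>Here \<open>s\<close> is a complete ending. It agrees with \<open>l @ [b]\<close> symbol
  by symbol as long as it has symbols other than brackets; it may run out of them early, and then
  some \<open>c\<close> on the other path comes after all of them.\<close>

lemma final_comparable:
  assumes "r @ s \<in> L" "r @ l @ b # s' \<in> L"
    and "\<forall>u\<in>set s \<union> set l. kd u \<noteq> 3" "\<not> br b" "kd b \<noteq> 3"
  shows "(\<exists>q. s = l @ b # q) \<or> (\<exists>l' c z. l @ [b] = l' @ c # z \<and> \<not> br c \<and> kd c \<noteq> 3 \<and>
    {u \<in> set s. \<not> br u} \<subseteq> set l')"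
  using assms
proof (induction "length s" arbitrary: r s l rule: less_induct)
  case less
  obtain g2 a2 z2 where 2: "l @ [b] = g2 @ a2 # z2" "\<forall>u\<in>set g2. br u" "\<not> br a2"
    using split_first[of "l @ [b]"] less.prems by auto
  have "a2 \<in> set (l @ [b])" unfolding 2(1) by simp
  then have a2: "kd a2 \<noteq> 3" using less.prems by auto
  show ?case
  proof (cases "\<exists>u\<in>set s. \<not> br u")
    case False
    then show ?thesis using 2 a2 by blast
  next
    case True
    then obtain g1 a1 z1 where 1: "s = g1 @ a1 # z1" "\<forall>u\<in>set g1. br u" "\<not> br a1"
      by (rule split_first)
    have "l @ b # s' = g2 @ a2 # z2 @ s'" using arg_cong[OF 2(1), of "\<lambda>x. x @ s'"] by simp
    note L = less.prems(1)[unfolded 1(1)] less.prems(2)[unfolded this]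
    have eq: "a1 = a2" "g1 = g2" using deterministic_step[OF L] 1 2 a2 by blast+
    show ?thesis
    proof (cases "z2 = []")
      case True
      then show ?thesis using 1(1) 2(1) eq by auto
    next
      case False
      then obtain z2' where z2': "z2 = z2' @ [b]" using 2(1)
        by (metis append_butlast_last_id last.simps last_append last_snoc list.distinct(1))
      then have l: "l = g1 @ a1 # z2'" using 2(1) eq by auto
      have "(\<exists>q. z1 = z2' @ b # q) \<or> (\<exists>l' c z. z2' @ [b] = l' @ c # z \<and> \<not> br c \<and> kd c \<noteq> 3 \<and>
          {u \<in> set z1. \<not> br u} \<subseteq> set l')"
        by (rule less.hyps[of z1 "r @ g1 @ [a1]" z2']) (use less.prems 1 l in auto)
      then show ?thesis
      proof (elim disjE exE conjE)
        fix q assume "z1 = z2' @ b # q"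
        then show ?thesis using 1(1) l by auto
      next
        fix l' c z assume "z2' @ [b] = l' @ c # z" "\<not> br c" "kd c \<noteq> 3" "{u \<in> set z1. \<not> br u} \<subseteq> set l'"
        moreover have "{u \<in> set s. \<not> br u} \<subseteq> set (g1 @ a1 # l')"
          using calculation(4) 1(1,2) by auto
        moreover have "l @ [b] = (g1 @ a1 # l') @ c # z" using calculation(1) l by simp
        ultimately show ?thesis by blast
      qed
    qed
  qed
qed

end

section \<open>Search trees\<close>

context graph
begin

definition cr :: "nat \<Rightarrow> nat \<Rightarrow> bool" where
  "cr u u' \<longleftrightarrow> kd u \<noteq> 3 \<and> (u' = nx u \<or> u' = ny u) \<and> u' \<noteq> 0"

text \<open>The vertices \<open>Q 0, \<dots>, Q (n - 1)\<close> are those that can be reached from the successor of \<open>v\<close> without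
  crossing a terminal symbol; \<open>P j\<close> is one plus the index of the parent of \<open>Q j\<close>. The last conjunct
  says that a variable is crossed only when nothing new can be reached without crossing it.\<close>

definition tree :: "nat \<Rightarrow> tab \<Rightarrow> tab \<Rightarrow> nat \<Rightarrow> bool" where
  "tree v Q P n \<longleftrightarrow> 0 < n \<and> Q 0 = nx v \<and> P 0 = 0 \<and> inj_on Q {..<n} \<and>
    (\<forall>j<n. 0 < j \<longrightarrow> 0 < P j \<and> P j \<le> j \<and> cr (Q (P j - 1)) (Q j)) \<and>
    (\<forall>j<n. \<forall>u'. cr (Q j) u' \<longrightarrow> u' \<in> Q ` {..<n}) \<and>
    (\<forall>j<n. 0 < j \<longrightarrow> 3 < kd (Q (P j - 1)) \<longrightarrow>
      (\<forall>i<j. \<forall>u'. kd (Q i) < 3 \<and> cr (Q i) u' \<longrightarrow> u' \<in> Q ` {..<j}) \<and>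
      (\<forall>i<P j - 1. \<forall>u'. 3 < kd (Q i) \<and> cr (Q i) u' \<longrightarrow> u' \<in> Q ` {..<j}))"

text \<open>Indices are shifted by one, with 0 for no vertex, so the path above the root is empty.
  The comparison ensures termination for arbitrary tables; in a search tree it holds by
  \<open>tree_P\<close>.\<close>

function tpath :: "tab \<Rightarrow> nat \<Rightarrow> nat list" where
  "tpath P t = (if t = 0 then [] else (if P (t - 1) < t then tpath P (P (t - 1)) else []) @ [t - 1])"
  by auto
termination by (relation "measure snd") auto

declare tpath.simps [simp del]

definition labs :: "tab \<Rightarrow> tab \<Rightarrow> nat \<Rightarrow> nat list" where
  "labs Q P t = filter (\<lambda>u. kd u \<noteq> 0) (map Q (tpath P t))"

definition evs :: "tab \<Rightarrow> tab \<Rightarrow> nat \<Rightarrow> nat list" where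
  "evs Q P t = filter (\<lambda>u. kd u \<noteq> 0 \<and> kd u \<noteq> 3) (map Q (tpath P t))"

lemma labs_0 [simp]: "labs Q P 0 = []"
  by (simp add: labs_def tpath.simps)

lemma labs_rec:
  assumes "P j \<le> j"
  shows "labs Q P (Suc j) = labs Q P (P j) @ lab (Q j)"
  using assms by (simp add: labs_def lab_def tpath.simps[of P "Suc j"])

text \<open>An entry of the table: the events on the way from \<open>v\<close> to the target for the letter \<open>a\<close>, or to the
  last variable if there is no target.\<close>

definition entry :: "nat \<Rightarrow> nat \<Rightarrow> nat list \<Rightarrow> nat \<Rightarrow> bool" where
  "entry v a e tt \<longleftrightarrow> (\<exists>Q P n t. tree v Q P n \<and> e = evs Q P t \<and> t \<le> n \<and>
    (if tt \<noteq> 0 then 0 < t \<and> tt = Q (t - 1) \<and> kd tt = 3 \<and> lb tt = a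
     else (\<forall>j<n. \<not> (kd (Q j) = 3 \<and> lb (Q j) = a)) \<and> (\<forall>j<n. 3 < kd (Q j) \<longrightarrow> j < t) \<and>
       (0 < t \<longrightarrow> 3 < kd (Q (t - 1)))))"

lemma tree_P: "tree v Q P n \<Longrightarrow> j < n \<Longrightarrow> P j \<le> j"
  unfolding tree_def by (cases "j = 0") auto

lemma tree_parent:
  assumes "tree v Q P n" "j < n" "0 < j"
  shows "0 < P j" "P j \<le> j" "cr (Q (P j - 1)) (Q j)"
  using assms unfolding tree_def by blast+

lemma tree_labs:
  assumes "tree v Q P n" "\<forall>j<n. kd (Q j) \<noteq> 0 \<longrightarrow> ny (Q j) = 0" "j < n"
  shows "walk (nx v) (labs Q P (P j)) (Q j) \<and>
    (\<forall>u\<in>set (labs Q P (P j)). kd u \<noteq> 3 \<and> kd u \<noteq> 0 \<and> u \<in> Q ` {..<j})"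
  using assms(3)
proof (induction j rule: less_induct)
  case (less j)
  show ?case
  proof (cases "j = 0")
    case True
    then show ?thesis using assms(1) by (auto simp: tree_def intro: walk_refl)
  next
    case False
    obtain i where i: "P j = Suc i" "i < j" "cr (Q i) (Q j)"
      using tree_parent[OF assms(1) less.prems] False by (metis One_nat_def Suc_diff_1 Suc_le_eq diff_Suc_1 neq0_conv)
    have IH: "walk (nx v) (labs Q P (P i)) (Q i)"
      "\<forall>u\<in>set (labs Q P (P i)). kd u \<noteq> 3 \<and> kd u \<noteq> 0 \<and> u \<in> Q ` {..<i}"
      using less.IH[OF i(2)] i(2) less.prems by auto
    have l: "labs Q P (P j) = labs Q P (P i) @ lab (Q i)"
      unfolding i(1) using labs_rec tree_P[OF assms(1)] i(2) less.prems by simp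
    have "walk (Q i) (lab (Q i)) (Q j)"
      using i(3) assms(2) i(2) less.prems
      using walk_nx[of "Q i"] by (cases "kd (Q i) = 0") (auto simp: cr_def lab_def intro: walk.intros)
    from walk_trans[OF IH(1) this] show ?thesis
      using IH(2) i(2,3) by (auto simp: l lab_def cr_def less_imp_le)
  qed
qed

lemma tree_reach:
  assumes T: "tree v Q P n" and "walk u l m" "u \<in> Q ` {..<n}" "\<forall>x\<in>set l. kd x \<noteq> 3"
  shows "m \<in> Q ` {..<n}"
  using assms(2-4)
proof (induction rule: walk.induct)
  case (walk_eps u u' l t)
  then have "cr u u'" by (auto simp: cr_def)
  then have "u' \<in> Q ` {..<n}" using T walk_eps.prems(1) unfolding tree_def by blast
  then show ?case using walk_eps by blast
next
  case (walk_sym u l t)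
  then have "cr u (nx u)" by (auto simp: cr_def)
  then have "nx u \<in> Q ` {..<n}" using T walk_sym.prems(1) unfolding tree_def by blast
  then show ?case using walk_sym by auto
qed

lemma labs_subset: "tree v Q P n \<Longrightarrow> t \<le> n \<Longrightarrow> set (labs Q P t) \<subseteq> Q ` {..<t}"
proof (induction t rule: less_induct)
  case (less t)
  show ?case
  proof (cases t)
    case (Suc j)
    then have Pj: "P j \<le> j" using tree_P[OF less.prems(1)] less.prems by simp
    then have "set (labs Q P (P j)) \<subseteq> Q ` {..<P j}" using less Suc by simp
    also have "\<dots> \<subseteq> Q ` {..<t}" using Pj Suc by auto
    finally show ?thesis using labs_rec[where P = P, OF Pj] Suc by (auto simp: lab_def)
  qed simp
qed

text \<open>Locates a symbol of a path in the order of the search. Unless it is the end of the path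
  it is the parent of another vertex \<open>m\<close> on it, to which the last conjunct of
  \<open>tree\<close> can be applied.\<close>

lemma labs_split:
  assumes T: "tree v Q P n" and "t \<le> n" "labs Q P t = x @ c # y"
  shows "\<exists>j<t. Q j = c \<and> (\<forall>u\<in>set x. u \<in> Q ` {..<j}) \<and>
    (j = t - 1 \<or> (\<exists>m<t. 0 < m \<and> P m = Suc j))"
  using assms(2,3)
proof (induction t arbitrary: y rule: less_induct)
  case (less t)
  show ?case
  proof (cases t)
    case 0
    then show ?thesis using less.prems by simp
  next
    case (Suc j)
    then have Pj: "P j \<le> j" using tree_P[OF T] less.prems by simp
    have l: "labs Q P t = labs Q P (P j) @ lab (Q j)"
      unfolding Suc by (rule labs_rec[where P = P, OF Pj])
    show ?thesis
    proof (cases "\<exists>y'. labs Q P (P j) = x @ c # y'")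
      case True
      then obtain y' where y': "labs Q P (P j) = x @ c # y'" by blast
      then have "P j \<noteq> 0" by (auto intro: ccontr)
      moreover obtain i where i: "i < P j" "Q i = c" "\<forall>u\<in>set x. u \<in> Q ` {..<i}"
        "i = P j - 1 \<or> (\<exists>m<P j. 0 < m \<and> P m = Suc i)"
        using less.IH[OF _ _ y'] Pj Suc less.prems by auto
      ultimately have "i = P j - 1 \<Longrightarrow> P j = Suc i \<and> 0 < j" using Pj by auto
      then have "\<exists>m<t. 0 < m \<and> P m = Suc i"
        using i(4) Pj Suc by (metis le_imp_less_Suc less_le_trans lessI less_imp_le_nat)
      then show ?thesis using i Pj Suc by (intro exI[of _ i]) auto
    next
      case False
      have "lab (Q j) = [c] \<and> x = labs Q P (P j)"
        using False less.prems(2) unfolding l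
        by (auto simp: lab_def append_eq_append_conv2 append_eq_Cons_conv Cons_eq_append_conv split: if_splits)
      then have "Q j = c" "set x \<subseteq> Q ` {..<P j}"
        using labs_subset[OF T, of "P j"] Pj Suc less.prems by (auto simp: lab_def split: if_splits)
      then show ?thesis using Suc Pj by (intro exI[of _ j]) fastforce
    qed
  qed
qed

end

section \<open>One step of the matching algorithm\<close>

context graph
begin

fun vstep :: "nat \<Rightarrow> nat \<Rightarrow> tab \<times> tab \<Rightarrow> tab \<times> tab" where
  "vstep i u (S, E) = (if kd u = 2 then S else S(lb u := i), E(lb u := i))"

definition blocked :: "nat \<Rightarrow> tab \<times> tab \<Rightarrow> bool" where
  "blocked u M \<longleftrightarrow> 2 < kd u \<and> fst M (lb u) \<noteq> snd M (lb u)"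

text \<open>The result 0, which is not a vertex, means that no event is blocked.\<close>

fun run :: "nat \<Rightarrow> nat list \<Rightarrow> tab \<times> tab \<Rightarrow> nat \<times> tab \<times> tab" where
  "run i [] M = (0, M)"
| "run i (u # e) M = (if blocked u M then (u, M) else run i e (vstep i u M))"

lemma run_append: "0 \<notin> set e1 \<Longrightarrow>
    run i (e1 @ e2) M = (if fst (run i e1 M) \<noteq> 0 then run i e1 M else run i e2 (snd (run i e1 M)))"
  by (induction e1 arbitrary: M) auto

lemma run_blocked_split:
  assumes "run i e M = (b, M')" "b \<noteq> 0" "0 \<notin> set e"
  shows "\<exists>e1 e2. e = e1 @ b # e2 \<and> run i e1 M = (0, M') \<and> blocked b M'"
  using assms
proof (induction e arbitrary: M)
  case (Cons u e)
  show ?case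
  proof (cases "blocked u M")
    case True
    then show ?thesis using Cons.prems by (intro exI[of _ "[]"] exI[of _ e]) auto
  next
    case False
    then obtain e1 e2 where "e = e1 @ b # e2" "run i e1 (vstep i u M) = (0, M')" "blocked b M'"
      using Cons.IH[of "vstep i u M"] Cons.prems by auto
    then show ?thesis using False by (intro exI[of _ "u # e1"] exI[of _ e2]) auto
  qed
qed simp

abbreviation wsem :: "nat list \<Rightarrow> nat list \<times> tab \<times> tab" where
  "wsem r \<equiv> sem (map sym r)"

lemma sem_append: "sem (p @ q) = fold sstep q (sem p)"
  by (simp add: sem_def)

lemma run_sem:
  assumes "run (length x) e M = (0, M')" "0 \<notin> set e" "\<forall>u\<in>set e. kd u \<noteq> 3 \<and> kd u \<noteq> 0" "wsem r = (x, M)"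
  shows "wsem (r @ e) = (x, M')"
  using assms
proof (induction e arbitrary: M r)
  case (Cons u e)
  obtain S E where M: "M = (S, E)" by (cases M)
  have nb: "\<not> blocked u M" using Cons.prems by (auto split: if_splits)
  have "wsem (r @ [u]) = (x, vstep (length x) u M)"
    using Cons.prems(3,4) nb by (auto simp: sem_append M sym_def[of u] blocked_def)
  then have "wsem ((r @ [u]) @ e) = (x, M')" using Cons nb by (intro Cons.IH) auto
  then show ?case by simp
qed simp

text \<open>Exactly the terminals and the nonempty variables produce output; a list without output
  is processed by \<open>run\<close> to its end, any other is cut at its first productive
  symbol.\<close>

lemma split_consuming:
  assumes "0 \<notin> set s"
  shows "((\<forall>u\<in>set s. kd u \<noteq> 3) \<and> (\<exists>M'. run i s M = (0, M'))) \<or>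
    (\<exists>l t s' M'. s = l @ t # s' \<and> (\<forall>u\<in>set l. kd u \<noteq> 3) \<and> run i l M = (0, M') \<and>
      (kd t = 3 \<or> (2 < kd t \<and> kd t \<noteq> 3 \<and> blocked t M')))"
  using assms
proof (induction s arbitrary: M)
  case (Cons u s)
  show ?case
  proof (cases "kd u = 3 \<or> blocked u M")
    case True
    then show ?thesis
      by (intro disjI2 exI[of _ "[]"] exI[of _ u] exI[of _ s] exI[of _ M]) (auto simp: blocked_def)
  next
    case False
    from Cons.IH[of "vstep i u M"] Cons.prems consider
      "\<forall>x\<in>set s. kd x \<noteq> 3" "\<exists>M'. run i s (vstep i u M) = (0, M')"
      | l t s' M' where "s = l @ t # s'" "\<forall>x\<in>set l. kd x \<noteq> 3" "run i l (vstep i u M) = (0, M')"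
        "kd t = 3 \<or> (2 < kd t \<and> kd t \<noteq> 3 \<and> blocked t M')" by auto
    then show ?thesis
    proof cases
      case 1
      then show ?thesis using False by auto
    next
      case 2
      then show ?thesis
        using False by (intro disjI2 exI[of _ "u # l"] exI[of _ t] exI[of _ s'] exI[of _ M']) auto
    qed
  qed
qed simp

text \<open>Crossing an empty variable moves both its ends to the position \<open>i\<close>, and
  every later event of the same run writes \<open>i\<close> again.\<close>

lemma run_crossed:
  assumes "run i e M = (0, M')" "0 \<notin> set e" "b \<in> set e" "2 < kd b"
  shows "\<not> blocked b M'"
proof -
  have keep: "fst M' x = snd M' x"
    if "run i e M = (0, M')" "0 \<notin> set e" "fst M x = i" "snd M x = i" for e M x
    using that
    by (induction e arbitrary: M) (auto split: if_splits)
  show ?thesis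
    using assms
  proof (induction e arbitrary: M)
    case (Cons u e)
    then have nb: "\<not> blocked u M" "run i e (vstep i u M) = (0, M')" by (auto split: if_splits)
    show ?case
    proof (cases "u = b")
      case True
      have "fst (vstep i u M) (lb b) = i" "snd (vstep i u M) (lb b) = i"
        using True Cons.prems(4) by (cases M; simp)+
      then show ?thesis using keep[OF nb(2)] Cons.prems by (auto simp: blocked_def)
    next
      case False
      then show ?thesis using Cons nb by auto
    qed
  qed simp
qed

text \<open>It suffices to process each event the first time, where an opening bracket or a variable makes
  all later events of this variable superfluous.\<close>

fun dd :: "tab \<Rightarrow> nat list \<Rightarrow> nat list" where
  "dd mk [] = []"
| "dd mk (u # e) =
    (if kd u = 2 then (if mk (lb u) < 1 then u # dd (mk(lb u := 1)) e else dd mk e)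
     else (if mk (lb u) < 2 then u # dd (mk(lb u := 2)) e else dd mk e))"

text \<open>Mark 1 records that the end of the variable already is \<open>i\<close>, mark 2 that the
  start is too. An event that is dropped would rewrite these values only, and with mark 2 it cannot
  be blocked.\<close>

lemma run_dd:
  assumes "\<forall>x. mk x \<le> 2 \<and> (1 \<le> mk x \<longrightarrow> snd M x = i) \<and> (mk x = 2 \<longrightarrow> fst M x = i)"
  shows "run i (dd mk e) M = run i e M"
  using assms
proof (induction e arbitrary: mk M)
  case (Cons u e)
  obtain S E where M: "M = (S, E)" by (cases M)
  have skip: "run i (dd mk e) M = run i (u # e) M" if "mk (lb u) = 2 \<or> kd u = 2 \<and> mk (lb u) = 1"
  proof -
    have "\<not> blocked u M" "vstep i u M = M"
      using that Cons.prems by (auto simp: M blocked_def)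
    then show ?thesis using Cons by simp
  qed
  have IH: "run i (dd (mk(lb u := d)) e) (vstep i u M) = run i e (vstep i u M)"
    if "d = (if kd u = 2 then 1 else 2)" "mk (lb u) < d" for d
    using Cons.prems that by (intro Cons.IH) (auto simp: M)
  have "mk (lb u) \<le> 2" using Cons.prems by blast
  then show ?case
    using skip IH[of "if kd u = 2 then 1 else 2"] by (cases "mk (lb u)") auto
qed simp

text \<open>The sum of the marks is a potential: each event kept raises it, and no mark exceeds
  2.\<close>

lemma length_dd:
  assumes "finite X" "\<forall>u\<in>set e. lb u \<in> X" "\<forall>x. mk x \<le> 2"
  shows "length (dd mk e) + (\<Sum>x\<in>X. mk x) \<le> 2 * card X"
  using assms(2,3)
proof (induction e arbitrary: mk)
  case Nil
  have "(\<Sum>x\<in>X. mk x) \<le> (\<Sum>x\<in>X. 2)" using Nil by (intro sum_mono) auto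
  then show ?case by simp
next
  case (Cons u e)
  have u: "lb u \<in> X" using Cons.prems by simp
  have "length (u # dd (mk(lb u := d)) e) + (\<Sum>x\<in>X. mk x) \<le> 2 * card X"
    if "mk (lb u) < d" "d \<le> 2" for d
  proof -
    have "(\<Sum>x\<in>X. mk x) < (\<Sum>x\<in>X. (mk(lb u := d)) x)"
      using that u assms(1) by (intro sum_strict_mono_ex1) auto
    moreover have "length (dd (mk(lb u := d)) e) + (\<Sum>x\<in>X. (mk(lb u := d)) x) \<le> 2 * card X"
      using Cons.prems that by (intro Cons.IH) auto
    ultimately show ?thesis by simp
  qed
  moreover have "length (dd mk e) + (\<Sum>x\<in>X. mk x) \<le> 2 * card X"
    using Cons by auto
  ultimately show ?case by simp
qed

end

section \<open>Configurations and forced continuations\<close>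

context det_graph
begin

text \<open>The last conjunct is the heart of the invariant: committing to the prefix
  \<open>r\<close> neither gains nor loses acceptance of \<open>w\<close>. The vertex
  \<open>v\<close> is the last one of \<open>r\<close>, or the start vertex 2.\<close>

definition conf :: "nat list \<Rightarrow> nat list \<Rightarrow> nat \<Rightarrow> nat \<Rightarrow> tab \<times> tab \<Rightarrow> bool" where
  "conf w r v i M \<longleftrightarrow> walk 3 r (nx v) \<and> (r = [] \<and> v = 2 \<or> (\<exists>r0. r = r0 @ [v])) \<and> v \<in> insert 2 U \<and> i \<le> length w \<and> wsem r = (take i w, M) \<and>
    (w \<in> language \<alpha> \<longleftrightarrow> (\<exists>s. r @ s \<in> L \<and> fst (wsem (r @ s)) = w))"

lemma conf_start: "conf w [] 2 0 (\<lambda>_. 0, \<lambda>_. 0)"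
  by (auto simp: conf_def start language_L sem_def intro: walk_refl)

lemma nx_in_U: "v \<in> insert 2 U \<Longrightarrow> nx v \<in> insert 1 U"
  using U_closed[of v] U_facts(2)[of v] start by (auto simp: vs_def)

lemma walk_L: "walk 3 r m \<Longrightarrow> walk m s 1 \<Longrightarrow> r @ s \<in> L"
  unfolding L_def using walk_trans by blast

lemma zero_notin: "r @ s \<in> L \<Longrightarrow> 0 \<notin> set s"
  using set_L_U one_notin_U by fastforce

lemma kd_ne_0: "l \<in> L \<Longrightarrow> u \<in> set l \<Longrightarrow> kd u \<noteq> 0 \<and> kd u \<le> 4"
  using walk_kd set_L_U U_facts(1) unfolding L_def by blast

lemma wsem_prefix: "\<exists>z. fst (wsem (r @ s)) = fst (wsem r) @ z"
proof (induction s rule: rev_induct)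
  case (snoc u s)
  then obtain z where z: "fst (wsem (r @ s)) = fst (wsem r) @ z" by blast
  obtain x S E where "wsem (r @ s) = (x, S, E)" by (metis prod_cases3)
  then have "\<exists>z'. fst (wsem (r @ s @ [u])) = fst (wsem (r @ s)) @ z'"
    by (cases "sym u") (auto simp: sem_append)
  then show ?case using z by auto
qed simp

text \<open>An accepting continuation must still produce the letter at position \<open>i\<close>, so
  it contains a productive symbol; if the first one is a terminal, it carries that letter.\<close>

lemma consuming:
  assumes c: "conf w r v i M" and s: "r @ s \<in> L" "fst (wsem (r @ s)) = w" and i: "i < length w"
  shows "\<exists>l t s' M'. s = l @ t # s' \<and> (\<forall>u\<in>set l. kd u \<noteq> 3) \<and> run i l M = (0, M') \<and>
    \<not> br t \<and> (if kd t = 3 then lb t = w ! i else blocked t M')"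
proof -
  have len: "length (take i w) = i" using i by simp
  have wr: "wsem r = (take i w, M)" using c by (simp add: conf_def)
  have "0 \<notin> set s" using zero_notin[OF s(1)] .
  then consider (silent) M' where "\<forall>u\<in>set s. kd u \<noteq> 3" "run i s M = (0, M')"
    | (cons) l t s' M' where "s = l @ t # s'" "\<forall>u\<in>set l. kd u \<noteq> 3" "run i l M = (0, M')"
      "kd t = 3 \<or> (2 < kd t \<and> kd t \<noteq> 3 \<and> blocked t M')"
    using split_consuming[of s i M] by blast
  then show ?thesis
  proof cases
    case silent
    have "wsem (r @ s) = (take i w, M')"
      using run_sem[of "take i w" s M M' r] silent wr \<open>0 \<notin> set s\<close> len kd_ne_0[OF s(1)] by auto
    then have "take i w = w" using s(2) by simp
    then show ?thesis using i len by simp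
  next
    case cons
    have "0 \<notin> set l" using \<open>0 \<notin> set s\<close> cons(1) by simp
    then have wl: "wsem (r @ l) = (take i w, M')"
      using run_sem[of "take i w" l M M' r] cons wr len kd_ne_0[OF s(1)] by auto
    have "lb t = w ! i" if "kd t = 3"
    proof -
      have "fst (wsem ((r @ l) @ [t])) = take i w @ [lb t]"
        using wl that by (cases M') (simp add: sem_append sym_def[of t])
      moreover obtain z where "fst (wsem (((r @ l) @ [t]) @ s')) = fst (wsem ((r @ l) @ [t])) @ z"
        using wsem_prefix by blast
      ultimately have "w = take i w @ lb t # z" using s(2) cons(1) by simp
      then have "w ! i = (take i w @ lb t # z) ! i" by metis
      then show ?thesis using i by (simp add: nth_append)
    qed
    then show ?thesis
      using cons by (intro exI[of _ l] exI[of _ t] exI[of _ s'] exI[of _ M']) auto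
  qed
qed

text \<open>The last premise has the form in which \<open>consuming\<close> delivers its symbol. A
  terminal in \<open>e\<close> contradicts the third premise; a blocked variable would have stopped
  the run.\<close>

lemma run_no_inner_block:
  assumes "run i e M = (0, M1)" "0 \<notin> set e" "\<forall>u\<in>set e. kd u \<noteq> 3"
    and "e = l @ t # q" "run i l M = (0, M')" "if kd t = 3 then X else blocked t M'"
  shows False
proof -
  have "run i e M = run i (t # q) M'" using assms(2,4,5) run_append[of l i "t # q" M] by simp
  then show False using assms by (auto split: if_splits)
qed

text \<open>By \<open>comparable\<close>, the path to \<open>b\<close> and the path to the first
  productive symbol of \<open>s\<close> extend one another. Neither can be the longer one, since it
  would then contain a productive symbol in its unblocked part.\<close>

lemma conf_blocked_unique:
  assumes c: "conf w r v i M" and s: "r @ s \<in> L" "fst (wsem (r @ s)) = w" and i: "i < length w"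
    and e: "r @ e1 @ b # y \<in> L" "\<forall>u\<in>set e1. kd u \<noteq> 3" "run i e1 M = (0, M1)"
    and b: "kd b \<noteq> 3" "blocked b M1"
  shows "\<exists>s'. s = e1 @ b # s'"
proof -
  obtain l t s' M' where l: "s = l @ t # s'" "\<forall>u\<in>set l. kd u \<noteq> 3" "run i l M = (0, M')"
    "\<not> br t" "if kd t = 3 then lb t = w ! i else blocked t M'" using consuming[OF c s i] by blast
  have z: "0 \<notin> set e1" "0 \<notin> set l" using zero_notin[OF e(1)] zero_notin[OF s(1)] l(1) by auto
  have "\<not> br b" using b by (auto simp: blocked_def)
  then consider q where "e1 @ [b] = l @ [t] @ q" | q where "l @ [t] = e1 @ [b] @ q"
    using comparable[of r l t s' e1 b y] s(1) l e b(1) by blast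
  then show ?thesis
  proof cases
    case 1
    show ?thesis
    proof (cases q rule: rev_cases)
      case Nil
      then show ?thesis using 1 l(1) by simp
    next
      case (snoc q' b')
      then have "e1 = l @ t # q'" using 1 by simp
      then show ?thesis using run_no_inner_block[OF e(3) z(1) e(2) _ l(3,5)] by blast
    qed
  next
    case 2
    show ?thesis
    proof (cases q rule: rev_cases)
      case Nil
      then show ?thesis using 2 l(1) by simp
    next
      case (snoc q' t')
      then have "l = e1 @ b # q'" using 2 by simp
      then show ?thesis
        using run_no_inner_block[OF l(3) z(2) l(2) _ e(3), of b q' True] b by auto
    qed
  qed
qed

text \<open>As for a blocked variable; moreover, both paths may end at terminals, but these carry
  the same letter of \<open>w\<close>, which excludes the last alternative of
  \<open>comparable\<close>.\<close>

lemma conf_target_unique: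
  assumes c: "conf w r v i M" and s: "r @ s \<in> L" "fst (wsem (r @ s)) = w" and i: "i < length w"
    and e: "r @ e @ t # y \<in> L" "\<forall>u\<in>set e. kd u \<noteq> 3" "run i e M = (0, M1)"
    and t: "kd t = 3" "lb t = w ! i"
  shows "\<exists>s'. s = e @ t # s'"
proof -
  obtain l t' s' M' where l: "s = l @ t' # s'" "\<forall>u\<in>set l. kd u \<noteq> 3" "run i l M = (0, M')"
    "\<not> br t'" "if kd t' = 3 then lb t' = w ! i else blocked t' M'" using consuming[OF c s i] by blast
  have z: "0 \<notin> set e" using zero_notin[OF e(1)] by auto
  consider q where "e @ [t] = l @ [t'] @ q" | q where "l @ [t'] = e @ [t] @ q"
    using comparable[of r l t' s' e t y] s(1) l e t by (auto split: if_splits)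
  then show ?thesis
  proof cases
    case 1
    show ?thesis
    proof (cases q rule: rev_cases)
      case Nil
      then show ?thesis using 1 l(1) by simp
    next
      case (snoc q' b')
      then have "e = l @ t' # q'" using 1 by simp
      then show ?thesis using run_no_inner_block[OF e(3) z e(2) _ l(3,5)] by blast
    qed
  next
    case 2
    show ?thesis
    proof (cases q rule: rev_cases)
      case Nil
      then show ?thesis using 2 l(1) by simp
    next
      case (snoc q' u)
      then have "l = e @ t # q'" using 2 by simp
      then show ?thesis using l(2) t(1) by auto
    qed
  qed
qed

lemma tree_root: "tree v Q P n \<Longrightarrow> Q 0 = nx v \<and> 0 < n \<and> nx v \<in> Q ` {..<n}"
  unfolding tree_def by (metis imageI lessThan_iff)

lemma tree_in_U:
  assumes T: "tree v Q P n" and v: "v \<in> insert 2 U" and "j < n"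
  shows "Q j \<in> insert 1 U"
  using assms(3)
proof (induction j rule: less_induct)
  case (less j)
  show ?case
  proof (cases "j = 0")
    case True
    then show ?thesis using T nx_in_U[OF v] by (simp add: tree_def)
  next
    case False
    then have "P j - 1 < j" "cr (Q (P j - 1)) (Q j)" using tree_parent[OF T less.prems] by auto
    then show ?thesis using less U_closed[of "Q (P j - 1)" "Q j"] by (auto simp: cr_def)
  qed
qed

lemma tree_ny: "tree v Q P n \<Longrightarrow> v \<in> insert 2 U \<Longrightarrow> \<forall>j<n. kd (Q j) \<noteq> 0 \<longrightarrow> ny (Q j) = 0"
  using tree_in_U[of v Q P n] U_facts(3) final(4) by (metis insertE)

lemma evs_Suc:
  assumes T: "tree v Q P n" and v: "v \<in> insert 2 U" and "j < n"
  shows "evs Q P (Suc j) = labs Q P (P j) @ (if kd (Q j) = 0 \<or> kd (Q j) = 3 then [] else [Q j])"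
proof -
  have "evs Q P (Suc j) = filter (\<lambda>u. kd u \<noteq> 3) (labs Q P (Suc j))"
    by (simp add: evs_def labs_def conj_commute)
  also have "labs Q P (Suc j) = labs Q P (P j) @ lab (Q j)"
    using labs_rec[where P = P, OF tree_P[OF T assms(3)]] .
  also have "filter (\<lambda>u. kd u \<noteq> 3) \<dots> = labs Q P (P j) @ filter (\<lambda>u. kd u \<noteq> 3) (lab (Q j))"
    using tree_labs[OF T tree_ny[OF T v] assms(3)] by (simp add: filter_id_conv)
  finally show ?thesis by (auto simp: lab_def)
qed

text \<open>The path of an entry starts behind the current vertex, and from its end the exit can be
  reached. The events are therefore part of a ref-word and subject to determinism.\<close>

lemma entry_continues:
  assumes c: "conf w r v i M" and en: "entry v a e tt"
  shows "\<exists>y. r @ e @ y \<in> L" "\<forall>u\<in>set e. kd u \<noteq> 3" "tt \<noteq> 0 \<Longrightarrow> walk 3 (r @ e) tt \<and> tt \<in> insert 1 U"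
proof -
  have v: "v \<in> insert 2 U" and r: "walk 3 r (nx v)" using c by (auto simp: conf_def)
  obtain Q P n t where T: "tree v Q P n" and e: "e = evs Q P t" and t: "t \<le> n"
    "tt \<noteq> 0 \<Longrightarrow> 0 < t \<and> tt = Q (t - 1) \<and> kd tt = 3"
    "tt = 0 \<Longrightarrow> 0 < t \<Longrightarrow> 3 < kd (Q (t - 1))"
    using en unfolding entry_def by (auto split: if_splits)
  show "\<forall>u\<in>set e. kd u \<noteq> 3" using e by (auto simp: evs_def)
  have *: "(\<exists>y. r @ e @ y \<in> L) \<and> (tt \<noteq> 0 \<longrightarrow> walk 3 (r @ e) tt \<and> tt \<in> insert 1 U)"
  proof (cases t)
    case 0
    then show ?thesis
      using coreach[OF nx_in_U[OF v]] walk_L[OF r] e t by (auto simp: evs_def tpath.simps)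
  next
    case (Suc j)
    then have j: "j < n" using t by simp
    have e': "e = labs Q P (P j) @ (if kd (Q j) = 3 then [] else [Q j])"
      using evs_Suc[OF T v j] e Suc t by (cases "tt = 0") auto
    have w: "walk 3 (r @ labs Q P (P j)) (Q j)"
      using walk_trans[OF r] tree_labs[OF T tree_ny[OF T v] j] by blast
    have U: "Q j \<in> insert 1 U" by (rule tree_in_U[OF T v j])
    show ?thesis
    proof (cases "kd (Q j) = 3")
      case True
      obtain y where "walk (Q j) y 1" using coreach[OF U] by blast
      from walk_L[OF w this] have "\<exists>y. r @ e @ y \<in> L" using e' True by auto
      moreover have "walk 3 (r @ e) (Q j)" using w e' True by simp
      ultimately show ?thesis using U t Suc by auto
    next
      case False
      then have "tt = 0" "3 < kd (Q j)" using t Suc by auto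
      then have QU: "Q j \<in> U" using U final by auto
      then have "walk (Q j) [Q j] (nx (Q j))"
        using \<open>3 < kd (Q j)\<close> U_facts(2) by (auto intro: walk.intros)
      from walk_trans[OF w this] have "walk 3 (r @ e) (nx (Q j))" using e' False by simp
      moreover obtain y where "walk (nx (Q j)) y 1" using coreach[OF nx_in_U, of "Q j"] QU by blast
      ultimately show ?thesis using walk_L[of "r @ e" "nx (Q j)" y] \<open>tt = 0\<close> by auto
    qed
  qed
  show "\<exists>y. r @ e @ y \<in> L" "tt \<noteq> 0 \<Longrightarrow> walk 3 (r @ e) tt \<and> tt \<in> insert 1 U" using * by blast+
qed

lemma L_walk: "p @ b # y \<in> L \<Longrightarrow> walk 3 p b \<and> walk 3 (p @ [b]) (nx b) \<and> walk (nx b) y 1"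
proof -
  assume L: "p @ b # y \<in> L"
  then obtain m where m: "walk 3 p m" "walk m (b # y) 1" using walk_split unfolding L_def by blast
  have b: "kd b \<noteq> 0" "walk m [] b" "walk (nx b) y 1" using walk_ConsD[OF m(2)] by auto
  have "b \<in> U" using set_L_U[OF L] by auto
  then have "walk b [b] (nx b)" using b(1) U_facts(2) by (auto intro: walk.intros)
  moreover have "walk 3 p b" using walk_trans[OF m(1) b(2)] by simp
  ultimately show ?thesis using b(3) walk_trans by blast
qed

lemma conf_walk:
  assumes "conf w r v i M" "r @ s \<in> L"
  shows "walk (nx v) s 1"
proof (cases "r = []")
  case True
  then show ?thesis using assms start by (auto simp: conf_def L_def)
next
  case False
  then obtain r0 where "r = r0 @ [v]" using assms by (auto simp: conf_def)
  then show ?thesis using L_walk[of r0 v s] assms(2) by simp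
qed

lemma conf_extend:
  assumes c: "conf w r v i M" and L: "r @ e1 @ b # y \<in> L"
    and sem: "wsem (r @ e1 @ [b]) = (take j w, M')" "j \<le> length w"
    and u: "\<And>s. r @ s \<in> L \<Longrightarrow> fst (wsem (r @ s)) = w \<Longrightarrow> \<exists>s'. s = e1 @ b # s'"
  shows "conf w (r @ e1 @ [b]) b j M'"
proof -
  have "(\<exists>s. r @ s \<in> L \<and> fst (wsem (r @ s)) = w) \<longleftrightarrow>
      (\<exists>s. (r @ e1 @ [b]) @ s \<in> L \<and> fst (wsem ((r @ e1 @ [b]) @ s)) = w)"
  proof
    assume "\<exists>s. r @ s \<in> L \<and> fst (wsem (r @ s)) = w"
    then obtain s where s: "r @ s \<in> L" "fst (wsem (r @ s)) = w" by blast
    then obtain s' where "s = e1 @ b # s'" using u by blast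
    then show "\<exists>s. (r @ e1 @ [b]) @ s \<in> L \<and> fst (wsem ((r @ e1 @ [b]) @ s)) = w"
      using s by (intro exI[of _ s']) simp
  next
    assume "\<exists>s. (r @ e1 @ [b]) @ s \<in> L \<and> fst (wsem ((r @ e1 @ [b]) @ s)) = w"
    then show "\<exists>s. r @ s \<in> L \<and> fst (wsem (r @ s)) = w" by (metis append_assoc)
  qed
  moreover have "walk 3 (r @ e1 @ [b]) (nx b)" using L_walk[of "r @ e1" b y] L by simp
  moreover have "b \<in> U" using set_L_U[OF L] by auto
  ultimately show ?thesis using c sem unfolding conf_def by (auto simp del: append.simps)
qed

lemma entry_run:
  assumes c: "conf w r v i M" and en: "entry v a e tt" and run: "run i (dd (\<lambda>_. 0) e) M = (b, M')"
  obtains y where "r @ e @ y \<in> L" "\<forall>u\<in>set e. kd u \<noteq> 3 \<and> kd u \<noteq> 0" "0 \<notin> set e" "run i e M = (b, M')"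
proof -
  obtain y where y: "r @ e @ y \<in> L" using entry_continues[OF c en] by blast
  moreover have "\<forall>u\<in>set e. kd u \<noteq> 3 \<and> kd u \<noteq> 0"
    using entry_continues(2)[OF c en] kd_ne_0[OF y] by auto
  moreover have "0 \<notin> set e" using zero_notin[OF y] by simp
  moreover have "run i e M = (b, M')" using run run_dd[of "\<lambda>_. 0" M i e] by simp
  ultimately show ?thesis using that by blast
qed

theorem step_blocked:
  assumes c: "conf w r v i M" and i: "i < length w" and en: "entry v a e tt"
    and run: "run i (dd (\<lambda>_. 0) e) M = (b, M')" and b: "b \<noteq> 0"
    and d: "s = fst M' (lb b)" "d = snd M' (lb b) - s"
  shows "b \<in> U" "4 = kd b" "s < snd M' (lb b)" "snd M' (lb b) \<le> i"
    "if take d (drop i w) = take d (drop s w) then \<exists>r'. conf w r' b (i + d) M' else w \<notin> language \<alpha>"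
proof -
  obtain y where y: "r @ e @ y \<in> L" and k: "\<forall>u\<in>set e. kd u \<noteq> 3 \<and> kd u \<noteq> 0" and z: "0 \<notin> set e"
    and run': "run i e M = (b, M')" by (rule entry_run[OF c en run])
  obtain e1 e2 where e: "e = e1 @ b # e2" "run i e1 M = (0, M')" "blocked b M'"
    using run_blocked_split[OF run' b z] by blast
  have L: "r @ e1 @ b # e2 @ y \<in> L" using y e(1) by simp
  show bU: "b \<in> U" using set_L_U[OF L] by auto
  show kb: "4 = kd b" using e(3) k U_facts(1)[OF bU] e(1) by (auto simp: blocked_def)
  have wr: "wsem r = (take i w, M)" and len: "length (take i w) = i"
    using c i by (auto simp: conf_def)
  have w1: "wsem (r @ e1) = (take i w, M')"
    using run_sem[of "take i w" e1 M M' r] e wr len z k by auto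
  have "wb {} (map sym (r @ e1))" using wb_L[of "r @ e1" "b # e2 @ y"] L by simp
  then have le: "s \<le> snd M' (lb b)" "snd M' (lb b) \<le> i"
    using sem_le[of "map sym (r @ e1)" "take i w" "fst M'" "snd M'"] w1 len d(1) by auto
  moreover have "s \<noteq> snd M' (lb b)" using e(3) d(1) by (auto simp: blocked_def)
  ultimately show lt: "s < snd M' (lb b)" "snd M' (lb b) \<le> i" by auto
  define val where "val = take d (drop s w)"
  \<comment> \<open>The value ends at or before position \<open>i\<close>, so it can be read off the
    input word instead of the output.\<close>
  have val: "val = take d (drop s (take i w))" "length val = d" "s + d \<le> i"
    using lt i d by (auto simp: val_def drop_take min_def)
  have w2: "wsem (r @ e1 @ [b]) = (take i w @ val, M')"
    using w1 e(3) kb d val(1) by (cases M') (auto simp: sem_append sym_def[of b] blocked_def)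
  have u: "\<exists>s'. s = e1 @ b # s'" if "r @ s \<in> L" "fst (wsem (r @ s)) = w" for s
    using conf_blocked_unique[OF c that i L _ e(2) _ e(3)] k e(1) kb by auto
  show "if take d (drop i w) = take d (drop s w) then \<exists>r'. conf w r' b (i + d) M' else w \<notin> language \<alpha>"
  proof (cases "take d (drop i w) = val")
    case True
    then have "take i w @ val = take (i + d) w" by (simp add: take_add)
    \<comment> \<open>If the word ended too early, the factor at \<open>i\<close> would be shorter
      than the value and could not equal it.\<close>
    moreover have "i + d \<le> length w"
      using arg_cong[OF True, of length] val(2) lt(1) d(2) by auto
    ultimately show ?thesis
      using conf_extend[OF c L, of "i + d" M'] u w2 True by (auto simp: val_def)
  next
    case False
    have "w \<notin> language \<alpha>"
    proof
      assume "w \<in> language \<alpha>"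
      then obtain s where s: "r @ s \<in> L" "fst (wsem (r @ s)) = w" using c by (auto simp: conf_def)
      then obtain s' where "s = e1 @ b # s'" using u by blast
      then have "w = fst (wsem ((r @ e1 @ [b]) @ s'))" using s by simp
      then obtain x where "w = (take i w @ val) @ x"
        using wsem_prefix[of "r @ e1 @ [b]" s'] w2 by auto
      then have "drop i w = val @ x" using len by (metis append_assoc append_eq_conv_conj)
      then show False using False val(2) by simp
    qed
    then show ?thesis using False by (simp add: val_def)
  qed
qed

theorem step_target:
  assumes c: "conf w r v i M" and i: "i < length w" and w: "set w \<subseteq> {..<\<sigma>}"
    and en: "entry v (w ! i) e tt"
    and run: "run i (dd (\<lambda>_. 0) e) M = (0, M')" and tt: "tt \<noteq> 0"
  shows "tt \<in> U" "kd tt = 3" "\<exists>r'. conf w r' tt (i + 1) M'"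
proof -
  obtain y where y: "r @ e @ y \<in> L" and k: "\<forall>u\<in>set e. kd u \<noteq> 3 \<and> kd u \<noteq> 0" and z: "0 \<notin> set e"
    and run': "run i e M = (0, M')" by (rule entry_run[OF c en run])
  have t: "kd tt = 3" "lb tt = w ! i" using en tt by (auto simp: entry_def)
  have wk: "walk 3 (r @ e) tt" "tt \<in> insert 1 U" using entry_continues(3)[OF c en tt] by auto
  have "w ! i < \<sigma>" using w nth_mem[OF i] by auto
  then show ttU: "tt \<in> U" using wk(2) t final by auto
  show "kd tt = 3" by fact
  obtain y' where "walk (nx tt) y' 1" using coreach[OF nx_in_U, of tt] ttU by blast
  moreover have "walk tt [tt] (nx tt)" using t U_facts(2)[OF ttU] by (auto intro: walk.intros)
  ultimately have L: "r @ e @ tt # y' \<in> L"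
    using walk_L[OF wk(1), of "[tt] @ y'"] walk_trans by fastforce
  have wr: "wsem r = (take i w, M)" and len: "length (take i w) = i"
    using c i by (auto simp: conf_def)
  have "wsem (r @ e) = (take i w, M')"
    using run_sem[of "take i w" e M M' r] run' wr len z k by auto
  then have "wsem (r @ e @ [tt]) = (take (i + 1) w, M')"
    using t i by (cases M') (simp add: sem_append sym_def[of tt] take_Suc_conv_app_nth)
  then have "conf w (r @ e @ [tt]) tt (i + 1) M'"
    using conf_target_unique[OF c _ _ i L _ run' t] k i by (intro conf_extend[OF c L]) auto
  then show "\<exists>r'. conf w r' tt (i + 1) M'" by blast
qed

text \<open>Without a target, an accepting continuation would have to consume through a nonempty
  variable. All variables that can be reached lie on the path to the one found last, and that path
  turned out to be unblocked.\<close>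

theorem step_none:
  assumes c: "conf w r v i M" and i: "i < length w"
    and en: "entry v (w ! i) e 0" and run: "run i (dd (\<lambda>_. 0) e) M = (0, M')"
  shows "w \<notin> language \<alpha>"
proof
  assume "w \<in> language \<alpha>"
  then obtain s where s: "r @ s \<in> L" "fst (wsem (r @ s)) = w" using c by (auto simp: conf_def)
  obtain y where y: "r @ e @ y \<in> L" and k: "\<forall>u\<in>set e. kd u \<noteq> 3 \<and> kd u \<noteq> 0" and z: "0 \<notin> set e"
    and run': "run i e M = (0, M')" by (rule entry_run[OF c en run])
  have v: "v \<in> insert 2 U" and r: "walk 3 r (nx v)" using c by (auto simp: conf_def)
  obtain l t s' M2 where l: "s = l @ t # s'" "\<forall>u\<in>set l. kd u \<noteq> 3" "run i l M = (0, M2)"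
    "\<not> br t" "if kd t = 3 then lb t = w ! i else blocked t M2" using consuming[OF c s i] by blast
  have zl: "0 \<notin> set l" using zero_notin[OF s(1)] l(1) by auto
  obtain m where m: "walk (nx v) l m" "walk m (t # s') 1"
    using conf_walk[OF c s(1)] walk_split l(1) by blast
  then have wt: "walk (nx v) l t" using walk_ConsD[OF m(2)] walk_trans[OF m(1), of "[]" t] by simp
  obtain Q P n t0 where T: "tree v Q P n" and e: "e = evs Q P t0" and t0: "t0 \<le> n"
    "\<forall>j<n. \<not> (kd (Q j) = 3 \<and> lb (Q j) = w ! i)" "\<forall>j<n. 3 < kd (Q j) \<longrightarrow> j < t0"
    "0 < t0 \<Longrightarrow> 3 < kd (Q (t0 - 1))"
    using en unfolding entry_def by auto
  have "nx v \<in> Q ` {..<n}" using tree_root[OF T] by auto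
  then have "t \<in> Q ` {..<n}" using tree_reach[OF T wt _ l(2)] by blast
  then obtain j where j: "j < n" "t = Q j" by auto
  have kt: "kd t \<noteq> 3" using l(5) t0(2) j by auto
  then have bt: "blocked t M2" "3 < kd t" using l(4,5) by (auto simp: blocked_def)
  then have "j < t0" using t0(3) j by auto
  then obtain j0 where j0: "t0 = Suc j0" "j \<le> j0" "j0 < n" using t0(1) by (cases t0) auto
  define u0 p where "u0 = Q j0" and "p = labs Q P (P j0)"
  have u0: "3 < kd u0" using t0(4) j0 by (simp add: u0_def)
  then have ep: "e = p @ [u0]" using evs_Suc[OF T v j0(3)] e j0(1) by (simp add: p_def u0_def)
  define q where "q = labs Q P (P j)"
  have q: "walk (nx v) q t" "\<forall>u\<in>set q. kd u \<noteq> 3 \<and> u \<in> Q ` {..<j}"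
    using tree_labs[OF T tree_ny[OF T v] j(1)] j(2) by (auto simp: q_def)
  have Lq: "r @ q @ t # s' \<in> L"
  proof -
    have "walk t (t # s') 1"
      using L_walk[of "r @ l" t s'] s(1) l(1) set_L_U[OF s(1)] U_facts(2)[of t] bt(2)
      by (auto intro: walk.intros)
    then show ?thesis using walk_L[OF walk_trans[OF r q(1)]] by simp
  qed
  have Lp: "r @ p @ u0 # y \<in> L" using y ep by simp
  have kp: "\<forall>u\<in>set p. kd u \<noteq> 3" using k ep by simp
  \<comment> \<open>The tree paths to \<open>t\<close> and to \<open>u0\<close> extend one another.
    The former cannot be longer, since it would contain \<open>u0\<close>, which was found no
    earlier than \<open>t\<close>.\<close>
  have "t \<in> set e"
  proof -
    have "\<not> br u0" using u0 by auto
    then have "(\<exists>x. q @ [t] = p @ [u0] @ x) \<or> (\<exists>x. p @ [u0] = q @ [t] @ x) \<or> kd t = 3"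
      using comparable[OF Lp Lq] kp q(2) l(4) by blast
    then show ?thesis
    proof (elim disjE exE)
      fix x assume x: "q @ [t] = p @ [u0] @ x"
      show ?thesis
      proof (cases x rule: rev_cases)
        case Nil
        then show ?thesis using x ep by simp
      next
        case (snoc x' t')
        then have "u0 \<in> set q" using x by auto
        then obtain i' where "i' < j" "u0 = Q i'" using q(2) by auto
        then have "i' = j0" using T j0 unfolding tree_def inj_on_def u0_def by auto
        then show ?thesis using \<open>i' < j\<close> j0 by simp
      qed
    next
      fix x assume "p @ [u0] = q @ [t] @ x"
      then show ?thesis using ep by simp
    qed (use kt in simp)
  qed
  \<comment> \<open>If the actual path \<open>l\<close> to \<open>t\<close> is part of
    \<open>e\<close>, the run of \<open>e\<close> would have been blocked at \<open>t\<close>; if it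
    extends \<open>e\<close>, then \<open>t\<close> has been crossed before and its variable is
    empty.\<close>
  consider x where "e = l @ t # x" | x where "l @ [t] = e @ x"
    using comparable[of r p u0 y l t s'] Lp s(1) l ep kp u0 kt by (auto simp: ep)
  then show False
  proof cases
    case 1
    then show ?thesis
      using run_no_inner_block[OF run' z _ 1 l(3), of True] k bt(1) kt by auto
  next
    case 2
    show ?thesis
    proof (cases x rule: rev_cases)
      case Nil
      then have "e = l @ t # []" using 2 by simp
      then show ?thesis
        using run_no_inner_block[OF run' z _ _ l(3), of t "[]" True] k bt(1) kt by auto
    next
      case (snoc x' t')
      then have "t \<in> set l" using 2 \<open>t \<in> set e\<close> by auto
      then show ?thesis using run_crossed[OF l(3) zl] bt by auto
    qed
  qed
qed

text \<open>A terminal or nonempty variable strictly lengthens the output, which is already all of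
  \<open>w\<close>, and output never shrinks.\<close>

lemma silent_rest:
  assumes c: "conf w r v (length w) M" and s: "r @ s \<in> L" "fst (wsem (r @ s)) = w"
  shows "(\<forall>u\<in>set s. kd u \<noteq> 3) \<and> (\<exists>M'. run (length w) s M = (0, M'))"
proof (rule ccontr)
  assume neg: "\<not> ?thesis"
  have z: "0 \<notin> set s" using zero_notin[OF s(1)] .
  from split_consuming[OF z, of "length w" M] neg obtain l t s' M' where l: "s = l @ t # s'"
    "\<forall>u\<in>set l. kd u \<noteq> 3" "run (length w) l M = (0, M')" "kd t = 3 \<or> (2 < kd t \<and> kd t \<noteq> 3 \<and> blocked t M')"
    by blast
  have wr: "wsem r = (w, M)" using c by (simp add: conf_def)
  have wl: "wsem (r @ l) = (w, M')"
    using run_sem[of w l M M' r] l wr z kd_ne_0[OF s(1)] by auto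
  have "wb {} (map sym (r @ l))" using wb_L[of "r @ l" "t # s'"] s(1) l(1) by simp
  then have le: "fst M' x \<le> snd M' x \<and> snd M' x \<le> length w" for x
    using sem_le[of "map sym (r @ l)" w "fst M'" "snd M'"] wl by auto
  have "length (fst (wsem ((r @ l) @ [t]))) > length w"
  proof (cases "kd t = 3")
    case True
    then show ?thesis using wl by (cases M') (simp add: sem_append sym_def[of t])
  next
    case False
    then have "fst M' (lb t) < snd M' (lb t)" "2 < kd t"
      using l(4) le[of "lb t"] by (auto simp: blocked_def)
    then show ?thesis using wl le[of "lb t"] False by (cases M') (auto simp: sem_append sym_def[of t])
  qed
  moreover obtain x where "fst (wsem (((r @ l) @ [t]) @ s')) = fst (wsem ((r @ l) @ [t])) @ x"
    using wsem_prefix by blast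
  ultimately show False using s(2) l(1) by (metis append.assoc append_Cons append_Nil length_append not_add_less1)
qed

text \<open>The delicate direction: if \<open>w\<close> is accepted, the path of the table to the
  exit is not blocked. Were it blocked at \<open>b\<close>, the accepting ending would avoid some
  variable \<open>c'\<close> on that path, and the search would have found the exit before it
  crossed \<open>c'\<close>.\<close>

theorem step_final:
  assumes c: "conf w r v (length w) M" and en: "entry v \<sigma> e tt"
    and run: "run (length w) (dd (\<lambda>_. 0) e) M = (b, M')"
  shows "w \<in> language \<alpha> \<longleftrightarrow> b = 0 \<and> tt \<noteq> 0"
proof -
  let ?i = "length w"
  obtain y where y: "r @ e @ y \<in> L" and k: "\<forall>u\<in>set e. kd u \<noteq> 3 \<and> kd u \<noteq> 0" and z: "0 \<notin> set e"
    and run': "run ?i e M = (b, M')" by (rule entry_run[OF c en run])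
  have v: "v \<in> insert 2 U" and wr: "wsem r = (w, M)" using c by (auto simp: conf_def)
  obtain Q P n t where T: "tree v Q P n" and e: "e = evs Q P t" and t: "t \<le> n"
    "tt \<noteq> 0 \<Longrightarrow> 0 < t \<and> tt = Q (t - 1) \<and> kd tt = 3 \<and> lb tt = \<sigma>"
    "tt = 0 \<Longrightarrow> \<forall>j<n. \<not> (kd (Q j) = 3 \<and> lb (Q j) = \<sigma>)"
    using en unfolding entry_def by (auto split: if_splits)
  \<comment> \<open>Terminals of the regex carry letters below \<sigma>, so only the exit is a
    target for \<sigma>.\<close>
  have tt1: "tt = 1" if "tt \<noteq> 0"
    using entry_continues(3)[OF c en that] t(2)[OF that] U_facts(4)[of tt] by auto
  show ?thesis
  proof
    assume *: "b = 0 \<and> tt \<noteq> 0"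
    then have "walk 3 (r @ e) 1" using entry_continues(3)[OF c en] tt1 by auto
    then have "r @ e \<in> L" by (simp add: L_def)
    moreover have "wsem (r @ e) = (w, M')" using run_sem[of w e M M' r] run' * wr z k by auto
    ultimately show "w \<in> language \<alpha>" using c unfolding conf_def by (metis fst_conv)
  next
    assume "w \<in> language \<alpha>"
    then obtain s where s: "r @ s \<in> L" "fst (wsem (r @ s)) = w" using c by (auto simp: conf_def)
    obtain M2 where s3: "\<forall>u\<in>set s. kd u \<noteq> 3" and rs: "run ?i s M = (0, M2)"
      using silent_rest[OF c s] by blast
    have ws: "walk (nx v) s 1" by (rule conf_walk[OF c s(1)])
    have Q0: "nx v \<in> Q ` {..<n}" using tree_root[OF T] by auto
    then have "1 \<in> Q ` {..<n}" using tree_reach[OF T ws _ s3] by blast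
    then obtain f0 where f0: "f0 < n" "Q f0 = 1" by (metis imageE lessThan_iff)
    then have "kd (Q f0) = 3 \<and> lb (Q f0) = \<sigma>" using final by simp
    then have tt0: "tt \<noteq> 0" using t(3) f0(1) by blast
    then obtain f where f: "t = Suc f" "Q f = 1" "f < n"
      using t tt1 by (cases t) auto
    have b0: "b = 0"
    proof (rule ccontr)
      assume b: "b \<noteq> 0"
      obtain e1 e2 where e12: "e = e1 @ b # e2" "run ?i e1 M = (0, M')" "blocked b M'"
        using run_blocked_split[OF run' b z] by blast
      have Lb: "r @ e1 @ b # e2 @ y \<in> L" using y e12(1) by simp
      have kb: "\<not> br b" "kd b \<noteq> 3" using e12 k by (auto simp: blocked_def)
      from final_comparable[OF s(1) Lb _ kb] s3 k e12(1) consider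
        q where "s = e1 @ b # q"
        | l' c' x where "e1 @ [b] = l' @ c' # x" "\<not> br c'" "kd c' \<noteq> 3" "{u \<in> set s. \<not> br u} \<subseteq> set l'"
        by fastforce
      then show False
      proof cases
        case 1
        then show ?thesis
          using run_no_inner_block[OF rs zero_notin[OF s(1)] s3 1 e12(2), of True] e12(3) kb by auto
      next
        case 2
        have "evs Q P t = labs Q P (P f)" using evs_Suc[OF T v f(3)] f(1,2) final by simp
        then have lab: "labs Q P (P f) = l' @ c' # (x @ e2)"
          using e e12(1) arg_cong[OF 2(1), of "\<lambda>z. z @ e2"] by simp
        have Pf: "P f \<le> f" using tree_P[OF T f(3)] .
        \<comment> \<open>\<open>j\<close> is the place of \<open>c'\<close> in the queue, and
          \<open>m\<close> below is the child of \<open>c'\<close> on the path to the exit; at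
          \<open>m\<close> the order of the search is exploited.\<close>
        obtain j where j: "j < P f" "Q j = c'" "\<forall>u\<in>set l'. u \<in> Q ` {..<j}"
          "j = P f - 1 \<or> (\<exists>m<P f. 0 < m \<and> P m = Suc j)"
          using labs_split[OF T _ lab] Pf f(3) by auto
        obtain m where m: "m \<le> f" "0 < m" "P m = Suc j"
        proof (cases "j = P f - 1")
          case True
          then show ?thesis using that[of f] j(1) Pf by simp
        next
          case False
          then obtain m' where "m' < P f" "0 < m'" "P m' = Suc j" using j(4) by blast
          then show ?thesis using that[of m'] Pf by simp
        qed
        have "c' \<in> set (e1 @ [b])" unfolding 2(1) by simp
        then have "c' \<in> set e" using e12(1) by auto
        then have "3 < kd (Q (P m - 1))" using k 2(2,3) j(2) m(3) by fastforce
        then have cl: "\<And>i u'. i < m \<Longrightarrow> kd (Q i) < 3 \<Longrightarrow> cr (Q i) u' \<Longrightarrow> u' \<in> Q ` {..<m}"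
          "\<And>i u'. i < j \<Longrightarrow> 3 < kd (Q i) \<Longrightarrow> cr (Q i) u' \<Longrightarrow> u' \<in> Q ` {..<m}"
        proof -
          have "\<forall>j<n. 0 < j \<longrightarrow> 3 < kd (Q (P j - 1)) \<longrightarrow>
            (\<forall>i<j. \<forall>u'. kd (Q i) < 3 \<and> cr (Q i) u' \<longrightarrow> u' \<in> Q ` {..<j}) \<and>
            (\<forall>i<P j - 1. \<forall>u'. 3 < kd (Q i) \<and> cr (Q i) u' \<longrightarrow> u' \<in> Q ` {..<j})"
            using T unfolding tree_def by (elim conjE)
          moreover have "m < n" using m(1) f(3) by simp
          ultimately have "(\<forall>i<m. \<forall>u'. kd (Q i) < 3 \<and> cr (Q i) u' \<longrightarrow> u' \<in> Q ` {..<m}) \<and>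
            (\<forall>i<P m - 1. \<forall>u'. 3 < kd (Q i) \<and> cr (Q i) u' \<longrightarrow> u' \<in> Q ` {..<m})"
            using m(2) \<open>3 < kd (Q (P m - 1))\<close> by blast
          then show "\<And>i u'. i < m \<Longrightarrow> kd (Q i) < 3 \<Longrightarrow> cr (Q i) u' \<Longrightarrow> u' \<in> Q ` {..<m}"
            "\<And>i u'. i < j \<Longrightarrow> 3 < kd (Q i) \<Longrightarrow> cr (Q i) u' \<Longrightarrow> u' \<in> Q ` {..<m}"
            using m(3) by simp_all
        qed
        \<comment> \<open>Following \<open>s\<close> one never leaves the first \<open>m\<close>
          vertices: brackets and unlabelled vertices are closed there, and so are the variables
          found before \<open>c'\<close>, which are the only ones on \<open>s\<close>. But the exit
          has an index of at least \<open>m\<close>.\<close>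
        have "1 \<in> Q ` {..<m}"
          if "walk u s' one" "one = 1" "u \<in> Q ` {..<m}" "\<forall>x\<in>set s'. kd x \<noteq> 3 \<and> (\<not> br x \<longrightarrow> x \<in> Q ` {..<j})"
          for u s' one
          using that
        proof (induction rule: walk.induct)
          case (walk_eps u u' l t)
          then have "cr u u'" "kd u < 3" by (auto simp: cr_def)
          then have "u' \<in> Q ` {..<m}" using cl(1) walk_eps.prems(2) by auto
          then show ?case using walk_eps by blast
        next
          case (walk_sym u l t)
          then have cru: "cr u (nx u)" by (auto simp: cr_def)
          have "nx u \<in> Q ` {..<m}"
          proof (cases "br u")
            case True
            then have "kd u < 3" by auto
            then show ?thesis using cl(1) cru walk_sym.prems(2) by auto
          next
            case False
            then have "u \<in> Q ` {..<j}" "3 < kd u" using walk_sym by auto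
            then show ?thesis using cl(2) cru by auto
          qed
          then show ?case using walk_sym by auto
        qed auto
        moreover have "nx v \<in> Q ` {..<m}"
          using tree_root[OF T] imageI[of 0 "{..<m}" Q] m(2) by simp
        moreover have "\<forall>x\<in>set s. kd x \<noteq> 3 \<and> (\<not> br x \<longrightarrow> x \<in> Q ` {..<j})"
          using s3 2(4) j(3) by blast
        ultimately have "1 \<in> Q ` {..<m}" using ws by blast
        then obtain i' where "i' < m" "Q i' = 1" by auto
        then have "i' = f" using T m(1) f unfolding tree_def inj_on_def by auto
        then show False using \<open>i' < m\<close> m(1) by simp
      qed
    qed
    show "b = 0 \<and> tt \<noteq> 0" using b0 tt0 by simp
  qed
qed

end

section \<open>Building the graph\<close>

text \<open>Numbers are allotted by phase: parsing writes up to 13, the tables are computed in 14 to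
  37, and those from 38 on are introduced for matching. Frame conditions become comparisons of
  numbers. The alphabet size lies above all of them.\<close>

abbreviation (input) "xSig \<equiv> (63::nat)"
abbreviation (input) "xSp \<equiv> (2::nat)"
abbreviation (input) "xFr \<equiv> (3::nat)"
abbreviation (input) "xTok \<equiv> (4::nat)"
abbreviation (input) "xV \<equiv> (5::nat)"
abbreviation (input) "xK \<equiv> (6::nat)"
abbreviation (input) "aSV \<equiv> (7::nat)"
abbreviation (input) "aSK \<equiv> (8::nat)"
abbreviation (input) "aKd \<equiv> (9::nat)"
abbreviation (input) "aLb \<equiv> (10::nat)"
abbreviation (input) "aNx \<equiv> (11::nat)"
abbreviation (input) "aNy \<equiv> (12::nat)"
abbreviation (input) "xLab \<equiv> (13::nat)"

definition push :: "aexp \<Rightarrow> aexp \<Rightarrow> com" where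
  "push d e = Upd aSV (V xSp) d ;; Upd aSK (V xSp) e ;; Asg xSp (Pl (V xSp) (N 1))"

definition vertex :: "aexp \<Rightarrow> nat \<Rightarrow> aexp \<Rightarrow> aexp \<Rightarrow> com" where
  "vertex v kd d e = Upd aKd v (N kd) ;; Upd aNx v d ;; Upd aNy v e"

text \<open>The stack holds the pairs of vertices between which the regexes still to be read are laid out.\<close>

definition parse_body :: com where
  "parse_body =
    Asg xSp (Mi (V xSp) (N 1)) ;; Asg xV (Ar aSV (V xSp)) ;; Asg xK (Ar aSK (V xSp)) ;; Inp xTok ;;
    Ite (Mi (V xTok) (N 1))
    (Ite (Mi (V xTok) (N 2))
    (Ite (Mi (V xTok) (N 3))
    (Ite (Mi (V xTok) (N 4))
    (Ite (Mi (V xTok) (N 5))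
    (Ite (Mi (V xTok) (N 6))
      (Inp xLab ;; vertex (V xV) 1 (V xFr) (N 0) ;; Upd aLb (V xV) (V xLab) ;;
       vertex (Pl (V xFr) (N 1)) 2 (V xK) (N 0) ;; Upd aLb (Pl (V xFr) (N 1)) (V xLab) ;;
       push (V xFr) (Pl (V xFr) (N 1)) ;; Asg xFr (Pl (V xFr) (N 2)))
      (vertex (V xFr) 0 (V xV) (V xK) ;; push (V xV) (V xFr) ;; Asg xFr (Pl (V xFr) (N 1))))
      (vertex (V xV) 0 (V xFr) (Pl (V xFr) (N 1)) ;; push (Pl (V xFr) (N 1)) (V xK) ;;
       push (V xFr) (V xK) ;; Asg xFr (Pl (V xFr) (N 2))))
      (push (V xFr) (V xK) ;; push (V xV) (V xFr) ;; Asg xFr (Pl (V xFr) (N 1))))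
      (Inp xLab ;; vertex (V xV) 4 (V xK) (N 0) ;; Upd aLb (V xV) (V xLab)))
      (Inp xLab ;; vertex (V xV) 3 (V xK) (N 0) ;; Upd aLb (V xV) (V xLab)))
      (vertex (V xV) 0 (V xK) (N 0))"

definition parse_loop :: com where "parse_loop = While (V xSp) parse_body"

lemma parse_loop_step:
  "s xSp 0 \<noteq> 0 \<Longrightarrow> wp parse_body (wp parse_loop Q) s is (b - 1) \<Longrightarrow> wp parse_loop Q s is b"
  unfolding parse_loop_def by (rule wp_While_step) auto

lemmas parse_simps = parse_body_def vertex_def push_def

abbreviation frag_in :: "store \<Rightarrow> (nat, nat) regex \<Rightarrow> nat \<Rightarrow> nat \<Rightarrow> nat \<Rightarrow> bool" where
  "frag_in s \<equiv> frag (s aKd) (s aLb) (s aNx) (s aNy)"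

lemma frag_cong:
  assumes "\<forall>u\<in>vs \<alpha> v f. kd' u = kd u \<and> lb' u = lb u \<and> nx' u = nx u \<and> ny' u = ny u"
    and "frag kd lb nx ny \<alpha> v k f"
  shows "frag kd' lb' nx' ny' \<alpha> v k f"
  using assms by (induction \<alpha> arbitrary: v k f) (auto simp: vs_def)

text \<open>The token read last is nonzero, by which the recognizer later tells these regexes from
  \<open>Empty\<close>.\<close>

definition parsed :: "store \<Rightarrow> store \<Rightarrow> (nat, nat) regex \<Rightarrow> nat \<Rightarrow> nat \<Rightarrow> nat \<Rightarrow> nat \<Rightarrow> bool" where
  "parsed s s' \<alpha> v k f q \<longleftrightarrow> s' xSp 0 = q \<and> s' xFr 0 = f + fr \<alpha> \<and> s' xTok 0 \<noteq> 0 \<and> frag_in s' \<alpha> v k f \<and>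
    (\<forall>i<q. s' aSV i = s aSV i \<and> s' aSK i = s aSK i) \<and>
    (\<forall>u. u \<notin> vs \<alpha> v f \<longrightarrow>
      s' aKd u = s aKd u \<and> s' aLb u = s aLb u \<and> s' aNx u = s aNx u \<and> s' aNy u = s aNy u) \<and>
    (\<forall>j. 13 < j \<longrightarrow> s' j = s j)"

text \<open>Instead of an invariant for the whole stack, the loop is unfolded along the regex: the
  premise is the same loop, entered again after \<alpha> has been laid out and its stack entry
  consumed. For two operands the induction hypotheses are chained. The factor 40 generously covers
  one iteration.\<close>

lemma wp_parse_loop:
  assumes "is_nonempty_regex \<alpha>" "s xSp 0 = Suc q" "s aSV q = v" "s aSK q = k" "s xFr 0 = f"
    and "v < f" "k < f"
    and "\<And>s' b'. parsed s s' \<alpha> v k f q \<Longrightarrow> b - 40 * int (regex_length \<alpha>) \<le> b' \<Longrightarrow>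
      wp parse_loop Q s' is b'"
  shows "wp parse_loop Q s (encode_regex \<alpha> @ is) b"
  using assms
proof (induction \<alpha> arbitrary: s v k f q "is" b)
  case Empty
  then show ?case by simp
next
  case Eps
  show ?case
    apply (rule parse_loop_step)
     apply (simp add: Eps.prems(2))
    apply (simp add: parse_simps Eps.prems(2-5))
    apply (rule Eps.prems(8))
    using Eps.prems(2-7) by (auto simp: parsed_def vs_def)
next
  case (Lit a)
  show ?case
    apply (rule parse_loop_step)
     apply (simp add: Lit.prems(2))
    apply (simp add: parse_simps Lit.prems(2-5))
    apply (rule Lit.prems(8))
    using Lit.prems(2-7) by (auto simp: parsed_def vs_def)
next
  case (Ref x)
  show ?case
    apply (rule parse_loop_step)
     apply (simp add: Ref.prems(2))
    apply (simp add: parse_simps Ref.prems(2-5))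
    apply (rule Ref.prems(8))
    using Ref.prems(2-7) by (auto simp: parsed_def vs_def)
next
  case (Cat \<alpha> \<beta>)
  show ?case
    apply (rule parse_loop_step)
     apply (simp add: Cat.prems(2))
    apply (simp add: parse_simps Cat.prems(2-5))
    apply (rule Cat.IH(1)[where q = "Suc q" and v = v and k = f and f = "f + 1"])
    using Cat.prems(1-7) apply simp_all[7]
    subgoal for s1 b1
      apply (rule Cat.IH(2)[where q = q and v = f and k = k and f = "f + 1 + fr \<alpha>"])
      using Cat.prems(1-7) apply (simp_all add: parsed_def)[7]
      subgoal premises p for s2 b2
      proof (rule Cat.prems(8))
        have dis: "u \<notin> vs \<beta> f (f + 1 + fr \<alpha>)" if "u \<in> vs \<alpha> v (f + 1)" for u
          using that Cat.prems(6,7) by (auto simp: vs_def)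
        have un: "u \<notin> vs \<alpha> v (f + 1)" "u \<notin> vs \<beta> f (f + 1 + fr \<alpha>)" if "u \<notin> vs (Cat \<alpha> \<beta>) v f" for u
          using that by (auto simp: vs_def)
        have "frag_in s2 \<alpha> v f (f + 1)"
          by (rule frag_cong[where kd = "s1 aKd" and lb = "s1 aLb" and nx = "s1 aNx" and ny = "s1 aNy"])
            (use p dis in \<open>auto simp: parsed_def\<close>)
        then show "parsed s s2 (Cat \<alpha> \<beta>) v k f q"
          using p un by (auto simp: parsed_def)
      qed (use p in simp)
      done
    done
next
  case (Alt \<alpha> \<beta>)
  show ?case
    apply (rule parse_loop_step)
     apply (simp add: Alt.prems(2))
    apply (simp add: parse_simps Alt.prems(2-5))
    apply (rule Alt.IH(1)[where q = "Suc q" and v = f and k = k and f = "f + 2"])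
    using Alt.prems(1-7) apply simp_all[7]
    subgoal for s1 b1
      apply (rule Alt.IH(2)[where q = q and v = "f + 1" and k = k and f = "f + 2 + fr \<alpha>"])
      using Alt.prems(1-7) apply (simp_all add: parsed_def)[7]
      subgoal premises p for s2 b2
      proof (rule Alt.prems(8))
        have dis: "u \<notin> vs \<beta> (f + 1) (f + 2 + fr \<alpha>)" if "u \<in> vs \<alpha> f (f + 2)" for u
          using that Alt.prems(6,7) by (auto simp: vs_def)
        have v: "v \<notin> vs \<alpha> f (f + 2)" "v \<notin> vs \<beta> (f + 1) (f + 2 + fr \<alpha>)"
          using Alt.prems(6,7) by (auto simp: vs_def)
        have un: "u \<notin> vs \<alpha> f (f + 2)" "u \<notin> vs \<beta> (f + 1) (f + 2 + fr \<alpha>)" "u \<noteq> v"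
          if "u \<notin> vs (Alt \<alpha> \<beta>) v f" for u
          using that by (auto simp: vs_def)
        have "frag_in s2 \<alpha> f k (f + 2)"
          by (rule frag_cong[where kd = "s1 aKd" and lb = "s1 aLb" and nx = "s1 aNx" and ny = "s1 aNy"])
            (use p dis in \<open>auto simp: parsed_def\<close>)
        then show "parsed s s2 (Alt \<alpha> \<beta>) v k f q"
          using p un v by (auto simp: parsed_def)
      qed (use p in simp)
      done
    done
next
  case (Plus \<alpha>)
  show ?case
    apply (rule parse_loop_step)
     apply (simp add: Plus.prems(2))
    apply (simp add: parse_simps Plus.prems(2-5))
    apply (rule Plus.IH[where q = q and v = v and k = f and f = "f + 1"])
    using Plus.prems(1-7) apply simp_all[7]
    subgoal premises p for s1 b1
    proof (rule Plus.prems(8))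
      have f: "f \<notin> vs \<alpha> v (f + 1)" using Plus.prems(6,7) by (auto simp: vs_def)
      have un: "u \<notin> vs \<alpha> v (f + 1)" "u \<noteq> f" if "u \<notin> vs (Plus \<alpha>) v f" for u
        using that by (auto simp: vs_def)
      show "parsed s s1 (Plus \<alpha>) v k f q"
        using p un f by (auto simp: parsed_def)
    qed (use p in simp)
    done
next
  case (Bind x \<alpha>)
  show ?case
    apply (rule parse_loop_step)
     apply (simp add: Bind.prems(2))
    apply (simp add: parse_simps Bind.prems(2-5))
    apply (rule Bind.IH[where q = q and v = f and k = "f + 1" and f = "f + 2"])
    using Bind.prems(1-7) apply simp_all[7]
    subgoal premises p for s1 b1
    proof (rule Bind.prems(8))
      have f: "f + 1 \<notin> vs \<alpha> f (f + 2)" "v \<notin> vs \<alpha> f (f + 2)"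
        using Bind.prems(6,7) by (auto simp: vs_def)
      have un: "u \<notin> vs \<alpha> f (f + 2)" "u \<noteq> v" "u \<noteq> f + 1" if "u \<notin> vs (Bind x \<alpha>) v f" for u
        using that by (auto simp: vs_def)
      show "parsed s s1 (Bind x \<alpha>) v k f q"
        using p un f Bind.prems(6) by (auto simp: parsed_def)
    qed (use p in simp)
    done
qed

section \<open>Computing the tables\<close>

abbreviation (input) "xSt \<equiv> (14::nat)"
abbreviation (input) "xH \<equiv> (15::nat)"
abbreviation (input) "xRh \<equiv> (16::nat)"
abbreviation (input) "xTail \<equiv> (17::nat)"
abbreviation (input) "xU \<equiv> (18::nat)"
abbreviation (input) "xIdx \<equiv> (19::nat)"
abbreviation (input) "xLast \<equiv> (20::nat)"
abbreviation (input) "xA \<equiv> (21::nat)"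
abbreviation (input) "xT \<equiv> (22::nat)"
abbreviation (input) "xC \<equiv> (23::nat)"
abbreviation (input) "xStamp \<equiv> (24::nat)"
abbreviation (input) "xAp \<equiv> (25::nat)"
abbreviation (input) "xRp \<equiv> (26::nat)"
abbreviation (input) "aVis \<equiv> (27::nat)"
abbreviation (input) "aQ \<equiv> (28::nat)"
abbreviation (input) "aP \<equiv> (29::nat)"
abbreviation (input) "aTg \<equiv> (30::nat)"
abbreviation (input) "aPb \<equiv> (31::nat)"
abbreviation (input) "aMk \<equiv> (32::nat)"
abbreviation (input) "aRow \<equiv> (33::nat)"
abbreviation (input) "aLst \<equiv> (34::nat)"
abbreviation (input) "aTt \<equiv> (35::nat)"
abbreviation (input) "aAe \<equiv> (36::nat)"
abbreviation (input) "xX \<equiv> (37::nat)"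

section \<open>The search from one state\<close>

abbreviation incr :: "nat \<Rightarrow> com" where "incr j \<equiv> Asg j (Pl (V j) (N 1))"

text \<open>Visited vertices are stamped with the current state. States start at 2 and increase, so
  neither initial zeros nor older stamps are mistaken for a visit.\<close>

definition visit :: "nat \<Rightarrow> com" where
  "visit j = (let e = Ar j (V xU) in Ite e
    (Ite (Pl (Mi (Ar aVis e) (V xSt)) (Mi (V xSt) (Ar aVis e)))
      (Upd aVis e (V xSt) ;; Upd aQ (V xTail) e ;; Upd aP (V xTail) (Pl (V xIdx) (N 1)) ;; incr xTail)
      Skip)
    Skip)"

text \<open>One queue with two reading heads. \<open>xH\<close> crosses brackets and unlabelled
  vertices and records terminals and variables; only when it has caught up with the tail does
  \<open>xRh\<close> advance, crossing variables in the order of their discovery. This realizes the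
  preference for paths without variables.\<close>

definition explore_body :: com where
  "explore_body =
    Ite (Mi (V xTail) (V xH))
      (Asg xIdx (V xH) ;; Asg xU (Ar aQ (V xIdx)) ;; incr xH ;;
       Ite (Mi (Ar aKd (V xU)) (N 2))
         (Ite (Mi (Ar aKd (V xU)) (N 3)) (Asg xLast (V xH)) (Upd aTg (Ar aLb (V xU)) (V xH)))
         (visit aNx ;; visit aNy))
      (Asg xIdx (V xRh) ;; Asg xU (Ar aQ (V xIdx)) ;; incr xRh ;;
       Ite (Mi (Ar aKd (V xU)) (N 3)) (visit aNx) Skip)"

definition explore :: com where
  "explore =
    Asg xA (N 0) ;;
    While (Mi (Pl (V xSig) (N 1)) (V xA)) (Upd aTg (V xA) (N 0) ;; incr xA) ;;
    Asg xLast (N 0) ;; Asg xTail (N 1) ;; Asg xH (N 0) ;; Asg xRh (N 0) ;;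
    Upd aQ (N 0) (Ar aNx (V xSt)) ;; Upd aP (N 0) (N 0) ;; Upd aVis (Ar aNx (V xSt)) (V xSt) ;;
    While (Mi (V xTail) (V xRh)) explore_body"

context det_graph
begin

definition tabs :: "store \<Rightarrow> bool" where
  "tabs s \<longleftrightarrow> s aKd = kd \<and> s aLb = lb \<and> s aNx = nx \<and> s aNy = ny \<and> s xSig 0 = \<sigma>"

text \<open>What holds while the search is under way: \<open>tree\<close> except for the closure
  under \<open>cr\<close>, together with the meaning of the visit stamps. The closure is supplied in
  the end by \<open>closed\<close>.\<close>

definition core :: "nat \<Rightarrow> tab \<Rightarrow> tab \<Rightarrow> nat \<Rightarrow> tab \<Rightarrow> bool" where
  "core v Q P n vis \<longleftrightarrow> 0 < n \<and> Q 0 = nx v \<and> P 0 = 0 \<and> inj_on Q {..<n} \<and> Q ` {..<n} \<subseteq> insert 1 U \<and>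
    (\<forall>y. vis y = v \<longleftrightarrow> y \<in> Q ` {..<n}) \<and>
    (\<forall>j<n. 0 < j \<longrightarrow> 0 < P j \<and> P j \<le> j \<and> cr (Q (P j - 1)) (Q j)) \<and>
    (\<forall>j<n. 0 < j \<longrightarrow> 3 < kd (Q (P j - 1)) \<longrightarrow>
      (\<forall>i<j. \<forall>u'. kd (Q i) < 3 \<and> cr (Q i) u' \<longrightarrow> u' \<in> Q ` {..<j}) \<and>
      (\<forall>i<P j - 1. \<forall>u'. 3 < kd (Q i) \<and> cr (Q i) u' \<longrightarrow> u' \<in> Q ` {..<j}))"

definition closed :: "(nat \<Rightarrow> bool) \<Rightarrow> tab \<Rightarrow> nat \<Rightarrow> nat \<Rightarrow> bool" where
  "closed R Q m n \<longleftrightarrow> (\<forall>j<m. \<forall>u'. R (kd (Q j)) \<and> cr (Q j) u' \<longrightarrow> u' \<in> Q ` {..<n})"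

lemma image_upd: "(Q(n := y)) ` {..<Suc n} = insert y (Q ` {..<n})"
  by (auto simp: lessThan_Suc)

lemma image_upd_le: "(j::nat) \<le> n \<Longrightarrow> (Q(n := y)) ` {..<j} = Q ` {..<j}"
  by (rule image_cong) auto

text \<open>The premise \<open>r\<close> is the situation in which the second head crosses a
  variable; it yields the last conjunct of \<open>core\<close> for the new vertex.\<close>

lemma core_add:
  assumes c: "core v Q P n vis" and y: "y \<notin> Q ` {..<n}" "cr (Q idx) y" and idx: "idx < n"
    and r: "3 < kd (Q idx) \<Longrightarrow> closed (\<lambda>k. k < 3) Q n n \<and> closed (\<lambda>k. 3 < k) Q idx n"
  shows "core v (Q(n := y)) (P(n := Suc idx)) (Suc n) (vis(y := v))"
proof -
  have "Q idx \<in> Q ` {..<n}" "Q ` {..<n} \<subseteq> insert 1 U" using c idx by (simp_all add: core_def)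
  note QU = this(2)
  from \<open>Q idx \<in> Q ` {..<n}\<close> QU have "Q idx \<in> insert 1 U" by blast
  then have yU: "y \<in> insert 1 U" using U_closed[of "Q idx" y] y(2) unfolding cr_def by blast
  have inj: "inj_on (Q(n := y)) {..<Suc n}"
    using c y(1) unfolding core_def by (auto simp: lessThan_Suc inj_on_fun_updI)
  have vis: "\<forall>y'. (vis(y := v)) y' = v \<longleftrightarrow> y' \<in> (Q(n := y)) ` {..<Suc n}"
    using c unfolding image_upd core_def by auto
  have par: "\<forall>j<Suc n. 0 < j \<longrightarrow> 0 < (P(n := Suc idx)) j \<and> (P(n := Suc idx)) j \<le> j \<and>
      cr ((Q(n := y)) ((P(n := Suc idx)) j - 1)) ((Q(n := y)) j)"
  proof (intro allI impI)
    fix j assume j: "j < Suc n" "0 < j"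
    show "0 < (P(n := Suc idx)) j \<and> (P(n := Suc idx)) j \<le> j \<and>
      cr ((Q(n := y)) ((P(n := Suc idx)) j - 1)) ((Q(n := y)) j)"
    proof (cases "j = n")
      case False
      then have "j < n" using j by simp
      then have *: "0 < P j" "P j \<le> j" "cr (Q (P j - 1)) (Q j)" using c j unfolding core_def by blast+
      then have "P j - 1 \<noteq> n" using \<open>j < n\<close> by simp
      then show ?thesis using * False by simp
    qed (use idx y in auto)
  qed
  have T2: "\<forall>j<Suc n. 0 < j \<longrightarrow> 3 < kd ((Q(n := y)) ((P(n := Suc idx)) j - 1)) \<longrightarrow>
      (\<forall>i<j. \<forall>u'. kd ((Q(n := y)) i) < 3 \<and> cr ((Q(n := y)) i) u' \<longrightarrow> u' \<in> (Q(n := y)) ` {..<j}) \<and>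
      (\<forall>i<(P(n := Suc idx)) j - 1. \<forall>u'. 3 < kd ((Q(n := y)) i) \<and> cr ((Q(n := y)) i) u' \<longrightarrow>
        u' \<in> (Q(n := y)) ` {..<j})"
  proof (intro allI impI)
    fix j assume j: "j < Suc n" "0 < j" "3 < kd ((Q(n := y)) ((P(n := Suc idx)) j - 1))"
    have im: "(Q(n := y)) ` {..<j} = Q ` {..<j}" using j(1) by (intro image_upd_le) simp
    show "(\<forall>i<j. \<forall>u'. kd ((Q(n := y)) i) < 3 \<and> cr ((Q(n := y)) i) u' \<longrightarrow> u' \<in> (Q(n := y)) ` {..<j}) \<and>
      (\<forall>i<(P(n := Suc idx)) j - 1. \<forall>u'. 3 < kd ((Q(n := y)) i) \<and> cr ((Q(n := y)) i) u' \<longrightarrow>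
        u' \<in> (Q(n := y)) ` {..<j})"
    proof (cases "j = n")
      case True
      then have "3 < kd (Q idx)" using j idx by auto
      then show ?thesis unfolding im using r idx True by (auto simp: closed_def)
    next
      case False
      then have "j < n" using j by simp
      moreover have "P j \<le> j" using c j \<open>j < n\<close> unfolding core_def by blast
      moreover have "3 < kd (Q (P j - 1))" using j False calculation by (auto split: if_splits)
      ultimately have *: "(\<forall>i<j. \<forall>u'. kd (Q i) < 3 \<and> cr (Q i) u' \<longrightarrow> u' \<in> Q ` {..<j}) \<and>
        (\<forall>i<P j - 1. \<forall>u'. 3 < kd (Q i) \<and> cr (Q i) u' \<longrightarrow> u' \<in> Q ` {..<j})"
        using c j(2) unfolding core_def by blast
      have "i < j \<Longrightarrow> (Q(n := y)) i = Q i" for i using \<open>j < n\<close> by auto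
      moreover have "i < P j - 1 \<Longrightarrow> i < j" for i using \<open>P j \<le> j\<close> by simp
      ultimately show ?thesis unfolding im using * False by (simp cong: conj_cong)
    qed
  qed
  have "(Q(n := y)) 0 = nx v" "(P(n := Suc idx)) 0 = 0" using c unfolding core_def by auto
  moreover have "(Q(n := y)) ` {..<Suc n} \<subseteq> insert 1 U"
    using QU yU unfolding image_upd by blast
  ultimately show ?thesis
    unfolding core_def using inj vis par T2 by (intro conjI zero_less_Suc)
qed

lemma core_bound: "core v Q P n vis \<Longrightarrow> n \<le> fr \<alpha> + 2"
proof -
  assume c: "core v Q P n vis"
  then have "n = card (Q ` {..<n})" by (simp add: core_def card_image)
  also have "\<dots> \<le> card (insert 1 U)" using c by (intro card_mono) (auto simp: core_def vs_def)
  also have "\<dots> \<le> fr \<alpha> + 2" by (auto simp: vs_def intro: le_trans[OF card_insert_le_m1])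
  finally show ?thesis .
qed

abbreviation core_in :: "store \<Rightarrow> bool" where
  "core_in s \<equiv> core (s xSt 0) (s aQ) (s aP) (s xTail 0) (s aVis)"

lemma wp_visit:
  assumes "core_in s" "s xIdx 0 < s xTail 0" "y = s j (s xU 0)" "y \<noteq> 0 \<Longrightarrow> cr (s aQ (s xIdx 0)) y"
    and j: "j = aNx \<or> j = aNy"
    and "3 < kd (s aQ (s xIdx 0)) \<Longrightarrow> closed (\<lambda>k. k < 3) (s aQ) (s xTail 0) (s xTail 0) \<and>
      closed (\<lambda>k. 3 < k) (s aQ) (s xIdx 0) (s xTail 0)"
    and cont: "\<And>s' b'. \<forall>j. j \<notin> {aVis, aQ, aP, xTail} \<longrightarrow> s' j = s j \<Longrightarrow> core_in s' \<Longrightarrow>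
      s xTail 0 \<le> s' xTail 0 \<Longrightarrow> \<forall>i<s xTail 0. s' aQ i = s aQ i \<Longrightarrow>
      \<forall>y. s' aVis y = s aVis y \<or> s' aVis y = s xSt 0 \<Longrightarrow>
      y = 0 \<or> y \<in> s' aQ ` {..<s' xTail 0} \<Longrightarrow> b - 10 \<le> b' \<Longrightarrow> R s' is b'"
  shows "wp (visit j) R s is b"
proof (cases "y \<noteq> 0 \<and> s aVis y \<noteq> s xSt 0")
  case True
  then have y: "y \<notin> s aQ ` {..<s xTail 0}" using assms(1) unfolding core_def by metis
  have ca: "core (s xSt 0) ((s aQ)(s xTail 0 := y)) ((s aP)(s xTail 0 := Suc (s xIdx 0)))
      (Suc (s xTail 0)) ((s aVis)(y := s xSt 0))"
    by (rule core_add[OF assms(1) y]) (use assms True in auto)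
  define s' where "s' = put (put (put (put s aVis y (s xSt 0)) aQ (s xTail 0) y) aP (s xTail 0)
    (Suc (s xIdx 0))) xTail 0 (Suc (s xTail 0))"
  have "R s' is (b - 6)"
    by (rule cont) (use ca in \<open>auto simp: s'_def\<close>)
  moreover have "0 < s aVis y - s xSt 0 \<or> 0 < s xSt 0 - s aVis y" using True by linarith
  ultimately show ?thesis
    using True j unfolding s'_def
    by (auto simp: visit_def assms(3) Let_def)
next
  case False
  show ?thesis
  proof (cases "y = 0")
    case True
    have "R s is (b - 1)" by (rule cont) (use True assms(1) in auto)
    then show ?thesis using True assms(3) by (simp add: visit_def Let_def)
  next
    case y: False
    then have v: "s aVis y = s xSt 0" using False by simp
    then have "y \<in> s aQ ` {..<s xTail 0}" using assms(1) unfolding core_def by blast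
    then have "R s is (b - 2)" by (intro cont) (use assms(1) in auto)
    then show ?thesis using y v assms(3) by (simp add: visit_def Let_def)
  qed
qed

lemma closed_mono:
  assumes "closed R Q m n" "n \<le> n'" "m \<le> n" "\<forall>i<n. Q' i = Q i"
  shows "closed R Q' m n'"
proof -
  have "Q ` {..<n} \<subseteq> Q' ` {..<n'}"
    using assms(2,4) by (metis image_cong image_mono lessThan_iff lessThan_subset_iff)
  then show ?thesis using assms(1,3,4) unfolding closed_def by (metis less_le_trans subsetD)
qed

lemma closed_Suc:
  assumes "closed R Q m n" "\<And>u'. R (kd (Q m)) \<Longrightarrow> cr (Q m) u' \<Longrightarrow> u' \<in> Q ` {..<n}"
  shows "closed R Q (Suc m) n"
  using assms unfolding closed_def by (auto simp: less_Suc_eq)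

definition tg_ok :: "tab \<Rightarrow> tab \<Rightarrow> nat \<Rightarrow> bool" where
  "tg_ok tg Q h \<longleftrightarrow>
    (\<forall>a\<le>\<sigma>. tg a \<noteq> 0 \<longrightarrow> tg a \<le> h \<and> kd (Q (tg a - 1)) = 3 \<and> lb (Q (tg a - 1)) = a) \<and>
    (\<forall>j<h. kd (Q j) = 3 \<longrightarrow> tg (lb (Q j)) \<noteq> 0)"

definition last_ok :: "nat \<Rightarrow> tab \<Rightarrow> nat \<Rightarrow> bool" where
  "last_ok l Q h \<longleftrightarrow> (l \<noteq> 0 \<longrightarrow> l \<le> h \<and> 3 < kd (Q (l - 1))) \<and> (\<forall>j<h. 3 < kd (Q j) \<longrightarrow> j < l)"

definition ex_inv :: "store \<Rightarrow> bool" where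
  "ex_inv s \<longleftrightarrow> core_in s \<and> s xRh 0 \<le> s xH 0 \<and> s xH 0 \<le> s xTail 0 \<and>
    closed (\<lambda>k. k < 3) (s aQ) (s xH 0) (s xTail 0) \<and> closed (\<lambda>k. 3 < k) (s aQ) (s xRh 0) (s xTail 0) \<and>
    tg_ok (s aTg) (s aQ) (s xH 0) \<and> last_ok (s xLast 0) (s aQ) (s xH 0)"

definition ex_frame :: "store \<Rightarrow> store \<Rightarrow> bool" where
  "ex_frame s s' \<longleftrightarrow>
    (\<forall>j. j \<notin> {xH, xRh, xTail, xU, xIdx, xLast, xA, aVis, aQ, aP, aTg} \<longrightarrow> s' j = s j) \<and>
    (\<forall>y. s' aVis y = s aVis y \<or> s' aVis y = s xSt 0)"

lemma ex_frame_trans: "ex_frame s s' \<Longrightarrow> ex_frame s' s'' \<Longrightarrow> ex_frame s s''"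
proof -
  assume a: "ex_frame s s'" and b: "ex_frame s' s''"
  have "s' xSt = s xSt" using a by (simp add: ex_frame_def)
  then have "s'' aVis y = s aVis y \<or> s'' aVis y = s xSt 0" for y
    using a b unfolding ex_frame_def by metis
  then show ?thesis using a b by (simp add: ex_frame_def)
qed

lemma tabs_frame: "ex_frame s s' \<Longrightarrow> tabs s \<Longrightarrow> tabs s'"
  by (auto simp: ex_frame_def tabs_def)

lemma tg_ok_cong: "tg_ok tg Q h \<Longrightarrow> \<forall>i<h. Q' i = Q i \<Longrightarrow> tg_ok tg Q' h"
  unfolding tg_ok_def
  by (metis One_nat_def diff_less less_le_trans less_numeral_extra(1) neq0_conv)

lemma last_ok_cong: "last_ok l Q h \<Longrightarrow> \<forall>i<h. Q' i = Q i \<Longrightarrow> last_ok l Q' h"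
  unfolding last_ok_def
  by (metis One_nat_def diff_less less_le_trans less_numeral_extra(1) neq0_conv)

lemma core_in_U: "core v Q P n vis \<Longrightarrow> j < n \<Longrightarrow> Q j \<in> insert 1 U"
  unfolding core_def by (metis imageI lessThan_iff subsetD)

lemma wp_explore_body:
  assumes inv: "ex_inv s" and t: "tabs s" and ne: "s xRh 0 < s xTail 0"
    and cont: "\<And>s' b'. ex_inv s' \<Longrightarrow> ex_frame s s' \<Longrightarrow>
      s' xH 0 + s' xRh 0 = Suc (s xH 0 + s xRh 0) \<Longrightarrow> b - 40 \<le> b' \<Longrightarrow> R s' is b'"
  shows "wp explore_body R s is b"
proof -
  have tt: "s aKd = kd" "s aLb = lb" "s aNx = nx" "s aNy = ny" using t by (auto simp: tabs_def)
  have i: "core_in s" "s xRh 0 \<le> s xH 0" "s xH 0 \<le> s xTail 0"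
    "closed (\<lambda>k. k < 3) (s aQ) (s xH 0) (s xTail 0)" "closed (\<lambda>k. 3 < k) (s aQ) (s xRh 0) (s xTail 0)"
    "tg_ok (s aTg) (s aQ) (s xH 0)" "last_ok (s xLast 0) (s aQ) (s xH 0)"
    using inv by (auto simp: ex_inv_def)
  show ?thesis
  proof (cases "s xH 0 < s xTail 0")
    case True
    let ?u = "s aQ (s xH 0)"
    have uU: "?u \<in> insert 1 U" by (rule core_in_U[OF i(1) True])
    define s1 where "s1 = put (put (put s xIdx 0 (s xH 0)) xU 0 ?u) xH 0 (Suc (s xH 0))"
    consider "kd ?u < 3" | "kd ?u = 3" | "3 < kd ?u" by linarith
    then show ?thesis
    proof cases
      case 1
      have "wp (visit aNx) (wp (visit aNy) R) s1 is (b - 5)"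
      proof (rule wp_visit[where y = "nx ?u" and j = aNx], goal_cases)
        case (7 s2 b2)
        note v1 = 7
        show ?case
        proof (rule wp_visit[where y = "ny ?u" and j = aNy], goal_cases)
          case (7 s3 b3)
          note v2 = 7
          have Q2: "\<forall>i<s xTail 0. s2 aQ i = s aQ i" using v1(4) by (simp add: s1_def)
          have n2: "s xTail 0 \<le> s2 xTail 0" using v1(3) by (simp add: s1_def)
          have Q3: "\<forall>i<s xTail 0. s3 aQ i = s aQ i" using v2(4) Q2 n2 by (metis less_le_trans)
          have n3: "s xTail 0 \<le> s3 xTail 0" using v2(3) n2 by simp
          have im: "s2 aQ ` {..<s2 xTail 0} \<subseteq> s3 aQ ` {..<s3 xTail 0}"
            using v2(3,4) by (metis image_cong image_mono lessThan_iff lessThan_subset_iff)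
          have fr: "ex_frame s s3"
            using v1(1,5) v2(1,5) by (auto simp: ex_frame_def s1_def) metis+
          have same: "s3 xH 0 = Suc (s xH 0)" "s3 xRh 0 = s xRh 0" "s3 aTg = s aTg"
            "s3 xLast 0 = s xLast 0"
            using v1(1) v2(1) by (auto simp: s1_def)
          have succ: "u' \<in> s3 aQ ` {..<s3 xTail 0}" if "cr ?u u'" for u'
            using that v1(6) v2(6) im by (auto simp: cr_def)
          have "closed (\<lambda>k. k < 3) (s3 aQ) (Suc (s xH 0)) (s3 xTail 0)"
            using closed_mono[OF i(4) n3 i(3) Q3] Q3 True succ by (intro closed_Suc) auto
          moreover have "closed (\<lambda>k. 3 < k) (s3 aQ) (s xRh 0) (s3 xTail 0)"
            by (rule closed_mono[OF i(5) n3 _ Q3]) (use ne in simp)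
          moreover have Qh: "\<forall>j<s xH 0. s3 aQ j = s aQ j" using Q3 i(3) by simp
          have "tg_ok (s aTg) (s3 aQ) (Suc (s xH 0))"
            using tg_ok_cong[OF i(6) Qh] 1 Q3 True unfolding tg_ok_def by (auto simp: less_Suc_eq)
          moreover have "last_ok (s xLast 0) (s3 aQ) (Suc (s xH 0))"
            using last_ok_cong[OF i(7) Qh] 1 Q3 True unfolding last_ok_def by (auto simp: less_Suc_eq)
          ultimately have "ex_inv s3"
            unfolding ex_inv_def same using v2(2) i(2) n3 True by (intro conjI) auto
          then show ?case using fr same v1(7) v2(7) by (intro cont) auto
        qed (use v1 1 i True in \<open>auto simp: s1_def tt cr_def\<close>)
      qed (use 1 i True in \<open>auto simp: s1_def tt cr_def\<close>)
      then show ?thesis using True 1 by (simp add: explore_body_def tt s1_def)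
    next
      case 2
      define s2 where "s2 = put s1 aTg (lb ?u) (Suc (s xH 0))"
      have "ex_inv s2"
        using i 2 True unfolding ex_inv_def
        by (auto simp: s2_def s1_def tg_ok_def last_ok_def less_Suc_eq intro!: closed_Suc)
      moreover have "ex_frame s s2" by (auto simp: ex_frame_def s2_def s1_def)
      ultimately have "R s2 is (b - 7)" by (intro cont) (auto simp: s2_def s1_def)
      then show ?thesis using True 2 by (simp add: explore_body_def tt s1_def s2_def)
    next
      case 3
      define s2 where "s2 = put s1 xLast 0 (Suc (s xH 0))"
      have "ex_inv s2"
        using i 3 True unfolding ex_inv_def
        by (auto simp: s2_def s1_def tg_ok_def last_ok_def less_Suc_eq intro!: closed_Suc)
      moreover have "ex_frame s s2" by (auto simp: ex_frame_def s2_def s1_def)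
      ultimately have "R s2 is (b - 7)" by (intro cont) (auto simp: s2_def s1_def)
      then show ?thesis using True 3 by (simp add: explore_body_def tt s1_def s2_def)
    qed
  next
    case False
    \<comment> \<open>The first head has reached the tail, so everything found without further
      variables is in the queue; only now may a variable be crossed.\<close>
    then have hn: "s xH 0 = s xTail 0" using i(3) by simp
    let ?u = "s aQ (s xRh 0)"
    have uU: "?u \<in> insert 1 U" by (rule core_in_U[OF i(1) ne])
    define s1 where "s1 = put (put (put s xIdx 0 (s xRh 0)) xU 0 ?u) xRh 0 (Suc (s xRh 0))"
    show ?thesis
    proof (cases "3 < kd ?u")
      case True
      have ny: "ny ?u = 0" using uU True U_facts(3)[of ?u] final by auto
      have "wp (visit aNx) R s1 is (b - 5)"
      proof (rule wp_visit[where y = "nx ?u" and j = aNx], goal_cases)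
        case (7 s2 b2)
        note v1 = 7
        have Q2: "\<forall>i<s xTail 0. s2 aQ i = s aQ i" using v1(4) by (simp add: s1_def)
        have n2: "s xTail 0 \<le> s2 xTail 0" using v1(3) by (simp add: s1_def)
        have fr: "ex_frame s s2" using v1(1,5) by (auto simp: ex_frame_def s1_def)
        have same: "s2 xH 0 = s xH 0" "s2 xRh 0 = Suc (s xRh 0)" "s2 aTg = s aTg"
          "s2 xLast 0 = s xLast 0"
          using v1(1) by (auto simp: s1_def)
        have succ: "u' \<in> s2 aQ ` {..<s2 xTail 0}" if "cr ?u u'" for u'
          using that v1(6) ny by (auto simp: cr_def)
        have "closed (\<lambda>k. k < 3) (s2 aQ) (s xH 0) (s2 xTail 0)"
          by (rule closed_mono[OF i(4) n2 i(3) Q2])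
        moreover have "closed (\<lambda>k. 3 < k) (s2 aQ) (Suc (s xRh 0)) (s2 xTail 0)"
          using closed_mono[OF i(5) n2 _ Q2] ne Q2 succ by (intro closed_Suc) auto
        moreover have "tg_ok (s aTg) (s2 aQ) (s xH 0)" "last_ok (s xLast 0) (s2 aQ) (s xH 0)"
          using tg_ok_cong[OF i(6)] last_ok_cong[OF i(7)] Q2 hn by auto
        ultimately have "ex_inv s2"
          unfolding ex_inv_def same using v1(2) hn n2 ne by (intro conjI) auto
        then show ?case using fr same v1(7) by (intro cont) auto
      qed (use True i hn ne in \<open>auto simp: s1_def tt cr_def\<close>)
      then show ?thesis using False True by (simp add: explore_body_def tt s1_def)
    next
      case k: False
      have "ex_inv s1"
        using i k ne hn unfolding ex_inv_def by (auto simp: s1_def intro!: closed_Suc)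
      moreover have "ex_frame s s1" by (auto simp: ex_frame_def s1_def)
      ultimately have "R s1 is (b - 5)" by (intro cont) (auto simp: s1_def)
      then show ?thesis using False k by (simp add: explore_body_def tt s1_def)
    qed
  qed
qed

end

text \<open>Marks relative to the stamp encode those of \<open>dd\<close>: older values stand for 0,
  the stamp for 1, its successor for 2. Raising the stamp by 2 invalidates all marks at once. A
  closing bracket uses \<open>d = 0\<close>, the other events \<open>d = 1\<close>.\<close>

definition append_event :: "nat \<Rightarrow> com" where
  "append_event d = Ite (Mi (Pl (V xStamp) (N d)) (Ar aMk (V xX)))
    (Upd aMk (V xX) (Pl (V xStamp) (N d)) ;; Upd aAe (V xAp) (V xU) ;; incr xAp) Skip"

definition event :: com where
  "event = Asg xX (Ar aLb (V xU)) ;;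
    Ite (Ar aKd (V xU))
      (Ite (Mi (Ar aKd (V xU)) (N 2))
        (Ite (Mi (Ar aKd (V xU)) (N 3)) (append_event 1) Skip)
        (Ite (Mi (Ar aKd (V xU)) (N 1)) (append_event 0) (append_event 1)))
      Skip"

text \<open>Parents lead from the end of the path to its root; the buffer \<open>aPb\<close> is
  later emptied from its top, which restores the order.\<close>

definition collect_path :: com where
  "collect_path = While (V xT) (Upd aPb (V xC) (Ar aQ (Mi (V xT) (N 1))) ;; incr xC ;;
    Asg xT (Ar aP (Mi (V xT) (N 1))))"

definition emit_events :: com where
  "emit_events = While (V xC) (Asg xC (Mi (V xC) (N 1)) ;; Asg xU (Ar aPb (V xC)) ;; event)"

text \<open>All event lists stand one after another in \<open>aAe\<close>, each closed by 0, which
  is not a vertex. Without a target for the letter, the path to the last variable is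
  recorded.\<close>

definition row :: com where
  "row = Asg xT (Ar aTg (V xA)) ;;
    Ite (V xT)
      (Upd aTt (Pl (V xRp) (V xA)) (Ar aQ (Mi (V xT) (N 1))))
      (Upd aTt (Pl (V xRp) (V xA)) (N 0) ;; Asg xT (V xLast)) ;;
    Upd aLst (Pl (V xRp) (V xA)) (V xAp) ;; Asg xStamp (Pl (V xStamp) (N 2)) ;; Asg xC (N 0) ;;
    collect_path ;; emit_events ;; Upd aAe (V xAp) (N 0) ;; incr xAp"

definition rows :: com where
  "rows = Asg xA (N 0) ;; While (Mi (Pl (V xSig) (N 1)) (V xA)) (row ;; incr xA)"

text \<open>A matching step always resumes behind a terminal or a variable or at the start vertex,
  which has been given the kind of a terminal; only these need tables.\<close>

definition state_body :: com where
  "state_body =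
    Ite (Mi (Ar aKd (V xSt)) (N 2))
      (explore ;; Upd aRow (V xSt) (V xRp) ;; rows ;; Asg xRp (Pl (V xRp) (Pl (V xSig) (N 1))))
      Skip ;;
    incr xSt"

definition tables :: com where
  "tables = While (Mi (V xFr) (V xSt)) state_body"

context det_graph
begin

text \<open>Both heads have passed the whole queue. Terminals are never crossed, so the two closure
  facts cover all kinds of vertices.\<close>

lemma tree_if_ex_inv:
  assumes "ex_inv s" "s xTail 0 \<le> s xRh 0"
  shows "tree (s xSt 0) (s aQ) (s aP) (s xTail 0) \<and>
    tg_ok (s aTg) (s aQ) (s xTail 0) \<and> last_ok (s xLast 0) (s aQ) (s xTail 0)"
proof -
  have eq: "s xH 0 = s xTail 0" "s xRh 0 = s xTail 0" using assms by (auto simp: ex_inv_def)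
  have cl: "closed (\<lambda>k. k < 3) (s aQ) (s xTail 0) (s xTail 0)"
    "closed (\<lambda>k. 3 < k) (s aQ) (s xTail 0) (s xTail 0)"
    using assms(1) eq by (auto simp: ex_inv_def)
  have "\<forall>j<s xTail 0. \<forall>u'. cr (s aQ j) u' \<longrightarrow> u' \<in> s aQ ` {..<s xTail 0}"
  proof (intro allI impI)
    fix j u' assume j: "j < s xTail 0" "cr (s aQ j) u'"
    then have "kd (s aQ j) < 3 \<or> 3 < kd (s aQ j)" by (auto simp: cr_def)
    then show "u' \<in> s aQ ` {..<s xTail 0}" using cl j unfolding closed_def by blast
  qed
  moreover have "core_in s" using assms(1) by (simp add: ex_inv_def)
  ultimately have "tree (s xSt 0) (s aQ) (s aP) (s xTail 0)"
    unfolding tree_def core_def by (intro conjI) simp_all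
  then show ?thesis using assms(1) eq by (simp add: ex_inv_def)
qed

lemma wp_explore:
  assumes t: "tabs s" and v: "s xSt 0 \<in> insert 2 U" and vis: "\<forall>y. s aVis y \<noteq> s xSt 0"
    and cont: "\<And>s' b'. ex_frame s s' \<Longrightarrow> tree (s xSt 0) (s' aQ) (s' aP) (s' xTail 0) \<Longrightarrow>
      tg_ok (s' aTg) (s' aQ) (s' xTail 0) \<Longrightarrow> last_ok (s' xLast 0) (s' aQ) (s' xTail 0) \<Longrightarrow>
      s' xTail 0 \<le> fr \<alpha> + 2 \<Longrightarrow> b - 3 * int \<sigma> - 82 * int (fr \<alpha> + 2) - 40 \<le> b' \<Longrightarrow> R s' is b'"
  shows "wp explore R s is b"
proof -
  let ?v = "s xSt 0" and ?n = "fr \<alpha> + 2"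
  have sig: "s xSig 0 = \<sigma>" "s aNx = nx" using t by (auto simp: tabs_def)
  have main: "wp (While (Mi (V xTail) (V xRh)) explore_body) R s1 is b1"
    if "ex_inv s1" "ex_frame s s1" "b - 3 * int \<sigma> - 30 \<le> b1" "s1 xH 0 = 0" "s1 xRh 0 = 0" for s1 b1
  \<comment> \<open>Every iteration advances exactly one head, and each head passes every vertex at
    most once, whence at most twice the number of vertices.\<close>
  proof (rule wp_While[where I = "\<lambda>s' is' b'. is' = is \<and> ex_inv s' \<and> ex_frame s s' \<and>
        b1 - 41 * int (s' xH 0 + s' xRh 0) \<le> b'" and M = "\<lambda>s'. 2 * ?n - (s' xH 0 + s' xRh 0)"],
      goal_cases)
    case 1
    then show ?case using that by simp
  next
    case (2 s2 is2 b2)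
    then have inv: "ex_inv s2" "ex_frame s s2" and lt: "s2 xRh 0 < s2 xTail 0" by auto
    have "core_in s2" "s2 xH 0 \<le> s2 xTail 0" using inv by (auto simp: ex_inv_def)
    then have bd: "s2 xH 0 + s2 xRh 0 < 2 * ?n" using core_bound lt by fastforce
    show ?case
      by (rule wp_explore_body[OF inv(1) tabs_frame[OF inv(2) t] lt])
        (use 2 bd ex_frame_trans[OF inv(2)] in auto)
  next
    case (3 s2 is2 b2)
    then have inv: "ex_inv s2" "ex_frame s s2" and le: "s2 xTail 0 \<le> s2 xRh 0" by auto
    have st: "s2 xSt 0 = ?v" using inv(2) by (simp add: ex_frame_def)
    have bd: "s2 xTail 0 \<le> ?n" using inv(1) core_bound by (auto simp: ex_inv_def)
    then have "s2 xH 0 + s2 xRh 0 \<le> 2 * ?n" using inv(1) by (auto simp: ex_inv_def)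
    then have "R s2 is (b2 - 1)"
      using 3 tree_if_ex_inv[OF inv(1) le] st bd that(3) inv(2) by (intro cont) auto
    then show ?case using 3 by simp
  qed
  show ?thesis
    unfolding explore_def wp_Seq wp_Asg
  proof (rule wp_While[where I = "\<lambda>s' is' b'. is' = is \<and> s' xA 0 \<le> \<sigma> + 1 \<and>
        (\<forall>a<s' xA 0. s' aTg a = 0) \<and> (\<forall>j. j \<noteq> xA \<and> j \<noteq> aTg \<longrightarrow> s' j = s j) \<and>
        b - 1 - 3 * int (s' xA 0) \<le> b'" and M = "\<lambda>s'. \<sigma> + 1 - s' xA 0"], goal_cases)
    case (2 s2 is2 b2)
    then show ?case by (auto simp: sig less_Suc_eq)
  next
    case (3 s2 is2 b2)
    then have z: "s2 xA 0 = \<sigma> + 1" "\<forall>a\<le>\<sigma>. s2 aTg a = 0" by (auto simp: sig)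
    have same: "j \<noteq> xA \<Longrightarrow> j \<noteq> aTg \<Longrightarrow> s2 j = s j" for j using 3 by blast
    define s3 where "s3 = put (put (put (put (put (put (put s2 xLast 0 0) xTail 0 1) xH 0 0) xRh 0 0)
      aQ 0 (nx ?v)) aP 0 0) aVis (nx ?v) ?v"
    have "core_in s3"
      using nx_in_U[OF v] vis same by (auto simp: core_def s3_def inj_on_def)
    moreover have "tg_ok (s3 aTg) (s3 aQ) 0" using z by (auto simp: tg_ok_def s3_def)
    ultimately have "ex_inv s3" by (auto simp: ex_inv_def closed_def last_ok_def s3_def)
    moreover have "ex_frame s s3" using same by (auto simp: ex_frame_def s3_def)
    ultimately have "wp (While (Mi (V xTail) (V xRh)) explore_body) R s3 is (b2 - 8)"
      using 3 z by (intro main) (auto simp: s3_def)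
    then show ?case using 3 same by (simp add: s3_def sig)
  qed simp
qed

lemma wp_collect_path:
  assumes P: "\<forall>j<n. s aP j \<le> j" and tn: "s xT 0 \<le> n" and c0: "s xC 0 = 0"
    and cont: "\<And>s' b'. \<forall>j. j \<notin> {xT, xC, aPb} \<longrightarrow> s' j = s j \<Longrightarrow>
      rev (map (s' aPb) [0..<s' xC 0]) = map (s aQ) (tpath (s aP) (s xT 0)) \<Longrightarrow>
      s' xC 0 \<le> n \<Longrightarrow> b - 5 * int n - 1 \<le> b' \<Longrightarrow> R s' is b'"
  shows "wp collect_path R s is b"
  unfolding collect_path_def
proof (rule wp_While[where I = "\<lambda>s' is' b'. is' = is \<and> s' xC 0 + s' xT 0 \<le> n \<and>
      (\<forall>j. j \<notin> {xT, xC, aPb} \<longrightarrow> s' j = s j) \<and>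
      map (s aQ) (tpath (s aP) (s' xT 0)) @ rev (map (s' aPb) [0..<s' xC 0]) =
        map (s aQ) (tpath (s aP) (s xT 0)) \<and>
      b - 5 * int (s' xC 0) \<le> b'" and M = "\<lambda>s'. s' xT 0"], goal_cases)
  case 1
  then show ?case using tn c0 by simp
next
  case (2 s2 is2 b2)
  then obtain j where j: "s2 xT 0 = Suc j" by (cases "s2 xT 0") auto
  have same: "s2 aQ = s aQ" "s2 aP = s aP" using 2 by auto
  have Pj: "s aP j \<le> j" using P 2 j by auto
  have tp: "tpath (s aP) (Suc j) = tpath (s aP) (s aP j) @ [j]"
    using Pj by (subst tpath.simps) simp
  have mp: "map ((s2 aPb)(s2 xC 0 := s aQ j)) [0..<s2 xC 0] = map (s2 aPb) [0..<s2 xC 0]" by simp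
  show ?case using 2 Pj mp by (auto simp: j same tp)
next
  case (3 s2 is2 b2)
  then have "R s2 is (b2 - 1)" by (intro cont) (auto simp: tpath.simps[of _ 0])
  then show ?case using 3 by simp
qed

lemma wp_emit_events:
  assumes t: "tabs s" and mk: "\<forall>x. s aMk x < s xStamp 0" and xs: "xs = rev (map (s aPb) [0..<s xC 0])"
    and kd4: "\<forall>u\<in>set xs. kd u \<le> 4"
    and cont: "\<And>s' b' d. d = dd (\<lambda>_. 0) (filter (\<lambda>u. kd u \<noteq> 0 \<and> kd u \<noteq> 3) xs) \<Longrightarrow>
      \<forall>j. j \<notin> {xC, xU, xX, xAp, aMk, aAe} \<longrightarrow> s' j = s j \<Longrightarrow>
      s' xAp 0 = s xAp 0 + length d \<Longrightarrow> \<forall>k<length d. s' aAe (s xAp 0 + k) = d ! k \<Longrightarrow>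
      \<forall>i<s xAp 0. s' aAe i = s aAe i \<Longrightarrow> \<forall>x. s' aMk x < s xStamp 0 + 2 \<Longrightarrow>
      b - 15 * int (s xC 0) - 1 \<le> b' \<Longrightarrow> R s' is b'"
  shows "wp emit_events R s is b"
  unfolding emit_events_def
proof -
  let ?f = "filter (\<lambda>u. kd u \<noteq> 0 \<and> kd u \<noteq> 3)" and ?st = "s xStamp 0" and ?ap = "s xAp 0"
  \<comment> \<open>The marks of \<open>dd\<close>, recovered from the stamps; truncated subtraction
    sends every older value to 0.\<close>
  let ?mk = "\<lambda>s' x. s' aMk x + 1 - ?st"
  show "wp (While (V xC) (Asg xC (Mi (V xC) (N 1)) ;; Asg xU (Ar aPb (V xC)) ;; event)) R s is b"
  proof (rule wp_While[where I = "\<lambda>s' is' b'. is' = is \<and> s' xC 0 \<le> s xC 0 \<and>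
      (\<forall>j. j \<notin> {xC, xU, xX, xAp, aMk, aAe} \<longrightarrow> s' j = s j) \<and>
      (\<exists>d. d @ dd (?mk s') (?f (rev (map (s aPb) [0..<s' xC 0]))) = dd (\<lambda>_. 0) (?f xs) \<and>
        s' xAp 0 = ?ap + length d \<and> (\<forall>k<length d. s' aAe (?ap + k) = d ! k)) \<and>
      (\<forall>i<?ap. s' aAe i = s aAe i) \<and> (\<forall>x. s' aMk x < ?st + 2) \<and>
      b - 15 * int (s xC 0 - s' xC 0) \<le> b'" and M = "\<lambda>s'. s' xC 0"], goal_cases)
    case 1
    have "?mk s = (\<lambda>_. 0)" using mk by (auto simp: fun_eq_iff Suc_le_eq)
    then show ?case using mk xs by (auto intro!: exI[of _ "[]"] less_SucI)
  next
    case (2 s2 is2 b2)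
    then obtain c where c: "s2 xC 0 = Suc c" by (cases "s2 xC 0") auto
    define u where "u = s aPb c"
    have same: "s2 aPb = s aPb" "s2 aLb = lb" "s2 aKd = kd" "s2 xStamp 0 = ?st"
      using 2 t by (auto simp: tabs_def)
    have cle: "Suc c \<le> s xC 0" using 2 c by simp
    have "u \<in> set xs" using cle by (simp add: xs u_def)
    then have k4: "kd u \<le> 4" using kd4 by blast
    obtain d where d: "d @ dd (?mk s2) (?f (rev (map (s aPb) [0..<Suc c]))) = dd (\<lambda>_. 0) (?f xs)"
      "s2 xAp 0 = ?ap + length d" "\<forall>k<length d. s2 aAe (?ap + k) = d ! k" using 2 c by auto
    have rv: "rev (map (s aPb) [0..<Suc c]) = u # rev (map (s aPb) [0..<c])" by (simp add: u_def)
    define s3 where "s3 = put (put (put s2 xC 0 c) xU 0 u) xX 0 (lb u)"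
    have frame: "\<forall>j. j \<notin> {xC, xU, xX, xAp, aMk, aAe} \<longrightarrow> s2 j = s j"
      and ae: "\<forall>i<?ap. s2 aAe i = s aAe i" and mk2: "\<forall>x. s2 aMk x < ?st + 2" 
      and b2: "b - 15 * int (s xC 0 - Suc c) \<le> b2" and is2: "is2 = is" using 2 c by auto
    \<comment> \<open>The loop invariant together with the decrease of the counter, as the
      postcondition of one iteration.\<close>
    define J where "J = (\<lambda>s' is' b'. is' = is \<and> s' xC 0 \<le> s xC 0 \<and>
      (\<forall>j. j \<notin> {xC, xU, xX, xAp, aMk, aAe} \<longrightarrow> s' j = s j) \<and>
      (\<exists>d. d @ dd (?mk s') (?f (rev (map (s aPb) [0..<s' xC 0]))) = dd (\<lambda>_. 0) (?f xs) \<and>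
        s' xAp 0 = ?ap + length d \<and> (\<forall>k<length d. s' aAe (?ap + k) = d ! k)) \<and>
      (\<forall>i<?ap. s' aAe i = s aAe i) \<and> (\<forall>x. s' aMk x < ?st + 2) \<and>
      b - 15 * int (s xC 0 - s' xC 0) \<le> b' \<and> s' xC 0 < Suc c)"
    have skip: "J s3 is2 b'"
      if "dd (?mk s2) (?f (rev (map (s aPb) [0..<Suc c]))) = dd (?mk s2) (?f (rev (map (s aPb) [0..<c])))"
        "b2 - 15 \<le> b'" for b'
      using that d frame ae mk2 b2 is2 cle unfolding s3_def J_def by (auto simp: of_nat_diff)
    have rec: "wp (append_event (k - 1)) J s3 is2 b'"
      if k: "k = (if kd u = 2 then 1 else 2)" and ku: "kd u \<noteq> 0" "kd u \<noteq> 3" and b': "b2 - 8 \<le> b'" for k b'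
    proof -
      have dd_take: "mk (lb u) < k \<Longrightarrow> dd mk (u # e) = u # dd (mk(lb u := k)) e"
        and dd_skip: "\<not> mk (lb u) < k \<Longrightarrow> dd mk (u # e) = dd mk e" for mk e
        using k by auto
      show ?thesis
      proof (cases "?mk s2 (lb u) < k")
        case True
        define s4 where "s4 = put (put (put s3 aMk (lb u) (?st + (k - 1))) aAe (s2 xAp 0) u)
          xAp 0 (Suc (s2 xAp 0))"
        have k1: "1 \<le> k" "k \<le> 2" using k by auto
        have m: "?mk s4 = (?mk s2)(lb u := k)" using k1 by (auto simp: s4_def s3_def fun_eq_iff)
        have "dd (?mk s2) (?f (rev (map (s aPb) [0..<Suc c]))) =
            u # dd (?mk s4) (?f (rev (map (s aPb) [0..<c])))"
          unfolding rv m using ku dd_take[of "?mk s2"] True by simp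
        then have "(d @ [u]) @ dd (?mk s4) (?f (rev (map (s aPb) [0..<c]))) = dd (\<lambda>_. 0) (?f xs)"
          using d(1) by simp
        moreover have "s4 xAp 0 = ?ap + length (d @ [u])" using d(2) by (simp add: s4_def)
        moreover have "\<forall>k<length (d @ [u]). s4 aAe (?ap + k) = (d @ [u]) ! k"
          using d(2,3) by (auto simp: s4_def s3_def nth_append less_Suc_eq)
        ultimately have ex: "\<exists>d. d @ dd (?mk s4) (?f (rev (map (s aPb) [0..<s4 xC 0]))) = dd (\<lambda>_. 0) (?f xs) \<and>
          s4 xAp 0 = ?ap + length d \<and> (\<forall>k<length d. s4 aAe (?ap + k) = d ! k)"
          by (intro exI[of _ "d @ [u]"]) (simp add: s4_def s3_def)
        have "s4 xC 0 = c" by (simp add: s4_def s3_def)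
        moreover have "\<forall>j. j \<notin> {xC, xU, xX, xAp, aMk, aAe} \<longrightarrow> s4 j = s j"
          using frame by (simp add: s4_def s3_def)
        moreover have "\<forall>i<?ap. s4 aAe i = s aAe i" using ae d(2) by (simp add: s4_def s3_def)
        moreover have "\<forall>x. s4 aMk x < ?st + 2" using mk2 k1 by (auto simp: s4_def s3_def)
        ultimately have "J s4 is2 (b' - 4)" using ex is2 b2 b' cle unfolding J_def by (auto simp: of_nat_diff)
        moreover have "s2 aMk (lb u) < ?st + (k - 1)" using True k1 by auto
        ultimately show ?thesis by (simp add: append_event_def s4_def s3_def same)
      next
        case False
        then have "dd (?mk s2) (?f (rev (map (s aPb) [0..<Suc c]))) = dd (?mk s2) (?f (rev (map (s aPb) [0..<c])))"
          unfolding rv using ku dd_skip[of "?mk s2"] by simp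
        then have "J s3 is2 (b' - 1)" using b' by (intro skip) auto
        moreover have "\<not> s2 aMk (lb u) < ?st + (k - 1)" using False k by auto
        ultimately show ?thesis by (simp add: append_event_def s3_def same)
      qed
    qed
    have "wp event J (put (put s2 xC 0 c) xU 0 u) is2 (b2 - 3)"
    proof (cases "kd u = 0 \<or> kd u = 3")
      case True
      then have "?f (rev (map (s aPb) [0..<Suc c])) = ?f (rev (map (s aPb) [0..<c]))"
        unfolding rv by auto
      then have "J s3 is2 b'" if "b2 - 15 \<le> b'" for b'
        by (intro skip that) (rule arg_cong)
      then show ?thesis using True by (auto simp: event_def same s3_def)
    next
      case False
      then consider "kd u = 1" | "kd u = 2" | "kd u = 4" using k4 by linarith
      then show ?thesis
      proof cases
        case 1
        then show ?thesis using rec[of 2 "b2 - 7"] by (simp add: event_def same s3_def)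
      next
        case 2
        then show ?thesis using rec[of 1 "b2 - 7"] by (simp add: event_def same s3_def)
      next
        case 3
        then show ?thesis using rec[of 2 "b2 - 7"] by (simp add: event_def same s3_def)
      qed
    qed
    then show ?case using c by (simp add: same u_def) (erule wp_mono, auto simp: J_def)
  next
    case (3 s2 is2 b2)
    then obtain d where d: "d = dd (\<lambda>_. 0) (?f xs)"
      "s2 xAp 0 = ?ap + length d" "\<forall>k<length d. s2 aAe (?ap + k) = d ! k" by auto
    have "R s2 is (b2 - 1)" by (rule cont[of d]) (use 3 d in auto)
    then show ?case using 3 by simp
  qed
qed

text \<open>The list with its closing 0 lies in the part of \<open>aAe\<close> already filled, so
  later appending cannot spoil it.\<close>

definition has :: "store \<Rightarrow> nat \<Rightarrow> nat \<Rightarrow> nat \<Rightarrow> bool" where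
  "has s v i a \<longleftrightarrow> (\<exists>e d. entry v a e (s aTt i) \<and> d = dd (\<lambda>_. 0) e \<and> s aLst i + length d < s xAp 0 \<and>
    (\<forall>k<length d. s aAe (s aLst i + k) = d ! k) \<and> s aAe (s aLst i + length d) = 0)"

lemma has_mono:
  assumes "has s v i a" "s' aTt i = s aTt i" "s' aLst i = s aLst i"
    "\<forall>k<s xAp 0. s' aAe k = s aAe k" "s xAp 0 \<le> s' xAp 0"
  shows "has s' v i a"
proof -
  obtain e d where e: "entry v a e (s aTt i)" "d = dd (\<lambda>_. 0) e" "s aLst i + length d < s xAp 0"
    "\<forall>k<length d. s aAe (s aLst i + k) = d ! k" "s aAe (s aLst i + length d) = 0"
    using assms(1) by (auto simp: has_def)
  then show ?thesis unfolding has_def using assms(2-)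
    by (intro exI[of _ e] exI[of _ d]) auto
qed

lemma set_tpath: "set (tpath P t) \<subseteq> {..<t}"
proof (induction t rule: less_induct)
  case (less t)
  show ?case
  proof (cases t)
    case (Suc j)
    have "set (tpath P (P j)) \<subseteq> {..<t}" if "P j < t"
      using less.IH[OF that] that by auto
    then show ?thesis using Suc by (subst tpath.simps) auto
  qed (subst tpath.simps, simp)
qed

lemma wp_row:
  assumes t: "tabs s" and v: "v \<in> insert 2 U" and T: "tree v (s aQ) (s aP) n"
    and tg: "tg_ok (s aTg) (s aQ) n" and last: "last_ok (s xLast 0) (s aQ) n"
    and a: "a = s xA 0" "a \<le> \<sigma>" and rp: "rp = s xRp 0"
    and mk: "\<forall>x. s aMk x < s xStamp 0 + 2"
    and cont: "\<And>s' b'. \<forall>j. j \<notin> {xT, xC, xU, xX, xStamp, xAp, aPb, aMk, aLst, aTt, aAe} \<longrightarrow> s' j = s j \<Longrightarrow>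
      \<forall>i. i \<noteq> rp + a \<longrightarrow> s' aTt i = s aTt i \<and> s' aLst i = s aLst i \<Longrightarrow>
      \<forall>i<s xAp 0. s' aAe i = s aAe i \<Longrightarrow> s xAp 0 \<le> s' xAp 0 \<Longrightarrow>
      \<forall>x. s' aMk x < s' xStamp 0 + 2 \<Longrightarrow> has s' v (rp + a) a \<Longrightarrow>
      b - 20 * int n - 30 \<le> b' \<Longrightarrow> R s' is b'"
  shows "wp row R s is b"
proof -
  have tab: "s aKd = kd" using t by (simp add: tabs_def)
  define tg0 where "tg0 = s aTg a"
  define t0 where "t0 = (if tg0 = 0 then s xLast 0 else tg0)"
  define tt where "tt = (if tg0 = 0 then 0 else s aQ (tg0 - 1))"
  have tgn: "tg0 \<noteq> 0 \<Longrightarrow> tg0 \<le> n \<and> kd (s aQ (tg0 - 1)) = 3 \<and> lb (s aQ (tg0 - 1)) = a"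
    using tg a(2) by (auto simp: tg_ok_def tg0_def)
  have ln: "s xLast 0 \<noteq> 0 \<Longrightarrow> s xLast 0 \<le> n \<and> 3 < kd (s aQ (s xLast 0 - 1))"
    using last by (auto simp: last_ok_def)
  have t0n: "t0 \<le> n" using tgn ln by (cases "s xLast 0 = 0") (auto simp: t0_def)
  have en: "entry v a (evs (s aQ) (s aP) t0) tt"
  proof -
    \<comment> \<open>In the table 0 means that there is no target, so a target that exists must be
      seen not to be 0.\<close>
    have "tt \<noteq> 0" if "tg0 \<noteq> 0"
    proof -
      have "s aQ (tg0 - 1) \<in> insert 1 U"
        by (rule tree_in_U[OF T v]) (use conjunct1[OF tgn[OF that]] that in linarith)
      then show ?thesis using that one_notin_U(3) unfolding tt_def by (metis insertE zero_neq_one)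
    qed
    moreover have "\<forall>j<n. \<not> (kd (s aQ j) = 3 \<and> lb (s aQ j) = a)" if "tg0 = 0"
      using tg that by (auto simp: tg_ok_def tg0_def)
    moreover have "\<forall>j<n. 3 < kd (s aQ j) \<longrightarrow> j < s xLast 0" using last by (simp add: last_ok_def)
    ultimately show ?thesis
      unfolding entry_def using T t0n tgn ln
      by (intro exI[of _ "s aQ"] exI[of _ "s aP"] exI[of _ n] exI[of _ t0])
        (auto simp: t0_def tt_def)
  qed
  define s1 where "s1 = put (put (put (put (put s xT 0 t0) aTt (rp + a) tt) aLst (rp + a) (s xAp 0))
    xStamp 0 (s xStamp 0 + 2)) xC 0 0"
  define ev where "ev = evs (s aQ) (s aP) t0"
  have P: "\<forall>j<n. s1 aP j \<le> j" using tree_P[OF T] by (auto simp: s1_def)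
  have main: "wp collect_path (wp (emit_events ;; Upd aAe (V xAp) (N 0) ;; incr xAp) R) s1 is b1"
    if "b - 8 \<le> b1" for b1
  proof (rule wp_collect_path[where s = s1 and n = n, OF P], goal_cases)
    case (3 s2 b2)
    note c = 3
    let ?xs = "map (s aQ) (tpath (s aP) t0)"
    have xs: "?xs = rev (map (s2 aPb) [0..<s2 xC 0])" using c(2) by (simp add: s1_def)
    have k4: "\<forall>u\<in>set ?xs. kd u \<le> 4"
    proof
      fix u assume "u \<in> set ?xs"
      then obtain j where "j < t0" "u = s aQ j" using set_tpath[of "s aP" t0] by auto
      then have "u \<in> insert 1 U" using tree_in_U[OF T v] t0n by simp
      then show "kd u \<le> 4" using U_facts(1) final by auto
    qed
    show ?case
      unfolding wp_Seq
    proof (rule wp_emit_events[OF _ _ xs k4], goal_cases)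
      case 1
      then show ?case using t c(1) by (simp add: tabs_def s1_def)
    next
      case 2
      then show ?case using mk c(1) by (simp add: s1_def)
    next
      case (3 s3 b3 d)
      note f = 3
      have d: "d = dd (\<lambda>_. 0) ev" using f(1) by (simp add: ev_def evs_def)
      let ?s = "put (put s3 aAe (s3 xAp 0) 0) xAp 0 (Suc (s3 xAp 0))"
      have same: "s3 aTt = s1 aTt" "s3 aLst = s1 aLst" "s3 xStamp = s1 xStamp"
        using f(2) c(1) by auto
      have ap: "s2 xAp 0 = s xAp 0" using c(1) by (simp add: s1_def)
      have ae: "s2 aAe = s aAe" using c(1) by (simp add: s1_def)
      have "has ?s v (rp + a) a"
        unfolding has_def
        by (intro exI[of _ ev] exI[of _ d])
          (use en d f(3,4) ap in \<open>auto simp: same s1_def ev_def\<close>)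
      moreover have "\<forall>j. j \<notin> {xT, xC, xU, xX, xStamp, xAp, aPb, aMk, aLst, aTt, aAe} \<longrightarrow> ?s j = s j"
        using f(2) c(1) by (simp add: s1_def)
      moreover have "\<forall>x. ?s aMk x < ?s xStamp 0 + 2"
        using f(6) c(1) by (simp add: same)
      moreover have "b - 20 * int n - 30 \<le> b3 - 2"
        using f(7) c(3,4) that by linarith
      ultimately have "R ?s is (b3 - 2)"
        using f(3,5) ap ae by (intro cont) (auto simp: same s1_def)
      then show ?case by simp
    qed
  qed (use t0n in \<open>auto simp: s1_def\<close>)
  show ?thesis
  proof (cases "tg0 = 0")
    case True
    have "s1 = put (put (put (put (put s aTt (rp + a) 0) xT 0 (s xLast 0)) aLst (rp + a) (s xAp 0))
      xStamp 0 (s xStamp 0 + 2)) xC 0 0"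
      using True unfolding s1_def t0_def tt_def by (simp add: fun_upd_twist[of xT aTt])
    then show ?thesis using True main[of "b - 7"]
      by (simp add: row_def flip: a(1) rp tg0_def)
  next
    case False
    have "s1 = put (put (put (put (put s xT 0 tg0) aTt (rp + a) tt) aLst (rp + a) (s xAp 0))
      xStamp 0 (s xStamp 0 + 2)) xC 0 0" using False by (simp add: s1_def t0_def)
    then show ?thesis using False main[of "b - 6"] main[of "b - 7"]
      by (simp add: row_def tt_def flip: a(1) rp tg0_def)
  qed
qed

end

lemma wp_Seq_fun: "wp (c ;; d) Q = wp c (wp d Q)"
  by (intro ext) simp

context graph
begin

text \<open>Only \<open>Lit\<close> and \<open>Ref\<close> create vertices of kind above 2. This
  gives the factor \<open>n\<close> of the time bound.\<close>

lemma card_states: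
  assumes "fra \<alpha> v k f"
  shows "card {u \<in> vs \<alpha> v f. 2 < kd u} \<le> occurrences \<alpha>"
  using assms
proof (induction \<alpha> arbitrary: v k f)
  case (Cat \<alpha> \<beta>)
  have "{u \<in> vs (Cat \<alpha> \<beta>) v f. 2 < kd u} =
      {u \<in> vs \<alpha> v (f + 1). 2 < kd u} \<union> {u \<in> vs \<beta> f (f + 1 + fr \<alpha>). 2 < kd u}"
    by (auto simp: vs_def)
  then show ?case
    using Cat.IH(1)[of v f "f + 1"] Cat.IH(2)[of f k "f + 1 + fr \<alpha>"] Cat.prems
      card_Un_le[of "{u \<in> vs \<alpha> v (f + 1). 2 < kd u}" "{u \<in> vs \<beta> f (f + 1 + fr \<alpha>). 2 < kd u}"]
    by simp
next
  case (Alt \<alpha> \<beta>)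
  have "{u \<in> vs (Alt \<alpha> \<beta>) v f. 2 < kd u} =
      {u \<in> vs \<alpha> f (f + 2). 2 < kd u} \<union> {u \<in> vs \<beta> (f + 1) (f + 2 + fr \<alpha>). 2 < kd u}"
    using Alt.prems by (auto simp: vs_def)
  then show ?case
    using Alt.IH(1)[of f k "f + 2"] Alt.IH(2)[of "f + 1" k "f + 2 + fr \<alpha>"] Alt.prems
      card_Un_le[of "{u \<in> vs \<alpha> f (f + 2). 2 < kd u}" "{u \<in> vs \<beta> (f + 1) (f + 2 + fr \<alpha>). 2 < kd u}"]
    by simp
next
  case (Plus \<alpha>)
  have "{u \<in> vs (Plus \<alpha>) v f. 2 < kd u} = {u \<in> vs \<alpha> v (f + 1). 2 < kd u}"
    using Plus.prems by (auto simp: vs_def Suc_le_eq le_less)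
  then show ?case using Plus.IH[of v f "f + 1"] Plus.prems by simp
next
  case (Bind x \<alpha>)
  have "{u \<in> vs (Bind x \<alpha>) v f. 2 < kd u} = {u \<in> vs \<alpha> f (f + 2). 2 < kd u}"
  proof (intro set_eqI iffI)
    fix u assume u: "u \<in> {u \<in> vs (Bind x \<alpha>) v f. 2 < kd u}"
    then have "u \<noteq> v" "u \<noteq> f + 1" using Bind.prems by auto
    then show "u \<in> {u \<in> vs \<alpha> f (f + 2). 2 < kd u}" using u by (auto simp: vs_def)
  qed (auto simp: vs_def)
  then show ?case using Bind.IH[of f "f + 1" "f + 2"] Bind.prems by simp
next
  case (Lit a v k f)
  have "{u \<in> vs (Lit a) v f. 2 < kd u} \<subseteq> {v}" by (auto simp: vs_def)
  from card_mono[OF _ this] show ?case by simp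
next
  case (Ref x v k f)
  have "{u \<in> vs (Ref x) v f. 2 < kd u} \<subseteq> {v}" by (auto simp: vs_def)
  from card_mono[OF _ this] show ?case by simp
qed (auto simp: vs_def)

end

context det_graph
begin

definition row_frame :: "store \<Rightarrow> store \<Rightarrow> bool" where
  "row_frame s s' \<longleftrightarrow>
    (\<forall>j. j \<notin> {xA, xT, xC, xU, xX, xStamp, xAp, aPb, aMk, aLst, aTt, aAe} \<longrightarrow> s' j = s j) \<and>
    (\<forall>i<s xRp 0. s' aTt i = s aTt i \<and> s' aLst i = s aLst i) \<and>
    (\<forall>i<s xAp 0. s' aAe i = s aAe i) \<and> s xAp 0 \<le> s' xAp 0"

lemma wp_rows:
  assumes t: "tabs s" and v: "v \<in> insert 2 U" and T: "tree v (s aQ) (s aP) n"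
    and tg: "tg_ok (s aTg) (s aQ) n" and last: "last_ok (s xLast 0) (s aQ) n"
    and mk: "\<forall>x. s aMk x < s xStamp 0 + 2"
    and cont: "\<And>s' b'. row_frame s s' \<Longrightarrow> \<forall>x. s' aMk x < s' xStamp 0 + 2 \<Longrightarrow>
      \<forall>a\<le>\<sigma>. has s' v (s xRp 0 + a) a \<Longrightarrow>
      b - (20 * int n + 35) * int (\<sigma> + 1) - 5 \<le> b' \<Longrightarrow> R s' is b'"
  shows "wp rows R s is b"
  unfolding rows_def wp_Seq wp_Asg
proof (rule wp_While[where I = "\<lambda>s' is' b'. is' = is \<and> row_frame s s' \<and> s' xA 0 \<le> \<sigma> + 1 \<and>
    (\<forall>x. s' aMk x < s' xStamp 0 + 2) \<and> (\<forall>a<s' xA 0. has s' v (s xRp 0 + a) a) \<and>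
    b - 1 - (20 * int n + 35) * int (s' xA 0) \<le> b'" and M = "\<lambda>s'. \<sigma> + 1 - s' xA 0"], goal_cases)
  case 1
  then show ?case using mk by (simp add: row_frame_def)
next
  case (2 s2 is2 b2)
  have sig: "s2 xSig 0 = \<sigma>" and fr: "row_frame s s2" using 2 t by (auto simp: row_frame_def tabs_def)
  have a: "s2 xA 0 \<le> \<sigma>" using 2 sig by simp
  have t2: "tabs s2" using fr t by (simp add: row_frame_def tabs_def)
  have same: "s2 aQ = s aQ" "s2 aP = s aP" "s2 aTg = s aTg" "s2 xLast = s xLast" "s2 xRp = s xRp"
    using fr by (auto simp: row_frame_def)
  show ?case unfolding wp_Seq
  proof (rule wp_row[where n = n, OF t2 v _ _ _ refl a refl], goal_cases)
    case (5 s3 b3)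
    note f = 5
    let ?s = "put s3 xA 0 (Suc (s3 xA 0))"
    have A: "s3 xA = s2 xA" using f(1) by simp
    have ap2: "s xAp 0 \<le> s2 xAp 0" using fr by (simp add: row_frame_def)
    have ae2: "\<forall>i<s xAp 0. s2 aAe i = s aAe i" using fr by (simp add: row_frame_def)
    have "row_frame s ?s"
      unfolding row_frame_def
    proof (intro conjI allI impI)
      fix j assume "j \<notin> {xA, xT, xC, xU, xX, xStamp, xAp, aPb, aMk, aLst, aTt, aAe}"
      then show "?s j = s j" using f(1) fr by (simp add: row_frame_def)
    next
      fix i assume i: "i < s xRp 0"
      then have "i \<noteq> s2 xRp 0 + s2 xA 0" using same by simp
      then show "?s aTt i = s aTt i" "?s aLst i = s aLst i"
        using f(2) fr i by (simp_all add: row_frame_def)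
    next
      fix i assume "i < s xAp 0"
      then show "?s aAe i = s aAe i" using f(3) ap2 ae2 by simp
    next
      show "s xAp 0 \<le> ?s xAp 0" using f(4) ap2 by simp
    qed
    moreover have "has ?s v (s xRp 0 + a) a" if "a < ?s xA 0" for a
    proof (cases "a = s2 xA 0")
      case True
      have "has s3 v (s xRp 0 + a) a" using f(6) True same by simp
      then show ?thesis by (rule has_mono) auto
    next
      case False
      then have "a < s2 xA 0" using that A by simp
      then have "has s2 v (s xRp 0 + a) a" using 2 by blast
      then show ?thesis by (rule has_mono) (use f False same in auto)
    qed
    moreover have "\<forall>x. ?s aMk x < ?s xStamp 0 + 2" using f(5) by simp
    moreover have "b - 1 - (20 * int n + 35) * int (?s xA 0) \<le> b3 - 1"
      using f(7) 2 A by (simp add: algebra_simps)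
    ultimately show ?case using a A 2 by simp
  qed (use 2 T tg last same in auto)
next
  case (3 s2 is2 b2)
  have sig: "s2 xSig 0 = \<sigma>" using 3 t by (auto simp: row_frame_def tabs_def)
  then have "s2 xA 0 = \<sigma> + 1" using 3 by simp
  then have "R s2 is (b2 - 1)" using 3 by (intro cont) auto
  then show ?case using 3 by simp
qed

text \<open>The inequality says that the row of \<open>v\<close> lies below the next free place, so
  the rows of later states do not overwrite it.\<close>

definition tables_done :: "store \<Rightarrow> nat \<Rightarrow> bool" where
  "tables_done s m \<longleftrightarrow> (\<forall>v. 2 \<le> v \<and> v < m \<and> 2 < kd v \<longrightarrow>
    s aRow v + \<sigma> < s xRp 0 \<and> (\<forall>a\<le>\<sigma>. has s v (s aRow v + a) a))"

lemma insert_2_U: "insert 2 U = {2..<4 + fr \<alpha>}"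
  by (auto simp: vs_def)

lemma card_states_before:
  "card {v. 2 \<le> v \<and> v < 4 + fr \<alpha> \<and> 2 < kd v} \<le> occurrences \<alpha> + 1"
proof -
  have "{v. 2 \<le> v \<and> v < 4 + fr \<alpha> \<and> 2 < kd v} \<subseteq> insert 2 {u \<in> U. 2 < kd u}"
    by (auto simp: vs_def)
  then have "card {v. 2 \<le> v \<and> v < 4 + fr \<alpha> \<and> 2 < kd v} \<le> card (insert 2 {u \<in> U. 2 < kd u})"
    by (intro card_mono) (auto simp: vs_def)
  also have "\<dots> \<le> Suc (card {u \<in> U. 2 < kd u})" by (rule card_insert_le_m1) simp_all
  also have "\<dots> \<le> occurrences \<alpha> + 1" using card_states[OF frag] by simp
  finally show ?thesis .
qed

text \<open>The search and the rows of one state together; the dominant product has a factor linear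
  in the length of the regex and one linear in the alphabet.\<close>

definition state_cost :: int where
  "state_cost = 3 * int \<sigma> + 82 * int (fr \<alpha> + 2) + (20 * int (fr \<alpha> + 2) + 35) * int (\<sigma> + 1) + 60"

lemma wp_tables:
  assumes t: "tabs s" and init: "s xFr 0 = 4 + fr \<alpha>" "s xSt 0 = 2" "\<forall>y. s aVis y < 2"
    and mk: "\<forall>x. s aMk x < s xStamp 0 + 2"
    and cont: "\<And>s' b'. \<forall>j. j < 14 \<or> 37 < j \<longrightarrow> s' j = s j \<Longrightarrow> tables_done s' (4 + fr \<alpha>) \<Longrightarrow>
      b - state_cost * int (occurrences \<alpha> + 1) - 5 * int (fr \<alpha> + 2) - 1 \<le> b' \<Longrightarrow> R s' is b'"
  shows "wp tables R s is b"
  unfolding tables_def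
proof -
  let ?S = "\<lambda>m. {v. 2 \<le> v \<and> v < m \<and> 2 < kd v}"
  have fin: "finite (?S m)" for m by (rule finite_subset[of _ "{..<m}"]) auto
  have sc0: "0 \<le> state_cost" by (simp add: state_cost_def)
  show "wp (While (Mi (V xFr) (V xSt)) state_body) R s is b"
  \<comment> \<open>Vertices with tables and the mere passing of a vertex are charged separately;
    otherwise \<open>state_cost\<close> would be multiplied by the size of the graph instead of
    \<open>n + 1\<close>.\<close>
  proof (rule wp_While[where I = "\<lambda>s' is' b'. is' = is \<and> (\<forall>j. j < 14 \<or> 37 < j \<longrightarrow> s' j = s j) \<and>
      2 \<le> s' xSt 0 \<and> s' xSt 0 \<le> 4 + fr \<alpha> \<and> (\<forall>y. s' aVis y < s' xSt 0) \<and>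
      (\<forall>x. s' aMk x < s' xStamp 0 + 2) \<and> tables_done s' (s' xSt 0) \<and>
      b - state_cost * int (card (?S (s' xSt 0))) - 5 * int (s' xSt 0 - 2) \<le> b'"
      and M = "\<lambda>s'. 4 + fr \<alpha> - s' xSt 0"], goal_cases)
    case 1
    then show ?case using init mk sc0 by (auto simp: tables_done_def intro!: mult_nonneg_nonneg)
  next
    case (2 s2 is2 b2)
    let ?v = "s2 xSt 0"
    have fr: "s2 xFr 0 = 4 + fr \<alpha>" using 2 init by simp
    then have v: "2 \<le> ?v" "?v < 4 + fr \<alpha>" "?v \<in> insert 2 U" using 2 by (auto simp: insert_2_U)
    have t2: "tabs s2" using 2 t by (simp add: tabs_def)
    then have kds: "s2 aKd = kd" by (simp add: tabs_def)
    have S_Suc: "?S (Suc ?v) = (if 2 < kd ?v then insert ?v (?S ?v) else ?S ?v)"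
      using v(1) by (auto simp: less_Suc_eq)
    have card_Suc: "card (?S (Suc ?v)) = (if 2 < kd ?v then card (?S ?v) + 1 else card (?S ?v))"
      unfolding S_Suc using fin[of ?v] by simp
    show ?case
    proof (cases "2 < kd ?v")
      case False
      have "tables_done s2 (Suc ?v)"
        using 2 False unfolding tables_done_def by (auto simp: less_Suc_eq)
      then have "tables_done (put s2 xSt 0 (Suc ?v)) (Suc ?v)"
        by (auto simp: tables_done_def has_def)
      then show ?thesis
        using 2 False v card_Suc fr
        by (auto simp: state_body_def kds less_Suc_eq of_nat_diff split: if_splits)
    next
      case True
      have "wp explore (wp (Upd aRow (V xSt) (V xRp)) (wp rows (wp (Asg xRp (Pl (V xRp) (Pl (V xSig) (N 1)))) (wp (incr xSt)
        (\<lambda>s' is' b'. (is' = is \<and> (\<forall>j. j < 14 \<or> 37 < j \<longrightarrow> s' j = s j) \<and>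
      2 \<le> s' xSt 0 \<and> s' xSt 0 \<le> 4 + fr \<alpha> \<and> (\<forall>y. s' aVis y < s' xSt 0) \<and>
      (\<forall>x. s' aMk x < s' xStamp 0 + 2) \<and> tables_done s' (s' xSt 0) \<and>
      b - state_cost * int (card (?S (s' xSt 0))) - 5 * int (s' xSt 0 - 2) \<le> b') \<and>
      4 + fr \<alpha> - s' xSt 0 < 4 + fr \<alpha> - s2 xSt 0))))) s2 is (b2 - 2)"
      proof (rule wp_explore[OF t2 v(3)], goal_cases)
        case 1
        \<comment> \<open>All stamps stem from smaller states, so at the start of the search no
          vertex counts as visited.\<close>
        then show ?case using 2 less_irrefl by metis
      next
        case (2 s3 b3)
        note e = 2
        define s4 where "s4 = put s3 aRow ?v (s2 xRp 0)"
        have x3: "s3 j = s2 j" if "j \<notin> {xH, xRh, xTail, xU, xIdx, xLast, xA, aVis, aQ, aP, aTg}" for j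
          using e(1) that by (simp add: ex_frame_def)
        have vis3: "\<forall>y. s3 aVis y < Suc ?v"
          using e(1) \<open>is2 = is \<and> _\<close> unfolding ex_frame_def by (metis less_Suc_eq)
        have t4: "tabs s4" using t2 x3 by (simp add: tabs_def s4_def)
        have "wp rows (wp (Asg xRp (Pl (V xRp) (Pl (V xSig) (N 1)))) (wp (incr xSt)
          (\<lambda>s' is' b'. (is' = is \<and> (\<forall>j. j < 14 \<or> 37 < j \<longrightarrow> s' j = s j) \<and>
          2 \<le> s' xSt 0 \<and> s' xSt 0 \<le> 4 + fr \<alpha> \<and> (\<forall>y. s' aVis y < s' xSt 0) \<and>
          (\<forall>x. s' aMk x < s' xStamp 0 + 2) \<and> tables_done s' (s' xSt 0) \<and>
          b - state_cost * int (card (?S (s' xSt 0))) - 5 * int (s' xSt 0 - 2) \<le> b') \<and>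
          4 + fr \<alpha> - s' xSt 0 < 4 + fr \<alpha> - s2 xSt 0))) s4 is (b3 - 1)"
        proof (rule wp_rows[where n = "s3 xTail 0", OF t4 v(3)], goal_cases)
          case (5 s5 b5)
          note r = 5
          let ?s = "put (put s5 xRp 0 (s2 xRp 0 + (\<sigma> + 1))) xSt 0 (Suc ?v)"
          have x5: "s5 j = s4 j" if "j \<notin> {xA, xT, xC, xU, xX, xStamp, xAp, aPb, aMk, aLst, aTt, aAe}" for j
            using r(1) that by (simp add: row_frame_def)
          have rp: "s4 xRp 0 = s2 xRp 0" "s5 xRp 0 = s2 xRp 0" "s5 xSt 0 = ?v" "s5 xSig 0 = \<sigma>"
            "s5 aRow = s4 aRow" "s5 aVis = s3 aVis" "s2 aRow = s3 aRow"
            "s3 xRp 0 = s2 xRp 0"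
            using x5 x3 t4 by (auto simp: s4_def tabs_def)
          have ap: "s4 xAp 0 = s2 xAp 0" "s4 aAe = s2 aAe" "s4 aTt = s2 aTt" "s4 aLst = s2 aLst"
            using x3 by (auto simp: s4_def)
          have hs: "has ?s v' i a" if "has s5 v' i a" for v' i a
            using that by (rule has_mono) auto
          have "tables_done ?s (Suc ?v)"
            unfolding tables_done_def
          proof (intro allI impI)
            fix v' assume v': "2 \<le> v' \<and> v' < Suc ?v \<and> 2 < kd v'"
            show "?s aRow v' + \<sigma> < ?s xRp 0 \<and> (\<forall>a\<le>\<sigma>. has ?s v' (?s aRow v' + a) a)"
            proof (cases "v' = ?v")
              case True
              then show ?thesis using r(3) hs by (auto simp: rp s4_def)
            next
              case False
              then have d: "s2 aRow v' + \<sigma> < s2 xRp 0" "\<forall>a\<le>\<sigma>. has s2 v' (s2 aRow v' + a) a"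
                using v' \<open>is2 = is \<and> _\<close> unfolding tables_done_def by auto
              have row: "?s aRow v' = s2 aRow v'" using False by (simp add: rp s4_def)
              have "has s5 v' (s2 aRow v' + a) a" if a: "a \<le> \<sigma>" for a
              proof (rule has_mono)
                show "has s2 v' (s2 aRow v' + a) a" using d(2) a by blast
                have "s2 aRow v' + a < s4 xRp 0" using d(1) a rp by simp
                then show "s5 aTt (s2 aRow v' + a) = s2 aTt (s2 aRow v' + a)"
                  "s5 aLst (s2 aRow v' + a) = s2 aLst (s2 aRow v' + a)"
                  using r(1) ap by (auto simp: row_frame_def)
                show "\<forall>k<s2 xAp 0. s5 aAe k = s2 aAe k" "s2 xAp 0 \<le> s5 xAp 0"
                  using r(1) ap by (auto simp: row_frame_def)
              qed
              then show ?thesis unfolding row using d(1) hs by auto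
            qed
          qed
          moreover have "\<forall>j. j < 14 \<or> 37 < j \<longrightarrow> ?s j = s j"
          proof (intro allI impI)
            fix j :: nat assume j: "j < 14 \<or> 37 < j"
            then have "s5 j = s4 j" "s3 j = s2 j" "s2 j = s j" "j \<noteq> aRow" "j \<noteq> xRp" "j \<noteq> xSt"
              using x5 x3 \<open>is2 = is \<and> _\<close> by auto
            then show "?s j = s j" by (simp add: s4_def)
          qed
          moreover have "b - state_cost * int (card (?S (Suc ?v))) - 5 * int (Suc ?v - 2) \<le> b5 - 2"
          proof -
            have "(20 * int (s3 xTail 0) + 35) * int (\<sigma> + 1) \<le> (20 * int (fr \<alpha> + 2) + 35) * int (\<sigma> + 1)"
              using e(5) by (intro mult_right_mono) auto
            moreover have "state_cost * int (card (?S (Suc ?v))) = state_cost * int (card (?S ?v)) + state_cost"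
              using True card_Suc by (simp add: algebra_simps)
            moreover have "int (Suc ?v - 2) = int (?v - 2) + 1" using v(1) by simp
            moreover have "b - state_cost * int (card (?S ?v)) - 5 * int (?v - 2) \<le> b2"
              using \<open>is2 = is \<and> _\<close> by blast
            moreover have "state_cost = 3 * int \<sigma> + 82 * int (fr \<alpha> + 2) +
              (20 * int (fr \<alpha> + 2) + 35) * int (\<sigma> + 1) + 60" by (rule state_cost_def)
            ultimately show ?thesis using r(4) e(6) by linarith
          qed
          ultimately show ?case
            using v r(2) vis3 t by (auto simp: rp tabs_def)
        qed (use e x3 \<open>is2 = is \<and> _\<close> in \<open>auto simp: s4_def\<close>)
        then show ?case using x3 by (simp add: s4_def)
      qed
      then show ?thesis using 2 True by (simp add: state_body_def kds wp_Seq_fun)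
    qed
  next
    case (3 s2 is2 b2)
    have "s2 xFr 0 = 4 + fr \<alpha>" using 3 init by simp
    then have st: "s2 xSt 0 = 4 + fr \<alpha>" using 3 by simp
    have "state_cost * int (card (?S (4 + fr \<alpha>))) \<le> state_cost * int (occurrences \<alpha> + 1)"
      using card_states_before sc0 by (intro mult_left_mono) auto
    then have "R s2 is (b2 - 1)" using 3 st by (intro cont) auto
    then show ?case using 3 by simp
  qed
qed

end

section \<open>Matching\<close>

abbreviation (input) "xLen \<equiv> (38::nat)"
abbreviation (input) "xI \<equiv> (39::nat)"
abbreviation (input) "xB \<equiv> (40::nat)"
abbreviation (input) "xPtr \<equiv> (41::nat)"
abbreviation (input) "xGo \<equiv> (42::nat)"
abbreviation (input) "xRes \<equiv> (43::nat)"
abbreviation (input) "aS \<equiv> (44::nat)"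
abbreviation (input) "aE \<equiv> (45::nat)"
abbreviation (input) "aW \<equiv> (46::nat)"
abbreviation (input) "xJ \<equiv> (47::nat)"
abbreviation (input) "xEnd \<equiv> (48::nat)"

definition neq :: "aexp \<Rightarrow> aexp \<Rightarrow> aexp" where
  "neq d e = Pl (Mi d e) (Mi e d)"

lemma aval_neq: "aval (neq d e) s = 0 \<longleftrightarrow> aval d s = aval e s"
  by (auto simp: neq_def)

definition next_event :: com where
  "next_event = incr xPtr ;; Asg xU (Ar aAe (V xPtr))"

text \<open>The machine form of \<open>run\<close>: a blocked variable is kept in \<open>xB\<close>,
  and setting \<open>xU\<close> to 0 leaves the loop.\<close>

definition scan :: com where
  "scan = While (V xU)
    (Asg xX (Ar aLb (V xU)) ;;
     Ite (Mi (Ar aKd (V xU)) (N 2))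
       (Ite (neq (Ar aS (V xX)) (Ar aE (V xX)))
         (Asg xB (V xU) ;; Asg xU (N 0))
         (Upd aS (V xX) (V xI) ;; Upd aE (V xX) (V xI) ;; next_event))
       (Ite (Mi (Ar aKd (V xU)) (N 1)) Skip (Upd aS (V xX) (V xI)) ;;
        Upd aE (V xX) (V xI) ;; next_event))"

text \<open>The end of the input needs no test of its own: the sentinel \<sigma> behind the word
  differs from every letter of the factor. A mismatch sets \<open>xEnd\<close> to 0 to leave the
  loop.\<close>

definition compare :: com where
  "compare = While (Mi (V xEnd) (V xJ))
    (Ite (neq (Ar aW (V xJ)) (Ar aW (V xI)))
      (Asg xGo (N 0) ;; Asg xEnd (N 0))
      (incr xI ;; incr xJ))"

text \<open>The lookup is the same at the end of the word, where the sentinel is the letter. There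
  \<open>xRes\<close> receives the target, which is 0 if the exit cannot be reached, and it stays 0
  if a variable is blocked.\<close>

definition match_body :: com where
  "match_body =
    Asg xA (Ar aW (V xI)) ;; Asg xT (Pl (Ar aRow (V xSt)) (V xA)) ;;
    Asg xPtr (Ar aLst (V xT)) ;; Asg xB (N 0) ;; Asg xU (Ar aAe (V xPtr)) ;; scan ;;
    Asg xT (Ar aTt (V xT)) ;;
    Ite (Mi (V xLen) (V xI))
      (Ite (V xB)
        (Asg xX (Ar aLb (V xB)) ;; Asg xJ (Ar aS (V xX)) ;; Asg xEnd (Ar aE (V xX)) ;;
         Asg xSt (V xB) ;; compare)
        (Ite (V xT) (Asg xSt (V xT) ;; incr xI) (Asg xGo (N 0))))
      (Asg xGo (N 0) ;; Ite (V xB) Skip (Asg xRes (V xT)))"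

definition match_word :: com where
  "match_word = While (V xGo) match_body"

definition read_word :: com where
  "read_word = Inp xLen ;; Asg xI (N 0) ;;
    While (Mi (V xLen) (V xI)) (Inp xB ;; Upd aW (V xI) (V xB) ;; incr xI) ;;
    Upd aW (V xLen) (V xSig)"

text \<open>The vertices 1, 2 and 3 are exit, start and entry; fresh ones begin at 4. The last token
  is 0 only for \<open>Empty\<close>, where nothing further is done and \<open>xRes\<close> keeps
  its initial 0.\<close>

definition recognizer :: com where
  "recognizer =
    Inp xSig ;;
    Upd aKd (N 1) (N 3) ;; Upd aLb (N 1) (V xSig) ;; Upd aKd (N 2) (N 3) ;; Upd aNx (N 2) (N 3) ;;
    Upd aSV (N 0) (N 3) ;; Upd aSK (N 0) (N 1) ;; Asg xSp (N 1) ;; Asg xFr (N 4) ;;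
    parse_loop ;;
    Ite (V xTok)
      (Asg xSt (N 2) ;; tables ;; read_word ;;
       Asg xSt (N 2) ;; Asg xI (N 0) ;; Asg xGo (N 1) ;; match_word)
      Skip"

lemma wp_read_word:
  assumes cont: "\<And>s' b'. \<forall>j. j \<notin> {xLen, xI, xB, aW} \<longrightarrow> s' j = s j \<Longrightarrow> s' xLen 0 = length w \<Longrightarrow>
      \<forall>k<length w. s' aW k = w ! k \<Longrightarrow> s' aW (length w) = s xSig 0 \<Longrightarrow>
      b - 4 * int (length w) - 4 \<le> b' \<Longrightarrow> R s' [] b'"
  shows "wp read_word R s (length w # w) b"
  unfolding read_word_def wp_Seq wp_Inp wp_Asg
proof (rule wp_While[where I = "\<lambda>s' is' b'. s' xI 0 \<le> length w \<and> is' = drop (s' xI 0) w \<and>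
    s' xLen 0 = length w \<and> (\<forall>k<s' xI 0. s' aW k = w ! k) \<and>
    (\<forall>j. j \<notin> {xLen, xI, xB, aW} \<longrightarrow> s' j = s j) \<and> b - 2 - 4 * int (s' xI 0) \<le> b'"
    and M = "\<lambda>s'. length w - s' xI 0"], goal_cases)
  case 1
  then show ?case by simp
next
  case (2 s2 is2 b2)
  then have i: "s2 xI 0 < length w" by simp
  then have "drop (s2 xI 0) w = w ! s2 xI 0 # drop (Suc (s2 xI 0)) w" by (simp add: Cons_nth_drop_Suc)
  then show ?case using 2 i by (auto simp: less_Suc_eq)
next
  case (3 s2 is2 b2)
  then have "s2 xI 0 = length w" by simp
  then show ?case using 3 by (auto intro!: cont)
qed

text \<open>Comparing letters is charged to the advance of \<open>xI\<close>. Since this position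
  never moves back, all comparisons together take time linear in the word.\<close>

lemma wp_compare:
  assumes "s xEnd 0 \<le> length w" "s xI 0 \<le> length w" "d = s xEnd 0 - s xJ 0"
    and w: "\<forall>k<length w. s aW k = w ! k \<and> w ! k < s aW (length w)"
    and "s xGo 0 = 1"
    and cont: "\<And>s' b'. \<forall>j. j \<notin> {xI, xJ, xEnd, xGo} \<longrightarrow> s' j = s j \<Longrightarrow>
      s xI 0 \<le> s' xI 0 \<Longrightarrow> s' xI 0 \<le> length w \<Longrightarrow>
      if take d (drop (s xI 0) w) = take d (drop (s xJ 0) w)
      then s' xGo 0 = 1 \<and> s' xI 0 = s xI 0 + d else s' xGo 0 = 0 \<Longrightarrow>
      b - 4 * int (s' xI 0 - s xI 0) - 6 \<le> b' \<Longrightarrow> R s' is b'"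
  shows "wp compare R s is b"
  using assms
proof (induction d arbitrary: s b)
  case 0
  show ?case unfolding compare_def
    by (rule wp_While_done) (use 0 in auto)
next
  case (Suc d)
  let ?i = "s xI 0" and ?j = "s xJ 0"
  have j: "?j < s xEnd 0" "?j < length w" "d = s xEnd 0 - Suc ?j" using Suc.prems by auto
  have cond: "aval (Mi (V xEnd) (V xJ)) s \<noteq> 0" using j by simp
  have tj: "take (Suc d) (drop ?j w) = w ! ?j # take d (drop (Suc ?j) w)"
    using j(2) by (metis Cons_nth_drop_Suc take_Suc_Cons)
  \<comment> \<open>At the end of the word the sentinel exceeds all letters, so equality shows that
    the word goes on.\<close>
  have i: "?i < length w \<and> w ! ?i = w ! ?j" if "s aW ?j = s aW ?i"
  proof -
    have "?i \<noteq> length w" using that Suc.prems(4) j(2) by auto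
    then show ?thesis using that Suc.prems(2,4) j(2) by auto
  qed
  show ?case
  proof (cases "s aW ?j = s aW ?i")
    case True
    let ?s = "put (put s xI 0 (Suc ?i)) xJ 0 (Suc ?j)"
    have ti: "take (Suc d) (drop ?i w) = w ! ?j # take d (drop (Suc ?i) w)"
      using i[OF True] by (metis Cons_nth_drop_Suc take_Suc_Cons)
    have eqv: "take (Suc d) (drop ?i w) = take (Suc d) (drop ?j w) \<longleftrightarrow>
        take d (drop (Suc ?i) w) = take d (drop (Suc ?j) w)"
      unfolding ti tj by simp
    have "wp compare R ?s is (b - 4)"
    proof (rule Suc.IH, goal_cases)
      case (6 s' b')
      show ?case
      proof (rule Suc.prems(6), goal_cases)
        case 4
        show ?case unfolding eqv using 6(4) by simp
      qed (use 6 in auto)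
    qed (use Suc.prems(1-5) j i[OF True] in auto)
    then show ?thesis
      unfolding compare_def using cond True
      by (intro wp_While_step) (simp_all add: neq_def)
  next
    case False
    let ?s = "put (put s xGo 0 0) xEnd 0 0"
    have ne: "take (Suc d) (drop ?i w) \<noteq> take (Suc d) (drop ?j w)"
    proof (cases "?i < length w")
      case True
      then have "take (Suc d) (drop ?i w) = w ! ?i # take d (drop (Suc ?i) w)"
        by (metis Cons_nth_drop_Suc take_Suc_Cons)
      then show ?thesis using False True Suc.prems(4) j(2) tj by auto
    qed (use tj in auto)
    have "R ?s is (b - 5)" by (rule Suc.prems(6)) (use ne Suc.prems(2) in auto)
    then have "wp compare R ?s is (b - 4)" unfolding compare_def by (intro wp_While_done) auto
    moreover have "aval (neq (Ar aW (V xJ)) (Ar aW (V xI))) s \<noteq> 0" using False by (simp add: aval_neq)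
    ultimately show ?thesis
      unfolding compare_def using cond
      by (intro wp_While_step) (simp_all del: aval.simps(2-5))
  qed
qed

context det_graph
begin

lemma wp_scan:
  assumes "s aKd = kd" "s aLb = lb" "i = s xI 0" "s xB 0 = 0" "s xU 0 = s aAe p" "s xPtr 0 = p"
    and "\<forall>k<length d. s aAe (p + k) = d ! k" "s aAe (p + length d) = 0"
    and "\<forall>u\<in>set d. u \<noteq> 0 \<and> (kd u = 1 \<or> kd u = 2 \<or> kd u = 4)"
    and "run i d (s aS, s aE) = (x, M')"
    and cont: "\<And>s' b'. \<forall>j. j \<notin> {xX, xU, xPtr, xB, aS, aE} \<longrightarrow> s' j = s j \<Longrightarrow> s' xB 0 = x \<Longrightarrow>
      (s' aS, s' aE) = M' \<Longrightarrow> b - 10 * int (length d) - 8 \<le> b' \<Longrightarrow> R s' is b'"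
  shows "wp scan R s is b"
  using assms
proof (induction d arbitrary: s b p)
  case Nil
  show ?case unfolding scan_def
    by (rule wp_While_done) (use Nil in auto)
next
  case (Cons u d)
  have u: "s xU 0 = u" "u \<noteq> 0" "kd u = 1 \<or> kd u = 2 \<or> kd u = 4"
    using Cons.prems(5,7,9) by force+
  have nxt: "\<forall>k<length d. s aAe (Suc p + k) = d ! k" "s aAe (Suc p + length d) = 0"
    using Cons.prems(7,8) by force+
  have cond: "aval (V xU) s \<noteq> 0" using u by simp
  have go: "wp scan R s1 is b1"
    if "s1 = put (put (put (put (put s xX 0 (lb u)) aS (lb u) S1) aE (lb u) i) xPtr 0 (Suc p))
        xU 0 (s aAe (Suc p))" "\<not> blocked u (s aS, s aE)"
      "S1 = (if kd u = 2 then s aS (lb u) else i)" "b - 10 \<le> b1" for s1 b1 S1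
  proof (rule Cons.IH[of s1 "Suc p"], goal_cases)
    case 10
    have "(s1 aS, s1 aE) = vstep i u (s aS, s aE)" using that(1,3) by auto
    moreover have "run i d (vstep i u (s aS, s aE)) = (x, M')" using Cons.prems(10) that(2) by simp
    ultimately have "run i d (s1 aS, s1 aE) = (x, M')" by metis
    then show ?case .
  next
    case (11 s' b')
    then show ?case using that(1,4) by (intro Cons.prems(11)) auto
  qed (use that Cons.prems(1-9) nxt in auto)
  consider "blocked u (s aS, s aE)" | "kd u = 4" "\<not> blocked u (s aS, s aE)" | "kd u = 1" | "kd u = 2"
    using u(3) by blast
  then show ?case
  proof cases
    case 1
    then have k4: "kd u = 4" and ne: "s aS (lb u) \<noteq> s aE (lb u)" using u(3) by (auto simp: blocked_def)
    let ?s = "put (put (put s xX 0 (lb u)) xB 0 u) xU 0 0"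
    have "x = u" "M' = (s aS, s aE)" using 1 Cons.prems(10) by auto
    then have "R ?s is (b - 7)" by (intro Cons.prems(11)) auto
    then have "wp scan R ?s is (b - 6)" unfolding scan_def by (intro wp_While_done) auto
    moreover have "s aS (lb u) - s aE (lb u) + (s aE (lb u) - s aS (lb u)) \<noteq> 0" using ne by linarith
    ultimately show ?thesis
      unfolding scan_def using k4 u Cons.prems(1,2)
      by (intro wp_While_step) (auto simp: neq_def)
  next
    case 2
    then have eq: "s aS (lb u) = s aE (lb u)" by (auto simp: blocked_def)
    show ?thesis
      unfolding scan_def
      by (rule wp_While_step[OF cond], fold scan_def)
        (use 2 u Cons.prems(1-6) eq in \<open>simp add: neq_def next_event_def, intro go, auto\<close>)
  next
    case 3
    then have nb: "\<not> blocked u (s aS, s aE)" by (simp add: blocked_def)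
    show ?thesis
      unfolding scan_def
      by (rule wp_While_step[OF cond], fold scan_def)
        (use 3 u nb Cons.prems(1-6) in \<open>simp add: next_event_def, intro go, auto\<close>)
  next
    case 4
    then have nb: "\<not> blocked u (s aS, s aE)" by (simp add: blocked_def)
    show ?thesis
      unfolding scan_def
      by (rule wp_While_step[OF cond], fold scan_def)
        (use 4 u nb Cons.prems(1-6) in \<open>simp add: next_event_def, intro go, auto simp: fun_eq_iff\<close>)
  qed
qed

lemma set_dd: "set (dd mk e) \<subseteq> set e"
  by (induction e arbitrary: mk) (auto split: if_splits)

text \<open>Ten units for each event, of which \<open>dd\<close> keeps at most two per variable,
  plus a constant.\<close>

definition step_cost :: int where
  "step_cost = 60 + 20 * int (card (vars \<alpha>))"

text \<open>A step that consumes \<open>n\<close> letters costs a fixed amount plus 4 per letter; as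
  \<open>n\<close> is positive, it can be charged as \<open>step_cost\<close> per letter.\<close>

lemma step_cost_mult: "1 \<le> n \<Longrightarrow> step_cost - 4 + 4 * n \<le> step_cost * n"
  using mult_nonneg_nonneg[of "step_cost - 4" "n - 1"] by (simp add: step_cost_def algebra_simps)

definition word_in :: "store \<Rightarrow> nat list \<Rightarrow> bool" where
  "word_in s w \<longleftrightarrow> s xLen 0 = length w \<and> (\<forall>k<length w. s aW k = w ! k) \<and> s aW (length w) = \<sigma>"

definition match_frame :: "store \<Rightarrow> store \<Rightarrow> bool" where
  "match_frame s s' \<longleftrightarrow> (\<forall>j. j \<notin> {xSt, xU, xA, xT, xX, xI, xB, xPtr, xGo, xRes, aS, aE, xJ, xEnd} \<longrightarrow> s' j = s j)"

text \<open>A successful step consumes at least one letter, because a blocked variable is nonempty,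
  and is paid for by the letters consumed. A failing comparison is paid for by the letters that
  remain.\<close>

lemma wp_match_body:
  assumes t: "tabs s" and w: "set w \<subseteq> {..<\<sigma>}" and wi: "word_in s w" and td: "tables_done s (4 + fr \<alpha>)"
    and c: "conf w r (s xSt 0) (s xI 0) (s aS, s aE)" and k: "2 < kd (s xSt 0)"
    and go: "s xGo 0 = 1" "s xRes 0 = 0"
    and cont: "\<And>s' b'. match_frame s s' \<Longrightarrow>
      s' xGo 0 = 1 \<and> s' xRes 0 = 0 \<and> (\<exists>r. conf w r (s' xSt 0) (s' xI 0) (s' aS, s' aE)) \<and>
        2 < kd (s' xSt 0) \<and> s xI 0 < s' xI 0 \<and> b - step_cost * int (s' xI 0 - s xI 0) \<le> b' \<or>
      s' xGo 0 = 0 \<and> (s' xRes 0 \<noteq> 0 \<longleftrightarrow> w \<in> language \<alpha>) \<and>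
        b - step_cost * (int (length w - s xI 0) + 1) \<le> b' \<Longrightarrow> R s' is b'"
  shows "wp match_body R s is b"
proof -
  let ?v = "s xSt 0" and ?i = "s xI 0"
  have tt: "s aKd = kd" "s aLb = lb" using t by (auto simp: tabs_def)
  have v: "?v \<in> insert 2 U" and i: "?i \<le> length w" using c by (auto simp: conf_def)
  have W: "s xLen 0 = length w" "\<forall>k<length w. s aW k = w ! k \<and> w ! k < \<sigma>" "s aW (length w) = \<sigma>"
    using wi w nth_mem by (fastforce simp: word_in_def)+
  define a where "a = s aW ?i"
  have a: "a \<le> \<sigma>" "?i < length w \<Longrightarrow> a = w ! ?i" "?i = length w \<Longrightarrow> a = \<sigma>"
    using W i by (auto simp: a_def le_less)
  define q where "q = s aRow ?v + a"
  have "has s ?v q a" using td k v a(1) by (auto simp: tables_done_def q_def insert_2_U)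
  then obtain e d where e: "entry ?v a e (s aTt q)" "d = dd (\<lambda>_. 0) e"
    "\<forall>k<length d. s aAe (s aLst q + k) = d ! k" "s aAe (s aLst q + length d) = 0"
    by (auto simp: has_def)
  obtain b0 M' where run: "run ?i d (s aS, s aE) = (b0, M')" by (metis surj_pair)
  obtain y where y: "r @ e @ y \<in> L" and ke: "\<forall>u\<in>set e. kd u \<noteq> 3 \<and> kd u \<noteq> 0" "0 \<notin> set e"
    by (rule entry_run[OF c e(1) run[unfolded e(2)]])
  have eU: "set e \<subseteq> U" using set_L_U[OF y] by auto
  have kd: "\<forall>u\<in>set d. u \<noteq> 0 \<and> (kd u = 1 \<or> kd u = 2 \<or> kd u = 4)"
  proof
    fix u assume "u \<in> set d"
    then have "u \<in> set e" using set_dd e(2) by blast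
    then have "kd u \<le> 4" "kd u \<noteq> 3" "kd u \<noteq> 0" using ke eU U_facts(1) by auto
    moreover have "u \<noteq> 0" using \<open>u \<in> set e\<close> ke(2) by metis
    ultimately show "u \<noteq> 0 \<and> (kd u = 1 \<or> kd u = 2 \<or> kd u = 4)" by linarith
  qed
  have "length (dd (\<lambda>_. 0) e) + (\<Sum>x\<in>vars \<alpha>. 0) \<le> 2 * card (vars \<alpha>)"
    by (rule length_dd) (use ke eU U_facts(5) in \<open>auto simp: regex.set_finite\<close>)
  then have ld: "10 * int (length d) \<le> step_cost - 60" by (simp add: e(2) step_cost_def)
  define s1 where "s1 = put (put (put (put (put s xA 0 a) xT 0 q) xPtr 0 (s aLst q)) xB 0 0)
    xU 0 (s aAe (s aLst q))"
  have "wp scan (wp (Asg xT (Ar aTt (V xT)) ;;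
    Ite (Mi (V xLen) (V xI))
      (Ite (V xB)
        (Asg xX (Ar aLb (V xB)) ;; Asg xJ (Ar aS (V xX)) ;; Asg xEnd (Ar aE (V xX)) ;;
         Asg xSt (V xB) ;; compare)
        (Ite (V xT) (Asg xSt (V xT) ;; incr xI) (Asg xGo (N 0))))
      (Asg xGo (N 0) ;; Ite (V xB) Skip (Asg xRes (V xT)))) R) s1 is (b - 5)"
  proof (rule wp_scan[where d = d and p = "s aLst q" and i = ?i and x = b0 and M' = M'], goal_cases)
    case (11 s2 b2)
    have x2: "s2 j = s j" if "j \<notin> {xA, xT, xX, xU, xPtr, xB, aS, aE}" for j
      using 11(1) that by (simp add: s1_def)
    have T2: "s2 xT 0 = q" "s2 xB 0 = b0" "(s2 aS, s2 aE) = M'" using 11 by (auto simp: s1_def)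
    have mf: "match_frame s s2" using x2 by (simp add: match_frame_def)
    have b2: "b - step_cost + 47 \<le> b2" using 11(4) ld by simp
    have sc: "60 \<le> step_cost" by (simp add: step_cost_def)
    show ?case
    proof (cases "?i < length w")
      case i: True
      show ?thesis
      proof (cases "b0 = 0")
        case False
        let ?S = "fst M' (lb b0)" and ?E = "snd M' (lb b0)"
        note sb = step_blocked[OF c i e(1) run[unfolded e(2)] False refl refl]
        define s3 where "s3 = put (put (put (put (put s2 xT 0 (s aTt q)) xX 0 (lb b0)) xJ 0 ?S) xEnd 0 ?E) xSt 0 b0"
        have "wp compare R s3 is (b2 - 7)"
        proof (rule wp_compare[where w = w and d = "?E - ?S"], goal_cases)
          case (6 s4 b4)
          note f = 6
          have x4: "s4 j = s3 j" if "j \<notin> {xI, xJ, xEnd, xGo}" for j using f(1) that by simp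
          have s4: "s4 xRes 0 = 0" "s4 xSt 0 = b0" "(s4 aS, s4 aE) = M'" "s3 xI 0 = ?i" "s3 xJ 0 = ?S"
            using x4 x2 T2 go by (auto simp: s3_def)
          have "match_frame s s4" using x4 x2 by (simp add: match_frame_def s3_def)
          moreover have bb: "b - step_cost + 34 - 4 * int (s4 xI 0 - ?i) \<le> b4"
            using f(5) b2 s4 by simp
          moreover have "s4 xGo 0 = 1 \<and> s4 xRes 0 = 0 \<and> (\<exists>r. conf w r (s4 xSt 0) (s4 xI 0) (s4 aS, s4 aE)) \<and>
              2 < kd (s4 xSt 0) \<and> ?i < s4 xI 0 \<and> b - step_cost * int (s4 xI 0 - ?i) \<le> b4"
            if eq: "take (?E - ?S) (drop ?i w) = take (?E - ?S) (drop ?S w)"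
          proof -
            have g: "s4 xGo 0 = 1" "s4 xI 0 = ?i + (?E - ?S)" using f(4) eq s4 by auto
            have "1 \<le> int (s4 xI 0 - ?i)" using g sb(3) by simp
            from step_cost_mult[OF this] have "b - step_cost * int (s4 xI 0 - ?i) \<le> b4" using bb by simp
            then show ?thesis using sb(2,3,5) eq g s4 by auto
          qed
          moreover have "s4 xGo 0 = 0 \<and> (s4 xRes 0 \<noteq> 0 \<longleftrightarrow> w \<in> language \<alpha>) \<and>
              b - step_cost * (int (length w - ?i) + 1) \<le> b4"
            if ne: "take (?E - ?S) (drop ?i w) \<noteq> take (?E - ?S) (drop ?S w)"
          proof -
            have "int (s4 xI 0 - ?i) \<le> int (length w - ?i)" using f(3) by simp
            moreover have "step_cost - 4 + 4 * (int (length w - ?i) + 1) \<le> step_cost * (int (length w - ?i) + 1)"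
              by (rule step_cost_mult) simp
            \<comment> \<open>The product with \<open>step_cost\<close> is abstracted to
              \<open>z\<close>, which leaves a linear problem.\<close>
            moreover have "x \<le> y \<Longrightarrow> step_cost - 4 + 4 * (y + 1) \<le> z \<Longrightarrow>
                b - step_cost + 34 - 4 * x \<le> b4 \<Longrightarrow> b - z \<le> b4" for x y z :: int
              by (smt (verit))
            ultimately have "b - step_cost * (int (length w - ?i) + 1) \<le> b4" using bb by blast
            then show ?thesis using f(4) sb(5) ne s4 by auto
          qed
          ultimately show ?case by (intro cont) blast+
        qed (use sb(3,4) i W x2 go in \<open>auto simp: s3_def\<close>)
        moreover have "s2 aLb = lb" "s2 aTt = s aTt" "s2 xLen = s xLen" "s2 xI = s xI"
          using x2 tt by auto
        moreover have "s2 aS = fst M'" "s2 aE = snd M'" using T2(3) by auto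
        ultimately show ?thesis using False i T2(1,2) W by (simp add: s3_def)
      next
        case b0: True
        show ?thesis
        proof (cases "s aTt q = 0")
          case True
          have "w \<notin> language \<alpha>"
            using step_none[OF c i _ run[unfolded e(2) b0]] e(1) True a(2)[OF i] by simp
          moreover have "step_cost \<le> step_cost * (int (length w - ?i) + 1)"
            using sc by (simp add: algebra_simps)
          moreover have "match_frame s (put (put s2 xT 0 0) xGo 0 0)"
            using x2 by (simp add: match_frame_def)
          ultimately have "R (put (put s2 xT 0 0) xGo 0 0) is (b2 - 5)"
            using b2 x2 go by (intro cont) auto
          then show ?thesis using True b0 T2 i W x2 by simp
        next
          case False
          let ?s = "put (put (put s2 xT 0 (s aTt q)) xSt 0 (s aTt q)) xI 0 (Suc ?i)"
          note st = step_target[OF c i w _ run[unfolded e(2) b0] False]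
          have "entry ?v (w ! ?i) e (s aTt q)" using e(1) a(2)[OF i] by simp
          note st = st[OF this]
          have "match_frame s ?s" using x2 by (simp add: match_frame_def)
          moreover have "?s aS = fst M'" "?s aE = snd M'" using T2(3) by auto
          ultimately have "R ?s is (b2 - 6)"
            using st b2 x2 go by (intro cont disjI1) auto
          then show ?thesis using False b0 T2 i W x2 by simp
        qed
      qed
    next
      case False
      then have il: "?i = length w" using i by simp
      have fin: "w \<in> language \<alpha> \<longleftrightarrow> b0 = 0 \<and> s aTt q \<noteq> 0"
        by (rule step_final[of w r ?v "(s aS, s aE)" e _ b0 M'])
          (use c e(1) run a(3) il in \<open>auto simp: e(2)\<close>)
      define s3 where "s3 = put (put s2 xT 0 (s aTt q)) xGo 0 0"
      define s4 where "s4 = (if b0 = 0 then put s3 xRes 0 (s aTt q) else s3)"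
      have "R s4 is b'" if "b2 - 6 \<le> b'" for b'
      proof (rule cont)
        show "match_frame s s4" using x2 by (simp add: match_frame_def s4_def s3_def)
        have "s4 xGo 0 = 0" by (simp add: s4_def s3_def)
        moreover have "s4 xRes 0 \<noteq> 0 \<longleftrightarrow> w \<in> language \<alpha>"
          using fin go x2 by (auto simp: s4_def s3_def)
        ultimately show "s4 xGo 0 = 1 \<and> s4 xRes 0 = 0 \<and> (\<exists>r. conf w r (s4 xSt 0) (s4 xI 0) (s4 aS, s4 aE)) \<and>
            2 < kd (s4 xSt 0) \<and> ?i < s4 xI 0 \<and> b - step_cost * int (s4 xI 0 - ?i) \<le> b' \<or>
          s4 xGo 0 = 0 \<and> (s4 xRes 0 \<noteq> 0 \<longleftrightarrow> w \<in> language \<alpha>) \<and>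
            b - step_cost * (int (length w - ?i) + 1) \<le> b'"
          using that b2 il by auto
      qed
      from this[of "b2 - 4"] this[of "b2 - 5"] this[of "b2 - 3"] show ?thesis
        using T2 W x2 il by (auto simp: s4_def s3_def)
    qed
  qed (use tt e(3,4) kd run in \<open>auto simp: s1_def\<close>)
  then show ?thesis by (simp add: match_body_def s1_def a_def q_def)
qed

lemma wp_match_word:
  assumes t: "tabs s" and w: "set w \<subseteq> {..<\<sigma>}" and wi: "word_in s w" and td: "tables_done s (4 + fr \<alpha>)"
    and init: "s xSt 0 = 2" "kd 2 = 3" "s xI 0 = 0" "s xGo 0 = 1" "s xRes 0 = 0" "s aS = (\<lambda>_. 0)" "s aE = (\<lambda>_. 0)"
    and cont: "\<And>s' b'. (s' xRes 0 \<noteq> 0 \<longleftrightarrow> w \<in> language \<alpha>) \<Longrightarrow>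
      b - (step_cost + 1) * (int (length w) + 1) - 1 \<le> b' \<Longrightarrow> R s' is b'"
  shows "wp match_word R s is b"
  unfolding match_word_def
\<comment> \<open>The rate \<open>step_cost + 1\<close> includes the loop test, and the extra unit
  beside the length covers the step that stops.\<close>
proof (rule wp_While[where I = "\<lambda>s' is' b'. is' = is \<and> match_frame s s' \<and>
    (s' xGo 0 = 1 \<and> s' xRes 0 = 0 \<and> (\<exists>r. conf w r (s' xSt 0) (s' xI 0) (s' aS, s' aE)) \<and>
        2 < kd (s' xSt 0) \<and> b - (step_cost + 1) * int (s' xI 0) \<le> b' \<or>
     s' xGo 0 = 0 \<and> (s' xRes 0 \<noteq> 0 \<longleftrightarrow> w \<in> language \<alpha>) \<and>
        b - (step_cost + 1) * (int (length w) + 1) \<le> b')"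
    and M = "\<lambda>s'. if s' xGo 0 = 0 then 0 else length w + 1 - s' xI 0"], goal_cases)
  case 1
  then show ?case using init conf_start[of w] by (auto simp: match_frame_def)
next
  case (2 s2 is2 b2)
  then obtain r where go: "s2 xGo 0 = 1" "s2 xRes 0 = 0" and c: "conf w r (s2 xSt 0) (s2 xI 0) (s2 aS, s2 aE)"
    and k: "2 < kd (s2 xSt 0)" and b2: "b - (step_cost + 1) * int (s2 xI 0) \<le> b2"
    and mf: "match_frame s s2" and "is": "is2 = is" by auto
  have t2: "tabs s2" "word_in s2 w" using t wi mf by (auto simp: tabs_def word_in_def match_frame_def)
  have "s2 aRow = s aRow" "s2 xRp = s xRp" "s2 aTt = s aTt" "s2 aLst = s aLst" "s2 xAp = s xAp" "s2 aAe = s aAe"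
    using mf by (auto simp: match_frame_def)
  then have td2: "tables_done s2 (4 + fr \<alpha>)" using td by (simp add: tables_done_def has_def)
  have i: "s2 xI 0 \<le> length w" using c by (simp add: conf_def)
  show ?case unfolding "is"
  proof (rule wp_match_body[OF t2(1) w t2(2) td2 c k go], goal_cases)
    case (1 s3 b3)
    note f = 1
    have mf3: "match_frame s s3" using mf f(1) by (simp add: match_frame_def)
    from f(2) show ?case
    proof
      assume g: "s3 xGo 0 = 1 \<and> s3 xRes 0 = 0 \<and> (\<exists>r. conf w r (s3 xSt 0) (s3 xI 0) (s3 aS, s3 aE)) \<and>
        2 < kd (s3 xSt 0) \<and> s2 xI 0 < s3 xI 0 \<and> b2 - 1 - step_cost * int (s3 xI 0 - s2 xI 0) \<le> b3"
      then have "s3 xI 0 \<le> length w" by (auto simp: conf_def)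
      moreover have "b - (step_cost + 1) * int (s3 xI 0) \<le> b3"
      proof -
        obtain n where n: "s3 xI 0 = s2 xI 0 + n" "1 \<le> n"
          using g less_imp_Suc_add[of "s2 xI 0" "s3 xI 0"] by auto
        have "(step_cost + 1) * int (s3 xI 0) = (step_cost + 1) * int (s2 xI 0) + step_cost * int n + int n"
          unfolding n(1) by (simp add: algebra_simps)
        moreover have "step_cost * int (s3 xI 0 - s2 xI 0) = step_cost * int n" using n by simp
        ultimately show ?thesis using g b2 n(2) by linarith
      qed
      ultimately show ?thesis using g mf3 go by auto
    next
      assume g: "s3 xGo 0 = 0 \<and> (s3 xRes 0 \<noteq> 0 \<longleftrightarrow> w \<in> language \<alpha>) \<and>
        b2 - 1 - step_cost * (int (length w - s2 xI 0) + 1) \<le> b3"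
      have "b - (step_cost + 1) * (int (length w) + 1) \<le> b3"
      proof -
        obtain n where n: "length w = s2 xI 0 + n" using i le_Suc_ex by blast
        have "(step_cost + 1) * (int (length w) + 1) =
            (step_cost + 1) * int (s2 xI 0) + step_cost * (int n + 1) + int n + 1"
          unfolding n by (simp add: algebra_simps)
        moreover have "step_cost * (int (length w - s2 xI 0) + 1) = step_cost * (int n + 1)"
          using n by simp
        ultimately show ?thesis using g b2 by linarith
      qed
      then show ?thesis using g mf3 go i by auto
    qed
  qed
next
  case (3 s2 is2 b2)
  then have "R s2 is (b2 - 1)" by (intro cont) auto
  then show ?case using 3 by simp
qed

end

section \<open>The time bound\<close>

lemma card_vars_le: "card (vars \<alpha>) \<le> regex_length \<alpha>"
proof (induction \<alpha>)
  case (Cat \<alpha> \<beta>)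
  then show ?case using card_Un_le[of "vars \<alpha>" "vars \<beta>"] by simp
next
  case (Alt \<alpha> \<beta>)
  then show ?case using card_Un_le[of "vars \<alpha>" "vars \<beta>"] by simp
next
  case (Bind x \<alpha>)
  then show ?case using card_insert_le_m1[of "Suc (card (vars \<alpha>))" "vars \<alpha>" x] by simp
qed auto

lemma regex_length_pos: "1 \<le> regex_length \<alpha>"
  by (cases \<alpha>) auto

text \<open>Products such as \<sigma> times the length are variables here, so that only linear
  arithmetic remains; the same holds for the next two lemmas.\<close>

lemma state_cost_arith:
  fixes X Y A s F :: int
  assumes "X \<le> 40 * Y + 40 * A + 75 * s + 75" "2 * A + s - 2 \<le> Y" "2 \<le> s" "1 \<le> A" "F \<le> 2 * A"
  shows "3 * s + 82 * (F + 2) + X + 60 \<le> 700 * Y"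
  using assms by (smt (verit))

lemma total_cost_arith:
  fixes X Y A s F S T KL l :: int
  assumes "X \<le> 1400 * S" "Y \<le> 81 * KL + 81 * A" "l \<le> KL" "2 * A + s - 2 \<le> T" "T \<le> S"
    "2 \<le> s" "1 \<le> A" "F \<le> 2 * A" "0 \<le> l"
  shows "40 * A + X + 5 * (F + 2) + 4 * l + Y + 40 \<le> 2000 * (S + KL)"
  using assms by (smt (verit))

lemma budget_arith:
  fixes A P F l D K :: int
  assumes "40 * A + P + 5 * F + 4 * l + D + 40 \<le> K" "K = B" "SC = P" "D' = D" "F' = F"
    "b3 - 4 * l - 4 \<le> b4" "b1 - 3 - SC - 5 * F' - 1 \<le> b3" "B - 9 - 40 * A \<le> b1"
  shows "0 \<le> b4 - 3 - D' - 1"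
  using assms by linarith

lemma total_cost_le:
  fixes \<sigma> A F m n k \<kappa> l :: int
  assumes "2 \<le> \<sigma>" "1 \<le> A" "0 \<le> F" "F \<le> 2 * A" "1 \<le> m" "n \<le> m" "0 \<le> n" "1 \<le> \<kappa>" "\<kappa> \<le> A" "k \<le> \<kappa>" "0 \<le> k" "0 \<le> l"
  shows "40 * A + (3 * \<sigma> + 82 * (F + 2) + (20 * (F + 2) + 35) * (\<sigma> + 1) + 60) * (n + 1) + 5 * (F + 2) +
    4 * l + (61 + 20 * k) * (l + 1) + 40 \<le> 2000 * (\<sigma> * A * m + \<kappa> * l)"
proof -
  \<comment> \<open>This is where an alphabet of at least two letters enters: separate summands for
    the length and for \<sigma> are absorbed by their product.\<close>
  have p: "0 \<le> (\<sigma> - 2) * (A - 1)" using assms by simp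
  then have sA: "2 * A + \<sigma> - 2 \<le> \<sigma> * A" by (simp add: algebra_simps)
  have S: "\<sigma> * A \<le> \<sigma> * A * m" using mult_left_mono[of 1 m "\<sigma> * A"] assms by simp
  have "(20 * (F + 2) + 35) * (\<sigma> + 1) \<le> (40 * A + 75) * (\<sigma> + 1)"
    using assms by (intro mult_right_mono) auto
  also have "\<dots> = 40 * (\<sigma> * A) + 40 * A + 75 * \<sigma> + 75" by (simp add: algebra_simps)
  finally have sc: "3 * \<sigma> + 82 * (F + 2) + (20 * (F + 2) + 35) * (\<sigma> + 1) + 60 \<le> 700 * (\<sigma> * A)"
    using state_cost_arith[OF _ sA] assms by blast
  have n: "n + 1 \<le> 2 * m" using assms by simp
  have sc0: "0 \<le> 3 * \<sigma> + 82 * (F + 2) + (20 * (F + 2) + 35) * (\<sigma> + 1) + 60" using assms by simp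
  have "(3 * \<sigma> + 82 * (F + 2) + (20 * (F + 2) + 35) * (\<sigma> + 1) + 60) * (n + 1) \<le> 700 * (\<sigma> * A) * (2 * m)"
    by (rule mult_mono[OF sc n]) (use assms in auto)
  then have 1: "(3 * \<sigma> + 82 * (F + 2) + (20 * (F + 2) + 35) * (\<sigma> + 1) + 60) * (n + 1) \<le>
      1400 * (\<sigma> * A * m)" by (simp add: algebra_simps)
  \<comment> \<open>The one step beyond the length of the word costs a multiple of the number of
    variables, which is at most the length of the regex and hence absorbed by the first summand of
    the bound.\<close>
  have "(61 + 20 * k) * (l + 1) \<le> (81 * \<kappa>) * (l + 1)" using assms by (intro mult_right_mono) auto
  then have 2: "(61 + 20 * k) * (l + 1) \<le> 81 * (\<kappa> * l) + 81 * A" using assms by (simp add: algebra_simps)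
  have 3: "l \<le> \<kappa> * l" using mult_right_mono[of 1 \<kappa> l] assms by simp
  show ?thesis by (rule total_cost_arith[OF 1 2 3 sA S]) (use assms in auto)
qed

lemma cok_recognizer: "cok recognizer"
  by (simp add: recognizer_def parse_loop_def parse_body_def vertex_def push_def tables_def
      state_body_def explore_def explore_body_def visit_def rows_def row_def collect_path_def
      emit_events_def event_def append_event_def read_word_def match_word_def match_body_def scan_def
      compare_def neq_def next_event_def eok_def Let_def)

text \<open>The token 0 is laid out like \<open>Eps\<close>, since truncated differences do not
  separate 0 from 1. The final test of the token then skips the matching.\<close>

lemma wp_recognizer_Empty:
  "wp recognizer (\<lambda>s is b. 0 \<le> b \<and> (s xRes 0 \<noteq> 0 \<longleftrightarrow> False)) (\<lambda>_ _. 0) (encode_instance \<sigma> Empty w) (int 60)"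
proof -
  have loop: "wp parse_loop Q s is b"
    if "s xSp 0 = 0" "Q s is (b - 1)" for Q s "is" b
    using that unfolding parse_loop_def by (intro wp_While_done) auto
  show ?thesis
    unfolding recognizer_def encode_instance_def
    apply simp
    apply (rule parse_loop_step, simp)
    apply (simp add: parse_simps)
    apply (rule loop)
     apply simp_all
    done
qed

lemma wp_recognizer:
  assumes \<sigma>: "2 \<le> \<sigma>" and ne: "is_nonempty_regex \<alpha>" and lits: "lits \<alpha> \<subseteq> {..<\<sigma>}"
    and det: "deterministic \<alpha>" and w: "set w \<subseteq> {..<\<sigma>}"
  shows "wp recognizer (\<lambda>s is b. 0 \<le> b \<and> (s xRes 0 \<noteq> 0 \<longleftrightarrow> w \<in> language \<alpha>)) (\<lambda>_ _. 0)
    (encode_instance \<sigma> \<alpha> w) (int (2000 * time_bound \<sigma> \<alpha> (length w)))"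
proof -
  let ?B = "int (2000 * time_bound \<sigma> \<alpha> (length w))"
  let ?R = "\<lambda>s is b. 0 \<le> b \<and> (s xRes 0 \<noteq> 0 \<longleftrightarrow> w \<in> language \<alpha>)"
  let ?z = "\<lambda>_ _. 0 :: nat"
  define s0 where "s0 = put (put (put (put (put (put (put (put (put ?z xSig 0 \<sigma>) aKd 1 3) aLb 1 \<sigma>)
    aKd 2 3) aNx 2 3) aSV 0 3) aSK 0 1) xSp 0 1) xFr 0 4"
  have "wp parse_loop (wp (Ite (V xTok)
      (Asg xSt (N 2) ;; tables ;; read_word ;;
       Asg xSt (N 2) ;; Asg xI (N 0) ;; Asg xGo (N 1) ;; match_word)
      Skip) ?R) s0 (encode_regex \<alpha> @ [length w] @ w) (?B - 9)"
  proof (rule wp_parse_loop[OF ne, where q = 0 and v = 3 and k = 1 and f = 4], goal_cases)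
    case (7 s1 b1)
    note p = 7(1)[unfolded parsed_def]
    have fr: "frag (s1 aKd) (s1 aLb) (s1 aNx) (s1 aNy) \<alpha> 3 1 4" using p by blast
    have out: "s1 aKd u = s0 aKd u \<and> s1 aLb u = s0 aLb u \<and> s1 aNx u = s0 aNx u \<and> s1 aNy u = s0 aNy u"
      if "u = 1 \<or> u = 2" for u
      using p that by (auto simp: vs_def)
    have x1: "s1 j = s0 j" if "13 < j" for j using p that by blast
    \<comment> \<open>The locale is instantiated with the arrays left by the parser; vertices 1 and
      2 lie outside the layout and keep their initial values.\<close>
    interpret det_graph "s1 aKd" "s1 aLb" "s1 aNx" "s1 aNy" \<alpha> \<sigma>
      by unfold_locales (use ne fr lits det out[of 1] out[of 2] in \<open>auto simp: s0_def\<close>)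
    have sig: "s1 xSig 0 = \<sigma>" using x1 by (simp add: s0_def)
    have kd2: "s1 aKd 2 = 3" using out[of 2] by (simp add: s0_def)
    have fr1: "s1 xFr 0 = 4 + fr \<alpha>" "s1 xTok 0 \<noteq> 0" using p by blast+
    have z1: "s1 aVis = (\<lambda>_. 0)" "s1 aMk = (\<lambda>_. 0)" using x1 by (simp_all add: s0_def)
    let ?s2 = "put s1 xSt 0 2"
    have "wp tables (wp read_word (wp (Asg xSt (N 2)) (wp (Asg xI (N 0)) (wp (Asg xGo (N 1))
        (wp match_word ?R))))) ?s2 (length w # w) (b1 - 3)"
    proof (rule wp_tables, goal_cases)
      case (6 s3 b3)
      note t3 = 6
      show ?case
      proof (rule wp_read_word, goal_cases)
        case (1 s4 b4)
        note r4 = 1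
        define s5 where "s5 = put (put (put s4 xSt 0 2) xI 0 0) xGo 0 1"
        have x3: "s3 j = s1 j" if "j < 14 \<or> 37 < j" for j using t3(1) that by auto
        have x4: "s4 j = s3 j" if "j \<notin> {xLen, xI, xB, aW}" for j using r4(1) that by simp
        have z: "s5 xRes 0 = 0" "s5 aS = (\<lambda>_. 0)" "s5 aE = (\<lambda>_. 0)"
          using x1 x3 x4 by (auto simp: s5_def s0_def)
        have "tabs s5" using x3 x4 sig by (simp add: tabs_def s5_def)
        moreover have "word_in s5 w" using r4(2-4) x3 sig by (simp add: word_in_def s5_def)
        moreover have "tables_done s5 (4 + fr \<alpha>)"
        proof -
          have "s5 aRow = s3 aRow" "s5 xRp = s3 xRp" "s5 aTt = s3 aTt" "s5 aLst = s3 aLst"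
            "s5 xAp = s3 xAp" "s5 aAe = s3 aAe" using x4 by (auto simp: s5_def)
          then show ?thesis using t3(2) by (simp add: tables_done_def has_def)
        qed
        moreover have "0 \<le> b4 - 3 - (step_cost + 1) * (int (length w) + 1) - 1"
        proof -
          let ?m = "max 1 (occurrences \<alpha>)" and ?\<kappa> = "max 1 (card (vars \<alpha>))" and ?A = "regex_length \<alpha>"
          have c1: "40 * int ?A + (3 * int \<sigma> + 82 * (int (fr \<alpha>) + 2) + (20 * (int (fr \<alpha>) + 2) + 35) * (int \<sigma> + 1) + 60) *
              (int (occurrences \<alpha>) + 1) + 5 * (int (fr \<alpha>) + 2) + 4 * int (length w) +
              (61 + 20 * int (card (vars \<alpha>))) * (int (length w) + 1) + 40
            \<le> 2000 * (int \<sigma> * int ?A * int ?m + int ?\<kappa> * int (length w))"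
            using \<sigma> is_nonempty_regex_size[OF ne] regex_length_pos[of \<alpha>] card_vars_le[of \<alpha>]
            by (intro total_cost_le) auto
          have c2: "2000 * (int \<sigma> * int ?A * int ?m + int ?\<kappa> * int (length w)) = ?B"
            by (simp add: time_bound_def)
          have c3: "state_cost * int (occurrences \<alpha> + 1) =
              (3 * int \<sigma> + 82 * (int (fr \<alpha>) + 2) + (20 * (int (fr \<alpha>) + 2) + 35) * (int \<sigma> + 1) + 60) *
              (int (occurrences \<alpha>) + 1)" by (simp add: state_cost_def add.commute)
          have c4: "(step_cost + 1) * (int (length w) + 1) =
              (61 + 20 * int (card (vars \<alpha>))) * (int (length w) + 1)" by (simp add: step_cost_def)
          have c5: "int (fr \<alpha> + 2) = int (fr \<alpha>) + 2" by simp
          show ?thesis by (rule budget_arith[OF c1 c2 c3 c4 c5 r4(5) t3(3) 7(2)])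
        qed
        ultimately have "wp match_word ?R s5 [] (b4 - 3)"
          using z kd2 w
          by (intro wp_match_word[where w = w and R = ?R]) (auto simp: s5_def)
        then show ?case by (simp add: s5_def)
      qed
    qed (use fr1 z1 sig in \<open>simp_all add: tabs_def\<close>)
    moreover have "s1 xSp 0 = 0" using p by blast
    ultimately show ?case
      using fr1 unfolding parse_loop_def by (intro wp_While_done) (simp_all add: wp_Seq_fun)
  qed (auto simp: s0_def)
  then show ?thesis
    by (simp add: recognizer_def encode_instance_def s0_def)
qed

theorem theorem5:
  shows "\<exists>(P :: instr list) (c :: nat).
    \<forall>(\<sigma> :: nat) (\<alpha> :: (nat, nat) regex) (w :: nat list).
      2 \<le> \<sigma> \<and> is_regex \<alpha> \<and> lits \<alpha> \<subseteq> {..<\<sigma>} \<and> deterministic \<alpha> \<and> set w \<subseteq> {..<\<sigma>} \<longrightarrow>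
      ram_result P (c * time_bound \<sigma> \<alpha> (length w)) (encode_instance \<sigma> \<alpha> w)
        = Some (w \<in> language \<alpha>)"
proof (intro exI[of _ "decider recognizer xRes"] exI[of _ "length (ccom 0 recognizer) * 2000 + 2"]
    allI impI)
  fix \<sigma> :: nat and \<alpha> :: "(nat, nat) regex" and w :: "nat list"
  assume *: "2 \<le> \<sigma> \<and> is_regex \<alpha> \<and> lits \<alpha> \<subseteq> {..<\<sigma>} \<and> deterministic \<alpha> \<and> set w \<subseteq> {..<\<sigma>}"
  let ?len = "length (ccom 0 recognizer)" and ?tb = "time_bound \<sigma> \<alpha> (length w)"
  have "1 \<le> \<sigma> * regex_length \<alpha> * max 1 (occurrences \<alpha>)"
    using * regex_length_pos[of \<alpha>] by (simp add: Suc_le_eq)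
  \<comment> \<open>The bound never vanishes, so constant costs are absorbed by the factor: 60 for
    \<open>Empty\<close>, and 2 for the final test and verdict.\<close>
  then have tb: "1 \<le> ?tb" unfolding time_bound_def by (rule trans_le_add1)
  have "wp recognizer (\<lambda>s is b. 0 \<le> b \<and> (s xRes 0 \<noteq> 0 \<longleftrightarrow> w \<in> language \<alpha>)) (\<lambda>_ _. 0)
      (encode_instance \<sigma> \<alpha> w) (int t)" if "t = (if \<alpha> = Empty then 60 else 2000 * ?tb)" for t
  proof (cases "\<alpha> = Empty")
    case True
    then show ?thesis using wp_recognizer_Empty[of \<sigma> w] that by (simp add: language_def)
  next
    case False
    then show ?thesis using wp_recognizer[of \<sigma> \<alpha> w] * that by (simp add: is_regex_def)
  qed
  note wp = this[OF refl]
  have "(if \<alpha> = Empty then 60 else 2000 * ?tb) \<le> 2000 * ?tb" using tb by auto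
  then have "?len * (if \<alpha> = Empty then 60 else 2000 * ?tb) \<le> ?len * (2000 * ?tb)"
    by (rule mult_le_mono2)
  moreover have "(?len * 2000 + 2) * ?tb = ?len * (2000 * ?tb) + 2 * ?tb"
    by (simp add: algebra_simps)
  ultimately have "?len * (if \<alpha> = Empty then 60 else 2000 * ?tb) + 2 \<le> (?len * 2000 + 2) * ?tb"
    using tb by linarith
  from ram_result_decider[OF cok_recognizer _ wp this]
  show "ram_result (decider recognizer xRes) ((?len * 2000 + 2) * ?tb) (encode_instance \<sigma> \<alpha> w)
      = Some (w \<in> language \<alpha>)"
    by simp
qed

end
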